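(* Let $0<\alpha\le 1$. There is a constant $c>0$ depending only on $\alpha$ such that the following holds. Let $a=\{a_k\}_{k\ge 1}\subset\mathbb{D}$ be a sequence satisfying $$\delta(a)=\inf_{n\ge 1}\ \prod_{k\ne n}\left|\frac{a_k-a_n}{1-\overline{a_k}a_n}\right|>0$$ and $$\sigma_\alpha(a)=\sup_{|\xi|=1}\ \sum_{k\ge 1}\left(\frac{1-|a_k|^2}{|1-\overline{\xi}a_k|}\right)^{\alpha}<\infty .$$ Then for each sequence $x=\{x_k\}_{k\ge 1}\in\ell^\infty$ there is a function $f\in m_\alpha$ such that (a) $f(a_k)=x_k$ for all $k=1,2,\dots$; (b) $\displaystyle \|f\|_{m_\alpha}\le c\left(\frac{\sigma_\alpha(a)}{\delta(a)}\right)^2\|x\|_{\ell^\infty}$.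
   Context: $\mathbb{D}$ is the open unit disk in the complex plane and $\mathbb{T}$ is the unit circle. $M$ is the Banach space of all complex-valued Borel measures on $\mathbb{T}$ with the total variation norm $\|\mu\|$. The space $\ell^\infty$ consists of bounded complex sequences with the supremum norm. For $\alpha>0$, $\mathcal{F}_\alpha$ is the family of functions $g$ on $\mathbb{D}$ for which there exists $\mu\in M$ such that $$g(z)=\int_{\mathbb{T}}\frac{1}{(1-\overline{\xi}z)^{\alpha}}\,d\mu(\xi),\qquad z\in\mathbb{D},$$ where the power is the principal branch. It is a Banach space with the norm $\|g\|_{\mathcal{F}_\alpha}=\inf\|\mu\|$, the infimum being over all $\mu\in M$ representing $g$ in this way. A function $f$ holomorphic in $\mathbb{D}$ is a multiplier of $\mathcal{F}_\alpha$ if $fg\in\mathcal{F}_\alpha$ for every $g\in\mathcal{F}_\alpha$. The set of multipliers of $\mathcal{F}_\alpha$ is denoted $m_\alpha$, with norm $$\|f\|_{m_\alpha}=\sup\{\|fg\|_{\mathcal{F}_\alpha}:\ \|g\|_{\mathcal{F}_\alpha}\le 1\}.$$ *)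

theory Defs
  imports "HOL-Complex_Analysis.Complex_Analysis"
begin

text \<open>
  A complex measure on a measurable space \<open>M\<close> is a countably additive complex-valued function on
  \<open>sets M\<close>; only the \<open>\<sigma>\<close>-algebra of \<open>M\<close> is used, and the values of \<open>\<mu>\<close> outside \<open>sets M\<close> are
  irrelevant throughout.
\<close>

definition complex_measure :: "'a measure \<Rightarrow> ('a set \<Rightarrow> complex) \<Rightarrow> bool" where
  "complex_measure M \<mu> \<longleftrightarrow> \<mu> {} = 0 \<and>
     (\<forall>A :: nat \<Rightarrow> 'a set. range A \<subseteq> sets M \<and> disjoint_family A \<longrightarrow>
        (\<lambda>i. \<mu> (A i)) sums \<mu> (\<Union>i. A i))"

definition total_variation :: "'a measure \<Rightarrow> ('a set \<Rightarrow> complex) \<Rightarrow> ennreal" where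
  "total_variation M \<mu> =
     (SUP A \<in> {A :: nat \<Rightarrow> 'a set. range A \<subseteq> sets M \<and> disjoint_family A \<and> (\<Union>i. A i) = space M}.
        \<Sum>i. ennreal (norm (\<mu> (A i))))"

text \<open>
  The positive part in the Jordan decomposition of a real signed measure \<open>\<nu>\<close>. Clipping negative
  values of \<open>\<nu> A\<close> to \<open>0\<close> by \<^const>\<open>ennreal\<close> does not change the supremum, since \<open>\<nu> {} = 0\<close>. The
  negative part is the positive part of \<open>- \<nu>\<close>.
\<close>

definition upper_variation :: "'a measure \<Rightarrow> ('a set \<Rightarrow> real) \<Rightarrow> 'a measure" where
  "upper_variation M \<nu> =
     measure_of (space M) (sets M) (\<lambda>E. SUP A \<in> {A \<in> sets M. A \<subseteq> E}. ennreal (\<nu> A))"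

definition complex_measure_integral ::
    "'a measure \<Rightarrow> ('a set \<Rightarrow> complex) \<Rightarrow> ('a \<Rightarrow> complex) \<Rightarrow> complex" where
  "complex_measure_integral M \<mu> f =
     (integral\<^sup>L (upper_variation M (\<lambda>A. Re (\<mu> A))) f
       - integral\<^sup>L (upper_variation M (\<lambda>A. - Re (\<mu> A))) f)
     + \<i> * (integral\<^sup>L (upper_variation M (\<lambda>A. Im (\<mu> A))) f
       - integral\<^sup>L (upper_variation M (\<lambda>A. - Im (\<mu> A))) f)"

definition circle_borel :: "complex measure" where
  "circle_borel = restrict_space borel (sphere 0 1)"

definition represents :: "real \<Rightarrow> (complex set \<Rightarrow> complex) \<Rightarrow> (complex \<Rightarrow> complex) \<Rightarrow> bool" where
  "represents \<alpha> \<mu> g \<longleftrightarrow> complex_measure circle_borel \<mu> \<and>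
     (\<forall>z \<in> ball 0 1. g z = complex_measure_integral circle_borel \<mu>
        (\<lambda>\<xi>. 1 / (1 - cnj \<xi> * z) powr complex_of_real \<alpha>))"

text \<open>
  Functions on the unit disk are total functions on \<^typ>\<open>complex\<close> of which only the values on
  \<^term>\<open>ball 0 1 :: complex set\<close> matter. Norms take values in \<^typ>\<open>ennreal\<close>, so that no supremum
  or infimum needs a side condition; \<open>F_norm \<alpha> g = \<infinity>\<close> if \<open>g\<close> has no representing measure.
\<close>

definition F_space :: "real \<Rightarrow> (complex \<Rightarrow> complex) set" where
  "F_space \<alpha> = {g. \<exists>\<mu>. represents \<alpha> \<mu> g}"

definition F_norm :: "real \<Rightarrow> (complex \<Rightarrow> complex) \<Rightarrow> ennreal" where
  "F_norm \<alpha> g = (INF \<mu> \<in> {\<mu>. represents \<alpha> \<mu> g}. total_variation circle_borel \<mu>)"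

definition multipliers :: "real \<Rightarrow> (complex \<Rightarrow> complex) set" where
  "multipliers \<alpha> = {f. f holomorphic_on ball 0 1 \<and>
     (\<forall>g \<in> F_space \<alpha>. (\<lambda>z. f z * g z) \<in> F_space \<alpha>)}"

definition multiplier_norm :: "real \<Rightarrow> (complex \<Rightarrow> complex) \<Rightarrow> ennreal" where
  "multiplier_norm \<alpha> f =
     (SUP g \<in> {g \<in> F_space \<alpha>. F_norm \<alpha> g \<le> 1}. F_norm \<alpha> (\<lambda>z. f z * g z))"

text \<open>
  Sequences \<open>(a\<^sub>k)\<close> with \<open>k \<ge> 1\<close> are indexed from \<open>0\<close> instead. The infinite product is the limit of
  its partial products, which exists because all factors lie in \<open>[0,1]\<close> for points of the disk.
  \<^const>\<open>prodinf\<close> would not do: it is unspecified when the partial products of non-zero factors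
  tend to \<open>0\<close>, whereas the product has to be \<open>0\<close> in that case.
\<close>

definition separation_const :: "(nat \<Rightarrow> complex) \<Rightarrow> real" where
  "separation_const a =
     (INF n. lim (\<lambda>N. \<Prod>k \<in> {..<N} - {n}. norm ((a k - a n) / (1 - cnj (a k) * a n))))"

definition carleson_sum :: "real \<Rightarrow> (nat \<Rightarrow> complex) \<Rightarrow> ennreal" where
  "carleson_sum \<alpha> a =
     (SUP \<xi> \<in> sphere 0 1. \<Sum>k. ennreal (((1 - (norm (a k))\<^sup>2) / norm (1 - cnj \<xi> * a k)) powr \<alpha>))"

end

theory Submission
  imports Defs
begin

text \<open>
  The interpolating function is a sum \<open>f(z) = \<Sum>\<^sub>i d\<^sub>i / (1 - cnj a\<^sub>i z)\<close> with
  \<open>\<bar>d\<^sub>i\<bar> \<le> C (1 - \<bar>a\<^sub>i\<bar>\<^sup>2)\<close> and \<open>C = 4 \<sigma> \<parallel>x\<parallel> / \<delta>\<^sup>2\<close>. For the first \<open>N\<close> points the coefficients come from the explicit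
  inverse of the Cauchy matrix \<open>1 / (1 - cnj a\<^sub>i a\<^sub>l)\<close>, whose entries involve the Blaschke products that
  \<open>\<delta>\<close> bounds from below; then a diagonal subsequence is taken.

  It remains to see that \<open>1 / ((1 - cnj a z) (1 - cnj \<xi> z)\<^sup>\<alpha>)\<close> has norm at most a constant times
  \<open>\<bar>1 - cnj a \<xi>\<bar>\<^sup>-\<^sup>\<alpha> (1 - \<bar>a\<bar>)\<^sup>\<alpha>\<^sup>-\<^sup>1\<close>, for then summation over the points costs one more factor \<open>\<sigma>\<close>.
  Write \<open>k\<^sub>w(z) = (1 - cnj w z)\<^sup>-\<^sup>\<alpha>\<close> and \<open>w\<^sub>s = a + s (\<xi> - a)\<close>. Integrating a total derivative in \<open>s\<close> gives the
  product as \<open>1 / (1 - cnj a \<xi>)\<close> times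
  \<open>k\<^sub>\<xi> - cnj a \<xi> k\<^sub>a + cnj a \<xi> (1 - \<alpha>) \<integral> s\<^sup>\<alpha>\<^sup>-\<^sup>2 (k\<^sub>w\<^sub>s - k\<^sub>a) ds\<close>, where \<open>s\<close> runs over \<open>[0, 1]\<close>. Each \<open>k\<^sub>w\<close> with \<open>\<bar>w\<bar> \<le> 1\<close> has norm at
  most 1, being the average of \<open>k\<^sub>\<eta>\<close> over the harmonic measure at \<open>w\<close>, and Cauchy's formula shows
  that \<open>k\<^sub>w - k\<^sub>a\<close> has norm \<open>O(\<bar>w - a\<bar> / (1 - \<bar>a\<bar>))\<close> when \<open>w\<close> is near \<open>a\<close>.
\<close>

section \<open>Signed and complex measures\<close>

text \<open>For \<alpha> < 1 the factor \<open>s powr (\<alpha> - 2)\<close> in the chord formula is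
  not integrable at 0, so the two kernels there may not be integrated separately; only their
  difference, of norm O(s), compensates it. Hence the estimates for differences assume integrability
  of the coefficient times \<open>min 1 (norm (w - a) / (1 - norm a))\<close> rather than of the
  coefficient itself. Infinite sums and integrals of functions are written as integrals of kernels
  over sigma-finite parameter spaces, with counting measure for the indices; Fubini then turns
  bounds of norms into bounds of masses. The weight of one fraction, multiplied by
  \<open>1 - (norm a)\<^sup>2\<close>, is at most twice the term of \<sigma> at \<xi>, which is why
  the coefficients must be that small. Their bound takes \<delta> twice because an entry of the
  inverse contains two Blaschke products, and \<sigma> once because a weighted row sum of the Cauchy
  matrix is a Carleson sum with exponent 1; on the circle its terms are at most 2, so for \<alpha>
  \<le> 1 the sum with exponent \<alpha> controls it.\<close>

definition signed_measure :: "'a measure \<Rightarrow> ('a set \<Rightarrow> real) \<Rightarrow> bool" where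
  "signed_measure M \<nu> \<longleftrightarrow> \<nu> {} = 0 \<and>
     (\<forall>A :: nat \<Rightarrow> 'a set. range A \<subseteq> sets M \<and> disjoint_family A \<longrightarrow>
        (\<lambda>i. \<nu> (A i)) sums \<nu> (\<Union>i. A i))"

lemma signed_measure_sums:
  assumes "signed_measure M \<nu>" "range A \<subseteq> sets M" "disjoint_family A"
  shows "(\<lambda>i. \<nu> (A i)) sums \<nu> (\<Union>i. A i)"
  using assms unfolding signed_measure_def by blast

lemma signed_measure_uminus:
  "signed_measure M \<nu> \<Longrightarrow> signed_measure M (\<lambda>A. - \<nu> A)"
  unfolding signed_measure_def by (auto intro: sums_minus)

lemma complex_measure_Re: "complex_measure M \<mu> \<Longrightarrow> signed_measure M (\<lambda>A. Re (\<mu> A))"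
  unfolding signed_measure_def complex_measure_def by (auto intro: sums_Re)

lemma complex_measure_Im: "complex_measure M \<mu> \<Longrightarrow> signed_measure M (\<lambda>A. Im (\<mu> A))"
  unfolding signed_measure_def complex_measure_def by (auto intro: sums_Im)

lemma signed_measure_Un:
  assumes \<nu>: "signed_measure M \<nu>" and "A \<in> sets M" "B \<in> sets M" "A \<inter> B = {}"
  shows "\<nu> (A \<union> B) = \<nu> A + \<nu> B"
proof -
  have "(\<lambda>i. \<nu> (binaryset A B i)) sums \<nu> (\<Union>i. binaryset A B i)"
    using assms by (intro signed_measure_sums[OF \<nu>]) (auto simp: disjoint_family_on_def binaryset_def)
  moreover have "(\<lambda>i. \<nu> (binaryset A B i)) sums (\<nu> A + \<nu> B)"
    using \<nu> unfolding signed_measure_def by (intro binaryset_sums) auto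
  ultimately show ?thesis
    by (simp add: UN_binaryset_eq sums_unique2)
qed

lemma signed_measure_Diff:
  assumes \<nu>: "signed_measure M \<nu>" and "A \<in> sets M" "B \<in> sets M" "A \<subseteq> B"
  shows "\<nu> (B - A) = \<nu> B - \<nu> A"
proof -
  have "A \<union> (B - A) = B" using assms by auto
  then show ?thesis
    using signed_measure_Un[OF \<nu>, of A "B - A"] assms by auto
qed

text \<open>
  If \<open>\<nu>\<close> were unbounded, one could repeatedly halve the space, each time keeping a half on which
  \<open>\<nu>\<close> is unbounded and discarding a set of measure larger than 1 in modulus.
\<close>

lemma signed_measure_bounded:
  assumes \<nu>: "signed_measure M \<nu>"
  shows "\<exists>C. \<forall>A\<in>sets M. \<bar>\<nu> A\<bar> \<le> C"
proof -
  define bad where "bad E \<longleftrightarrow> E \<in> sets M \<and> (\<forall>K. \<exists>A\<in>sets M. A \<subseteq> E \<and> \<bar>\<nu> A\<bar> > K)" for E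
  have step: "\<exists>F. bad F \<and> F \<subseteq> E \<and> \<bar>\<nu> (E - F)\<bar> > 1" if "bad E" for E
  proof -
    have E: "E \<in> sets M" using that bad_def by auto
    obtain A where A: "A \<in> sets M" "A \<subseteq> E" "\<bar>\<nu> A\<bar> > \<bar>\<nu> E\<bar> + 1"
      using \<open>bad E\<close>[unfolded bad_def, THEN conjunct2, rule_format, of "\<bar>\<nu> E\<bar> + 1"] by auto
    have D: "\<nu> (E - A) = \<nu> E - \<nu> A" using signed_measure_Diff[OF \<nu> A(1) E A(2)] .
    have "bad A \<or> bad (E - A)"
    proof (rule ccontr)
      assume "\<not> (bad A \<or> bad (E - A))"
      then obtain K1 K2 where K: "\<And>X. X \<in> sets M \<Longrightarrow> X \<subseteq> A \<Longrightarrow> \<bar>\<nu> X\<bar> \<le> K1"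
        "\<And>X. X \<in> sets M \<Longrightarrow> X \<subseteq> E - A \<Longrightarrow> \<bar>\<nu> X\<bar> \<le> K2"
        using A E unfolding bad_def by (meson not_le sets.Diff)
      obtain X where X: "X \<in> sets M" "X \<subseteq> E" "\<bar>\<nu> X\<bar> > K1 + K2"
        using \<open>bad E\<close>[unfolded bad_def, THEN conjunct2, rule_format, of "K1 + K2"] by auto
      have "X = (X \<inter> A) \<union> (X - A)" by auto
      then have "\<nu> X = \<nu> (X \<inter> A) + \<nu> (X - A)"
        using signed_measure_Un[OF \<nu>, of "X \<inter> A" "X - A"] X A by auto
      moreover have "\<bar>\<nu> (X \<inter> A)\<bar> \<le> K1" "\<bar>\<nu> (X - A)\<bar> \<le> K2" using X A by (intro K; auto)+
      ultimately show False using X by linarith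
    qed
    moreover have "E - (E - A) = A" using A by auto
    ultimately show ?thesis using A D by (intro exI[of _ "if bad A then A else E - A"]) auto
  qed
  have "\<not> bad (space M)"
  proof
    assume bad: "bad (space M)"
    obtain f where f: "\<And>E. bad E \<Longrightarrow> bad (f E) \<and> f E \<subseteq> E \<and> \<bar>\<nu> (E - f E)\<bar> > 1"
      using step by metis
    define E where "E n = (f ^^ n) (space M)" for n
    have badE: "bad (E n)" for n by (induction n) (auto simp: E_def bad f)
    have Suc: "E (Suc n) = f (E n)" for n by (simp add: E_def)
    have dec: "decseq E" using f[OF badE] by (intro decseq_SucI) (auto simp: Suc)
    define D where "D n = E n - E (Suc n)" for n
    have D1: "\<bar>\<nu> (D n)\<bar> > 1" for n using f[OF badE[of n]] by (simp add: D_def Suc)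
    have "disjoint_family D"
      unfolding disjoint_family_on_def
    proof (intro ballI impI)
      fix m n :: nat assume "m \<noteq> n"
      then show "D m \<inter> D n = {}"
      proof (induction m n rule: linorder_wlog)
        case (le m n)
        then have "E n \<subseteq> E (Suc m)" using dec by (auto simp: decseq_def)
        then show ?case by (auto simp: D_def)
      qed auto
    qed
    moreover have "range D \<subseteq> sets M" using badE by (auto simp: D_def bad_def)
    ultimately have "(\<lambda>i. \<nu> (D i)) \<longlonglongrightarrow> 0"
      using signed_measure_sums[OF \<nu>] summable_LIMSEQ_zero sums_summable by blast
    then have "eventually (\<lambda>i. \<bar>\<nu> (D i)\<bar> < 1) sequentially"
      by (auto dest: tendstoD[where e = 1])
    then obtain n where "\<bar>\<nu> (D n)\<bar> < 1" by (auto simp: eventually_sequentially)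
    with D1[of n] show False by simp
  qed
  then obtain K where "\<And>A. A \<in> sets M \<Longrightarrow> A \<subseteq> space M \<Longrightarrow> \<bar>\<nu> A\<bar> \<le> K"
    unfolding bad_def by (auto simp: not_less)
  then show ?thesis by (meson sets.sets_into_space)
qed

section \<open>Upper variation and Jordan decomposition\<close>

lemma upper_variation_space [simp]: "space (upper_variation M \<nu>) = space M"
  and upper_variation_sets [simp]: "sets (upper_variation M \<nu>) = sets M"
  by (simp_all add: upper_variation_def sets.space_closed sets.sigma_sets_eq)

text \<open>\<open>measure_of\<close> returns the supremum only if that is countably additive.
  Superadditivity on disjoint sets gives one inequality. For the other, a competitor B inside the
  union is cut along the sets \<open>A i\<close>; clipped at 0, each piece is at most
  \<open>v (A i)\<close>.\<close>

lemma emeasure_upper_variation: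
  assumes \<nu>: "signed_measure M \<nu>" and E: "E \<in> sets M"
  shows "emeasure (upper_variation M \<nu>) E = (SUP A \<in> {A \<in> sets M. A \<subseteq> E}. ennreal (\<nu> A))"
proof -
  define v where "v E = (SUP A \<in> {A \<in> sets M. A \<subseteq> E}. ennreal (\<nu> A))" for E
  have v_ge: "ennreal (\<nu> A) \<le> v E" if "A \<in> sets M" "A \<subseteq> E" for A E
    unfolding v_def using that by (intro SUP_upper) auto
  have v0: "v {} = 0"
    using \<nu> unfolding v_def signed_measure_def by (auto intro!: antisym SUP_least)
  have mono: "v E \<le> v F" if "E \<subseteq> F" for E F
    unfolding v_def using that by (intro SUP_subset_mono) auto
  have super2: "v E + v F \<le> v (E \<union> F)" if "E \<inter> F = {}" for E F
  proof -
    have "v E + ennreal (\<nu> B) \<le> v (E \<union> F)" if B: "B \<in> sets M" "B \<subseteq> F" for B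
    proof -
      have "ennreal (\<nu> A) + ennreal (\<nu> B) \<le> v (E \<union> F)" if A: "A \<in> sets M" "A \<subseteq> E" for A
      proof -
        have "\<nu> (A \<union> B) = \<nu> A + \<nu> B"
          using A B \<open>E \<inter> F = {}\<close> by (intro signed_measure_Un[OF \<nu>]) auto
        then have le: "ennreal (\<nu> A + \<nu> B) \<le> v (E \<union> F)"
          using v_ge[of "A \<union> B" "E \<union> F"] A B by fastforce
        have le': "ennreal (\<nu> A) \<le> v (E \<union> F)" "ennreal (\<nu> B) \<le> v (E \<union> F)"
          using A B by (intro v_ge; blast)+
        \<comment> \<open>\<open>ennreal\<close> sends negative values to 0, so it is additive only
          when both values are nonnegative. If one of them is not positive, its summand vanishes and
          the bound for the other set suffices.\<close>
        consider "\<nu> A \<le> 0" | "\<nu> B \<le> 0" | "0 \<le> \<nu> A" "0 \<le> \<nu> B" by linarith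
        then show ?thesis using le le' by cases (simp_all add: ennreal_neg)
      qed
      moreover have "v E + ennreal (\<nu> B) =
          (SUP A \<in> {A \<in> sets M. A \<subseteq> E}. ennreal (\<nu> A) + ennreal (\<nu> B))"
        unfolding v_def by (subst ennreal_SUP_add_left) auto
      ultimately show ?thesis by (auto intro!: SUP_least)
    qed
    moreover have "v E + v F = (SUP B \<in> {B \<in> sets M. B \<subseteq> F}. v E + ennreal (\<nu> B))"
      unfolding v_def[of F] by (subst ennreal_SUP_add_right) auto
    ultimately show ?thesis by (auto intro!: SUP_least)
  qed
  have "countably_additive (sets M) v"
    unfolding countably_additive_def
  proof (intro allI impI)
    fix A :: "nat \<Rightarrow> 'a set"
    assume A: "range A \<subseteq> sets M" "disjoint_family A"
    have fin: "(\<Sum>i<n. v (A i)) \<le> v (\<Union>i<n. A i)" for n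
    proof (induction n)
      case (Suc n)
      have "(\<Union>i<n. A i) \<inter> A n = {}"
      proof -
        have "A i \<inter> A n = {}" if "i < n" for i
          using A(2) that by (intro disjoint_family_onD[of A UNIV]) auto
        then show ?thesis by auto
      qed
      have "(\<Sum>i<Suc n. v (A i)) \<le> v (\<Union>i<n. A i) + v (A n)"
        using Suc by (simp add: add_right_mono)
      also have "\<dots> \<le> v ((\<Union>i<n. A i) \<union> A n)" by (rule super2) fact
      also have "(\<Union>i<n. A i) \<union> A n = (\<Union>i<Suc n. A i)" by (auto simp: less_Suc_eq)
      finally show ?case .
    qed (simp add: v0)
    have "(\<Sum>i. v (A i)) \<le> v (\<Union>i. A i)"
    proof (rule suminf_le_const)
      fix n show "(\<Sum>i<n. v (A i)) \<le> v (\<Union>i. A i)"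
        by (rule order_trans[OF fin mono]) auto
    qed auto
    moreover have "v (\<Union>i. A i) \<le> (\<Sum>i. v (A i))"
      unfolding v_def[of "\<Union>i. A i"]
    proof (rule SUP_least)
      fix B assume B: "B \<in> {B \<in> sets M. B \<subseteq> (\<Union>i. A i)}"
      have "(\<lambda>i. \<nu> (B \<inter> A i)) sums \<nu> (\<Union>i. B \<inter> A i)"
        using A B by (intro signed_measure_sums[OF \<nu>]) (auto simp: disjoint_family_on_def)
      moreover have "(\<Union>i. B \<inter> A i) = B" using B by auto
      ultimately have s: "(\<lambda>n. \<Sum>i<n. \<nu> (B \<inter> A i)) \<longlonglongrightarrow> \<nu> B" by (simp add: sums_def)
      have "ennreal (\<Sum>i<n. \<nu> (B \<inter> A i)) \<le> (\<Sum>i. v (A i))" for n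
      proof -
        have "ennreal (\<Sum>i<n. \<nu> (B \<inter> A i)) \<le> ennreal (\<Sum>i<n. max 0 (\<nu> (B \<inter> A i)))"
          by (intro ennreal_leI sum_mono) auto
        also have "\<dots> = (\<Sum>i<n. ennreal (max 0 (\<nu> (B \<inter> A i))))"
          by (subst sum_ennreal) auto
        also have "\<dots> \<le> (\<Sum>i<n. v (A i))"
        proof (rule sum_mono)
          fix i
          have "ennreal (max 0 (\<nu> (B \<inter> A i))) = ennreal (\<nu> (B \<inter> A i))"
            by (auto simp: max_def ennreal_neg)
          also have "\<dots> \<le> v (A i)" using A B by (intro v_ge) auto
          finally show "ennreal (max 0 (\<nu> (B \<inter> A i))) \<le> v (A i)" .
        qed
        also have "\<dots> \<le> (\<Sum>i. v (A i))" by (intro sum_le_suminf) auto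
        finally show ?thesis .
      qed
      moreover have "(\<lambda>n. ennreal (\<Sum>i<n. \<nu> (B \<inter> A i))) \<longlonglongrightarrow> ennreal (\<nu> B)"
        using s by (rule tendsto_ennrealI)
      ultimately show "ennreal (\<nu> B) \<le> (\<Sum>i. v (A i))"
        by (intro LIMSEQ_le_const2) auto
    qed
    ultimately show "(\<Sum>i. v (A i)) = v (\<Union>i. A i)" by (rule antisym)
  qed
  moreover have "positive (sets M) v" by (simp add: positive_def v0)
  ultimately show ?thesis
    unfolding upper_variation_def v_def[symmetric]
    using E by (intro emeasure_measure_of_sigma) (auto simp: sets.sigma_algebra_axioms)
qed

lemma finite_measure_upper_variation:
  assumes \<nu>: "signed_measure M \<nu>"
  shows "finite_measure (upper_variation M \<nu>)"
proof
  obtain C where C: "\<And>A. A \<in> sets M \<Longrightarrow> \<bar>\<nu> A\<bar> \<le> C"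
    using signed_measure_bounded[OF \<nu>] by auto
  have "emeasure (upper_variation M \<nu>) (space M) \<le> ennreal C"
    unfolding emeasure_upper_variation[OF \<nu> sets.top]
    by (intro SUP_least ennreal_leI) (use C in \<open>auto dest: abs_le_D1\<close>)
  then show "emeasure (upper_variation M \<nu>) (space (upper_variation M \<nu>)) \<noteq> \<infinity>"
    by (auto simp: top_unique)
qed

text \<open>Complementation inside E: from \<nu> A = \<nu> E - \<nu> (E - A), the value on A is at
  most \<nu> E plus the negative part of E, and the supremum over A gives one inequality. The same
  argument for - \<nu> gives the other. Both parts are finite, so the difference of real measures
  makes sense.\<close>

lemma jordan_decomposition:
  assumes \<nu>: "signed_measure M \<nu>" and E: "E \<in> sets M"
  shows "\<nu> E = measure (upper_variation M \<nu>) E - measure (upper_variation M (\<lambda>A. - \<nu> A)) E"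
proof -
  note \<nu>' = signed_measure_uminus[OF \<nu>]
  let ?P = "upper_variation M \<nu>" and ?N = "upper_variation M (\<lambda>A. - \<nu> A)"
  interpret P: finite_measure ?P by (rule finite_measure_upper_variation[OF \<nu>])
  interpret N: finite_measure ?N by (rule finite_measure_upper_variation[OF \<nu>'])
  have up: "\<rho> A \<le> measure (upper_variation M \<rho>) E"
    if "A \<in> sets M" "A \<subseteq> E" "signed_measure M \<rho>" for A \<rho>
  proof -
    interpret finite_measure "upper_variation M \<rho>" using that finite_measure_upper_variation by auto
    have "ennreal (\<rho> A) \<le> emeasure (upper_variation M \<rho>) E"
      using that by (auto simp: emeasure_upper_variation E intro: SUP_upper)
    then show ?thesis by (simp add: emeasure_eq_measure)
  qed
  have least: "measure (upper_variation M \<rho>) E \<le> K"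
    if "signed_measure M \<rho>" "\<And>A. A \<in> sets M \<Longrightarrow> A \<subseteq> E \<Longrightarrow> \<rho> A \<le> K" for \<rho> K
  proof -
    interpret finite_measure "upper_variation M \<rho>" using that finite_measure_upper_variation by auto
    have "0 \<le> K" using that(2)[of "{}"] that(1) by (auto simp: signed_measure_def)
    have "emeasure (upper_variation M \<rho>) E \<le> ennreal K"
      unfolding emeasure_upper_variation[OF that(1) E]
      by (intro SUP_least ennreal_leI) (use that(2) in auto)
    then show ?thesis using \<open>0 \<le> K\<close> by (simp add: emeasure_eq_measure)
  qed
  have "measure ?P E \<le> \<nu> E + measure ?N E"
  proof (rule least[OF \<nu>])
    fix A assume A: "A \<in> sets M" "A \<subseteq> E"
    have "- \<nu> (E - A) \<le> measure ?N E" using up[of "E - A", OF _ _ \<nu>'] A E by auto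
    then show "\<nu> A \<le> \<nu> E + measure ?N E" using signed_measure_Diff[OF \<nu> A(1) E A(2)] by simp
  qed
  moreover have "measure ?N E \<le> measure ?P E - \<nu> E"
  proof (rule least[OF \<nu>'])
    fix A assume A: "A \<in> sets M" "A \<subseteq> E"
    have "\<nu> (E - A) \<le> measure ?P E" using up[of "E - A", OF _ _ \<nu>] A E by auto
    then show "- \<nu> A \<le> measure ?P E - \<nu> E" using signed_measure_Diff[OF \<nu> A(1) E A(2)] by simp
  qed
  ultimately show ?thesis by simp
qed

text \<open>The partition into A and its complement is already a competitor for the total variation.
  With \<nu> one of the four functions Re, - Re, Im, - Im of \<mu>, each Jordan part has mass at
  most that of \<mu>.\<close>

lemma emeasure_upper_variation_le_total_variation:
  assumes \<nu>: "signed_measure M \<nu>" and le: "\<And>A. A \<in> sets M \<Longrightarrow> \<nu> A \<le> norm (\<mu> A)"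
  shows "emeasure (upper_variation M \<nu>) (space M) \<le> total_variation M \<mu>"
  unfolding emeasure_upper_variation[OF \<nu> sets.top]
proof (rule SUP_least)
  fix A assume "A \<in> {A \<in> sets M. A \<subseteq> space M}"
  then have A: "A \<in> sets M" "A \<subseteq> space M" by auto
  let ?B = "binaryset A (space M - A)"
  have "ennreal (\<nu> A) \<le> ennreal (norm (\<mu> (?B 0)))" using le[OF A(1)] by (simp add: binaryset_def ennreal_leI)
  also have "\<dots> = (\<Sum>i\<in>{0}. ennreal (norm (\<mu> (?B i))))" by simp
  also have "\<dots> \<le> (\<Sum>i. ennreal (norm (\<mu> (?B i))))"
    by (rule sum_le_suminf) auto
  also have "\<dots> \<le> total_variation M \<mu>"
    unfolding total_variation_def
    using A by (intro SUP_upper) (auto simp: binaryset_def disjoint_family_on_def split: if_splits)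
  finally show "ennreal (\<nu> A) \<le> total_variation M \<mu>" .
qed

text \<open>
  True by linearity for simple functions, and by dominated convergence in general. A measure with
  coefficients is encoded as a list of pairs of a coefficient and a positive finite measure.
\<close>

lemma sum_list_integral_eq_0:
  fixes F :: "'a \<Rightarrow> complex" and ps :: "(complex \<times> 'a measure) list"
  assumes fin: "\<And>c P. (c, P) \<in> set ps \<Longrightarrow> finite_measure P \<and> sets P = sets M"
    and zero: "\<And>A. A \<in> sets M \<Longrightarrow> (\<Sum>(c, P)\<leftarrow>ps. c * of_real (measure P A)) = 0"
    and F: "F \<in> borel_measurable M" and bound: "\<And>x. x \<in> space M \<Longrightarrow> norm (F x) \<le> K"
  shows "(\<Sum>(c, P)\<leftarrow>ps. c * integral\<^sup>L P F) = 0"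
proof -
  obtain s where s: "\<And>i. simple_function M (s i)"
    "\<And>x. x \<in> space M \<Longrightarrow> (\<lambda>i. s i x) \<longlonglongrightarrow> F x"
    "\<And>i x. x \<in> space M \<Longrightarrow> dist (s i x) 0 \<le> 2 * dist (F x) 0"
    using borel_measurable_implies_sequence_metric[OF F, of 0] by blast
  have zero_simple: "(\<Sum>(c, P)\<leftarrow>ps. c * integral\<^sup>L P (s i)) = 0" for i
  proof -
    let ?R = "s i ` space M" and ?A = "\<lambda>y. s i -` {y} \<inter> space M"
    have finR: "finite ?R" using s(1) by (simp add: simple_function_def)
    have A: "?A y \<in> sets M" for y using s(1)[of i] by (auto dest: simple_functionD)
    have "integral\<^sup>L P (s i) = (\<Sum>y\<in>?R. of_real (measure P (?A y)) * y)"
      if P: "(c, P) \<in> set ps" for c P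
    proof -
      have [measurable_cong, simp]: "sets P = sets M" and "finite_measure P" using fin[OF P] by auto
      then interpret finite_measure P by simp
      have sp [simp]: "space P = space M" by (rule sets_eq_imp_space_eq) simp
      have "integral\<^sup>L P (s i) = (\<integral>x. (\<Sum>y\<in>?R. indicator (?A y) x *\<^sub>R y) \<partial>P)"
        by (rule Bochner_Integration.integral_cong[OF refl],
            rule simple_function_indicator_representation_banach[OF s(1)]) simp
      also have "\<dots> = (\<Sum>y\<in>?R. (\<integral>x. indicator (?A y) x *\<^sub>R y \<partial>P))"
        using A by (intro Bochner_Integration.integral_sum integrable_scaleR_left integrable_indicator)
          (auto simp: emeasure_eq_measure)
      also have "\<dots> = (\<Sum>y\<in>?R. of_real (measure P (?A y)) * y)"
        using A by (intro sum.cong refl) (subst integral_scaleR_left,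
            auto simp: emeasure_eq_measure scaleR_conv_of_real intro!: integrable_indicator)
      finally show ?thesis .
    qed
    then have "(\<Sum>(c, P)\<leftarrow>ps. c * integral\<^sup>L P (s i)) =
        (\<Sum>(c, P)\<leftarrow>ps. \<Sum>y\<in>?R. y * (c * of_real (measure P (?A y))))"
      by (intro arg_cong[of _ _ sum_list] map_cong refl)
         (auto simp: sum_distrib_left mult_ac)
    also have "\<dots> = (\<Sum>y\<in>?R. y * (\<Sum>(c, P)\<leftarrow>ps. c * of_real (measure P (?A y))))"
      by (induction ps) (auto simp: sum.distrib algebra_simps sum_distrib_left)
    also have "\<dots> = 0" using zero[OF A] by simp
    finally show ?thesis .
  qed
  have "(\<lambda>i. \<Sum>(c, P)\<leftarrow>ps. c * integral\<^sup>L P (s i)) \<longlonglongrightarrow> (\<Sum>(c, P)\<leftarrow>ps. c * integral\<^sup>L P F)"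
    using fin
  proof (induction ps)
    case (Cons p ps)
    obtain c P where p: "p = (c, P)" by force
    have [measurable_cong, simp]: "sets P = sets M" and "finite_measure P"
      using Cons.prems[of c P] p by auto
    then interpret finite_measure P by simp
    have sp [simp]: "space P = space M" by (rule sets_eq_imp_space_eq) simp
    have "(\<lambda>i. integral\<^sup>L P (s i)) \<longlonglongrightarrow> integral\<^sup>L P F"
    proof (rule integral_dominated_convergence[where w = "\<lambda>_. 2 * K"])
      show "AE x in P. norm (s i x) \<le> 2 * K" for i
      proof (rule AE_I2)
        fix x assume "x \<in> space P"
        then show "norm (s i x) \<le> 2 * K" using s(3)[of x i] bound[of x] by simp
      qed
      have "borel_measurable P = borel_measurable M" by (rule measurable_cong_sets) auto
      then show "F \<in> borel_measurable P" "s i \<in> borel_measurable P" for i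
        using F borel_measurable_simple_function[OF s(1)] by auto
    qed (use s in auto)
    then have "(\<lambda>i. c * integral\<^sup>L P (s i)) \<longlonglongrightarrow> c * integral\<^sup>L P F"
      by (intro tendsto_intros)
    then show ?case using Cons p by (auto intro!: tendsto_add)
  qed simp
  then show ?thesis unfolding zero_simple by (simp add: LIMSEQ_const_iff)
qed

text \<open>This is how representing measures are produced. The variation bound is the triangle
  inequality on each cell of a partition, followed by countable additivity of every P in the
  list.\<close>

lemma complex_measure_sum_list:
  fixes ps :: "(complex \<times> 'a measure) list"
  assumes fin: "\<And>c P. (c, P) \<in> set ps \<Longrightarrow> finite_measure P \<and> sets P = sets M"
    and \<mu>: "\<And>A. \<mu> A = (\<Sum>(c, P)\<leftarrow>ps. c * of_real (measure P A))"
  shows "complex_measure M \<mu>"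
    and "total_variation M \<mu> \<le> (\<Sum>(c, P)\<leftarrow>ps. ennreal (norm c) * emeasure P (space M))"
proof -
  have "(\<lambda>i. \<Sum>(c, P)\<leftarrow>ps. c * of_real (measure P (A i))) sums
      (\<Sum>(c, P)\<leftarrow>ps. c * of_real (measure P (\<Union>i. A i)))"
    if A: "range A \<subseteq> sets M" "disjoint_family A" for A :: "nat \<Rightarrow> 'a set"
    using fin
  proof (induction ps)
    case (Cons p ps)
    obtain c P where p: "p = (c, P)" by force
    have "sets P = sets M" and "finite_measure P" using Cons.prems[of c P] p by auto
    then interpret finite_measure P by simp
    have "(\<lambda>i. measure P (A i)) sums measure P (\<Union>i. A i)"
      using A \<open>sets P = sets M\<close> by (intro finite_measure_UNION) auto
    then have "(\<lambda>i. c * of_real (measure P (A i))) sums (c * of_real (measure P (\<Union>i. A i)))"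
      by (intro sums_mult sums_of_real)
    then show ?case using Cons p by (auto intro!: sums_add)
  qed simp
  moreover have "(\<Sum>(c, P)\<leftarrow>ps. 0 :: complex) = 0" by (induction ps) auto
  ultimately show "complex_measure M \<mu>"
    unfolding complex_measure_def \<mu> by (auto simp: case_prod_beta sum_list_0)
  show "total_variation M \<mu> \<le> (\<Sum>(c, P)\<leftarrow>ps. ennreal (norm c) * emeasure P (space M))"
    unfolding total_variation_def
  proof (rule SUP_least, safe)
    fix A :: "nat \<Rightarrow> 'a set"
    assume A: "range A \<subseteq> sets M" "disjoint_family A" "(\<Union>i. A i) = space M"
    have "(\<Sum>i. ennreal (norm (\<mu> (A i)))) \<le>
        (\<Sum>i. \<Sum>(c, P)\<leftarrow>ps. ennreal (norm c) * emeasure P (A i))"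
    proof (rule suminf_le)
      fix i
      have "ennreal (norm (\<Sum>(c, P)\<leftarrow>ps. c * of_real (measure P (A i)))) \<le>
          (\<Sum>(c, P)\<leftarrow>ps. ennreal (norm c) * emeasure P (A i))"
        using fin
      proof (induction ps)
        case (Cons p ps)
        obtain c P where p: "p = (c, P)" by force
        have "finite_measure P" using Cons.prems[of c P] p by auto
        then interpret finite_measure P by simp
        let ?S = "\<Sum>(c, P)\<leftarrow>ps. c * of_real (measure P (A i))"
        have "norm (c * of_real (measure P (A i)) + ?S) \<le> norm c * measure P (A i) + norm ?S"
          by (rule order_trans[OF norm_triangle_ineq]) (simp add: norm_mult)
        then have "ennreal (norm (c * of_real (measure P (A i)) + ?S)) \<le>
            ennreal (norm c * measure P (A i) + norm ?S)"
          by (rule ennreal_leI)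
        also have "\<dots> = ennreal (norm c) * emeasure P (A i) + ennreal (norm ?S)"
          by (simp add: ennreal_plus ennreal_mult emeasure_eq_measure)
        also have "\<dots> \<le> ennreal (norm c) * emeasure P (A i) +
            (\<Sum>(c, P)\<leftarrow>ps. ennreal (norm c) * emeasure P (A i))"
          using Cons by (intro add_left_mono) auto
        finally show ?case by (simp add: p)
      qed simp
      then show "ennreal (norm (\<mu> (A i))) \<le> (\<Sum>(c, P)\<leftarrow>ps. ennreal (norm c) * emeasure P (A i))"
        by (simp add: \<mu>)
    qed auto
    also have "\<dots> = (\<Sum>(c, P)\<leftarrow>ps. ennreal (norm c) * emeasure P (space M))"
      using fin
    proof (induction ps)
      case (Cons p ps)
      obtain c P where p: "p = (c, P)" by force
      have "sets P = sets M" using Cons.prems[of c P] p by auto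
      then have "(\<Sum>i. emeasure P (A i)) = emeasure P (\<Union>i. A i)"
        using A by (intro suminf_emeasure) auto
      then have "(\<Sum>i. ennreal (norm c) * emeasure P (A i)) = ennreal (norm c) * emeasure P (space M)"
        using A(3) by simp
      moreover have "(\<Sum>i. \<Sum>(c, P)\<leftarrow>ps. ennreal (norm c) * emeasure P (A i)) =
          (\<Sum>(c, P)\<leftarrow>ps. ennreal (norm c) * emeasure P (space M))"
        using Cons by auto
      ultimately show ?case by (simp only: p list.map sum_list.Cons prod.case) (subst suminf_add[symmetric], auto)
    qed simp
    finally show "(\<Sum>i. ennreal (norm (\<mu> (A i)))) \<le>
      (\<Sum>(c, P)\<leftarrow>ps. ennreal (norm c) * emeasure P (space M))" .
  qed
qed

text \<open>\<open>complex_measure_integral\<close> is defined through the Jordan parts of \<mu>, so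
  it does not see how \<mu> was assembled. Appending these four parts with the opposite coefficients
  gives a list whose total measure is 0, and hence whose total integral is 0. Linearity in the
  measure is the special case of concatenated lists.\<close>

lemma complex_measure_integral_sum_list:
  fixes ps :: "(complex \<times> 'a measure) list" and F :: "'a \<Rightarrow> complex"
  assumes fin: "\<And>c P. (c, P) \<in> set ps \<Longrightarrow> finite_measure P \<and> sets P = sets M"
    and \<mu>: "\<And>A. A \<in> sets M \<Longrightarrow> \<mu> A = (\<Sum>(c, P)\<leftarrow>ps. c * of_real (measure P A))"
    and cm: "complex_measure M \<mu>"
    and F: "F \<in> borel_measurable M" and bound: "\<And>x. x \<in> space M \<Longrightarrow> norm (F x) \<le> K"
  shows "complex_measure_integral M \<mu> F = (\<Sum>(c, P)\<leftarrow>ps. c * integral\<^sup>L P F)"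
proof -
  let ?U = "upper_variation M"
  let ?qs = "[(- 1, ?U (\<lambda>A. Re (\<mu> A))), (1, ?U (\<lambda>A. - Re (\<mu> A))),
    (- \<i>, ?U (\<lambda>A. Im (\<mu> A))), (\<i>, ?U (\<lambda>A. - Im (\<mu> A)))]"
  note re = complex_measure_Re[OF cm] and im = complex_measure_Im[OF cm]
  note fins = finite_measure_upper_variation[OF re] finite_measure_upper_variation[OF im]
    finite_measure_upper_variation[OF signed_measure_uminus[OF re]]
    finite_measure_upper_variation[OF signed_measure_uminus[OF im]]
  have "(\<Sum>(c, P)\<leftarrow>ps @ ?qs. c * integral\<^sup>L P F) = 0"
  proof (rule sum_list_integral_eq_0[where M = M])
    show "finite_measure P \<and> sets P = sets M" if "(c, P) \<in> set (ps @ ?qs)" for c P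
      using that fin fins by auto
    fix A assume A: "A \<in> sets M"
    show "(\<Sum>(c, P)\<leftarrow>ps @ ?qs. c * of_real (measure P A)) = 0"
      using \<mu>[OF A] jordan_decomposition[OF re A] jordan_decomposition[OF im A]
      by (simp add: complex_eq_iff)
  qed (use F bound in auto)
  then show ?thesis
    unfolding complex_measure_integral_def by (simp add: algebra_simps eq_neg_iff_add_eq_0)
qed

section \<open>Superpositions of kernels\<close>

text \<open>z comes first so that \<open>frac_kernel \<alpha> z\<close> is the integrand in the
  measure variable. The point w may lie anywhere in the closed disk, not only on the circle.\<close>

definition frac_kernel :: "real \<Rightarrow> complex \<Rightarrow> complex \<Rightarrow> complex" where
  "frac_kernel \<alpha> z w = 1 / (1 - cnj w * z) powr complex_of_real \<alpha>"

text \<open>Keeps the base of the power in the right half-plane, where the principal branch is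
  holomorphic, and bounds it away from 0 for fixed z.\<close>

lemma Re_one_minus_pos:
  fixes w z :: complex
  assumes "norm w \<le> 1" "norm z < 1"
  shows "1 - norm z \<le> Re (1 - w * z)" "0 < Re (1 - w * z)"
proof -
  have "Re (w * z) \<le> norm w * norm z" using complex_Re_le_cmod[of "w * z"] by (simp add: norm_mult)
  also have "\<dots> \<le> 1 * norm z" using assms by (intro mult_right_mono) auto
  finally show "1 - norm z \<le> Re (1 - w * z)" by simp
  then show "0 < Re (1 - w * z)" using assms by simp
qed

lemma one_minus_not_nonpos:
  fixes w z :: complex
  assumes "norm w \<le> 1" "norm z < 1"
  shows "1 - w * z \<notin> \<real>\<^sub>\<le>\<^sub>0" "1 - w * z \<noteq> 0"
  using Re_one_minus_pos(2)[OF assms] by (auto simp: complex_nonpos_Reals_iff dest: arg_cong[of _ _ Re])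

lemma norm_frac_kernel_le:
  assumes "norm w \<le> 1" "norm z < 1" "0 < \<alpha>"
  shows "norm (frac_kernel \<alpha> z w) \<le> (1 - norm z) powr - \<alpha>"
proof -
  have "1 - norm z \<le> norm (1 - cnj w * z)"
    using Re_one_minus_pos(1)[of "cnj w" z] assms complex_Re_le_cmod[of "1 - cnj w * z"] by simp
  then have "norm (1 - cnj w * z) powr - \<alpha> \<le> (1 - norm z) powr - \<alpha>"
    using assms by (intro powr_mono2') auto
  then show ?thesis
    by (simp add: frac_kernel_def norm_divide norm_inverse norm_powr_real_powr' powr_minus divide_inverse)
qed

lemma measurable_cnj [measurable]: "cnj \<in> borel_measurable borel"
  by (intro borel_measurable_continuous_onI continuous_intros)

lemma measurable_frac_kernel [measurable (raw)]:
  assumes [measurable]: "w \<in> borel_measurable M"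
  shows "(\<lambda>x. frac_kernel \<alpha> z (w x)) \<in> borel_measurable M"
  unfolding frac_kernel_def by measurable

section \<open>Uniform measure on the circle and harmonic measure\<close>

definition circle_param :: "real \<Rightarrow> complex" where
  "circle_param t = exp (2 * of_real pi * \<i> * of_real t)"

lemma norm_circle_param [simp]: "norm (circle_param t) = 1"
  by (simp add: circle_param_def norm_exp)

lemma circle_param_nonzero [simp]: "circle_param t \<noteq> 0"
  by (simp add: circle_param_def)

lemma continuous_circle_param: "continuous_on S circle_param"
  unfolding circle_param_def by (intro continuous_intros)

lemma measurable_circle_param [measurable]: "circle_param \<in> borel_measurable borel"
  by (intro borel_measurable_continuous_onI continuous_circle_param)

definition unit_interval :: "real measure" where
  "unit_interval = restrict_space lborel {0..1}"

lemma space_unit_interval [simp]: "space unit_interval = {0..1}"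
  by (simp add: unit_interval_def space_restrict_space)

lemma emeasure_unit_interval: "emeasure unit_interval (space unit_interval) = 1"
  by (simp add: unit_interval_def emeasure_restrict_space space_restrict_space)

lemma measurable_unit_interval [measurable_cong]:
  "sets unit_interval = sets (restrict_space borel {0..1})"
  by (simp add: unit_interval_def sets_restrict_space)

lemma measurable_unit_intervalI:
  "f \<in> borel_measurable borel \<Longrightarrow> f \<in> borel_measurable unit_interval"
  unfolding unit_interval_def by (rule measurable_restrict_space1) simp

interpretation unit_interval: finite_measure unit_interval
  by standard (simp add: emeasure_unit_interval del: space_unit_interval)

lemma integral_unit_interval_eq:
  fixes f :: "real \<Rightarrow> complex"
  assumes "continuous_on {0..1} f"
  shows "integral\<^sup>L unit_interval f = integral {0..1} f"
proof -
  have "set_integrable lborel {0..1} f"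
    using assms by (rule borel_integrable_atLeastAtMost')
  then show ?thesis
    unfolding unit_interval_def
    by (simp add: integral_restrict_space set_borel_integral_eq_integral(2)[symmetric] set_lebesgue_integral_def)
qed

text \<open>On the circle, d\<zeta> / (2 pi i) equals \<open>r * circle_param t\<close> dt, which is
  the numerator here. Integrals over the probability measure \<open>unit_interval\<close> can then
  enter product measures.\<close>

lemma cauchy_circle_param:
  assumes f: "continuous_on (cball c r) f" "f holomorphic_on ball c r" and w: "w \<in> ball c r"
  shows "f w = (\<integral>t. f (c + r * circle_param t) * (r * circle_param t / (c + r * circle_param t - w))
    \<partial>unit_interval)"
proof -
  have "((\<lambda>u. f u / (u - w)) has_contour_integral (2 * of_real pi * \<i> * f w)) (circlepath c r)"
    using assms by (intro Cauchy_integral_circlepath) (auto simp: dist_norm norm_minus_commute)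
  then have "((\<lambda>t. f (circlepath c r t) / (circlepath c r t - w) *
      (2 * of_real pi * \<i> * r * circle_param t)) has_integral (2 * of_real pi * \<i> * f w)) {0..1}"
    unfolding has_contour_integral_def
    by (rule has_integral_eq[rotated]) (auto simp: vector_derivative_circlepath01 circle_param_def)
  from has_integral_mult_right[OF this, of "1 / (2 * of_real pi * \<i>)"]
  have I: "((\<lambda>t. f (c + r * circle_param t) * (r * circle_param t / (c + r * circle_param t - w)))
      has_integral f w) {0..1}"
    by (simp add: circlepath circle_param_def mult_ac)
  have "0 < r" using w zero_le_dist[of c w] unfolding mem_ball by linarith
  have "c + r * circle_param t \<noteq> w" for t
    using w \<open>0 < r\<close> by (auto simp: dist_norm norm_mult)
  then have "continuous_on {0..1}
      (\<lambda>t. f (c + r * circle_param t) * (r * circle_param t / (c + r * circle_param t - w)))"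
    using \<open>0 < r\<close> by (intro continuous_intros continuous_circle_param continuous_on_compose2[OF f(1)])
      (auto simp: dist_norm norm_mult)
  from integral_unit_interval_eq[OF this] show ?thesis using I by (simp add: integral_unique)
qed

text \<open>
  The harmonic measure of the disk at \<open>w\<close> is the image of the uniform measure on the circle under
  this map, which for \<open>\<bar>w\<bar> < 1\<close> is the complex conjugate of a Moebius transformation.
\<close>

definition harmonic_map :: "complex \<Rightarrow> complex \<Rightarrow> complex" where
  "harmonic_map w \<zeta> = (if norm w < 1 then cnj ((\<zeta> + cnj w) / (1 + w * \<zeta>)) else w)"

lemma measurable_harmonic_map [measurable (raw)]:
  assumes [measurable]: "w \<in> borel_measurable M" "\<zeta> \<in> borel_measurable M"
  shows "(\<lambda>x. harmonic_map (w x) (\<zeta> x)) \<in> borel_measurable M"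
  unfolding harmonic_map_def by measurable

text \<open>Everything but the nonvanishing rests on the identity \<open>eq\<close>. Besides the
  harmonic map it serves the factors of the separation product, with w = \<open>cnj (a k)\<close>
  and \<zeta> = \<open>- a n\<close>.\<close>

lemma moebius_bound:
  fixes w \<zeta> :: complex
  assumes "norm w < 1" "norm \<zeta> \<le> 1"
  shows "1 + w * \<zeta> \<noteq> 0" "norm ((\<zeta> + cnj w) / (1 + w * \<zeta>)) \<le> 1"
    "norm \<zeta> = 1 \<Longrightarrow> norm ((\<zeta> + cnj w) / (1 + w * \<zeta>)) = 1"
proof -
  have "norm w * norm \<zeta> \<le> norm w * 1" using assms by (intro mult_left_mono) auto
  then have "norm (w * \<zeta>) < 1" using assms by (simp add: norm_mult)
  then show nz: "1 + w * \<zeta> \<noteq> 0" by (metis add_eq_0_iff norm_minus_cancel norm_one order_less_irrefl)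
  have eq: "(norm (1 + w * \<zeta>))\<^sup>2 - (norm (\<zeta> + cnj w))\<^sup>2 = (1 - (norm w)\<^sup>2) * (1 - (norm \<zeta>)\<^sup>2)"
    unfolding cmod_power2 by (simp add: power2_eq_square algebra_simps)
  have "(norm (\<zeta> + cnj w))\<^sup>2 \<le> (norm (1 + w * \<zeta>))\<^sup>2"
  proof -
    have "0 \<le> (1 - (norm w)\<^sup>2) * (1 - (norm \<zeta>)\<^sup>2)"
      using assms by (intro mult_nonneg_nonneg) (simp_all add: power_le_one)
    then show ?thesis using eq by linarith
  qed
  then have "norm (\<zeta> + cnj w) \<le> norm (1 + w * \<zeta>)" by (rule power2_le_imp_le) simp
  then show "norm ((\<zeta> + cnj w) / (1 + w * \<zeta>)) \<le> 1" using nz by (simp add: norm_divide)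
  assume "norm \<zeta> = 1"
  then have "(norm (1 + w * \<zeta>))\<^sup>2 = (norm (\<zeta> + cnj w))\<^sup>2" using eq by simp
  then have "norm (1 + w * \<zeta>) = norm (\<zeta> + cnj w)" by (rule power2_eq_imp_eq) auto
  then show "norm ((\<zeta> + cnj w) / (1 + w * \<zeta>)) = 1"
    using nz by (metis divide_self norm_divide norm_eq_zero)
qed

lemma norm_harmonic_map:
  assumes "norm w \<le> 1"
  shows "norm (harmonic_map w (circle_param t)) = 1"
proof (cases "norm w < 1")
  case True
  then show ?thesis
    using moebius_bound(3)[of w "circle_param t"] by (simp only: harmonic_map_def if_True complex_mod_cnj) simp
qed (use assms in \<open>simp add: harmonic_map_def\<close>)

text \<open>The conjugate in \<open>harmonic_map\<close> cancels the one in the kernel, so the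
  integrand is a holomorphic function of \<zeta> on the circle. Cauchy's formula evaluates it at
  \<zeta> = 0, where the Moebius map takes the value \<open>cnj w\<close>. For w on the circle the
  map is constant and the total mass is 1.\<close>

lemma frac_kernel_mean_value:
  assumes "norm w \<le> 1" "norm z < 1"
  shows "(\<integral>t. frac_kernel \<alpha> z (harmonic_map w (circle_param t)) \<partial>unit_interval) = frac_kernel \<alpha> z w"
proof (cases "norm w < 1")
  case True
  define m where "m \<zeta> = (\<zeta> + cnj w) / (1 + w * \<zeta>)" for \<zeta>
  define F where "F \<zeta> = 1 / (1 - m \<zeta> * z) powr complex_of_real \<alpha>" for \<zeta>
  have m_cont: "continuous_on (cball 0 1) m" and m_hol: "m holomorphic_on ball 0 1"
    unfolding m_def using moebius_bound(1)[OF True]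
    by (intro continuous_intros holomorphic_intros; force)+
  have np: "1 - m \<zeta> * z \<notin> \<real>\<^sub>\<le>\<^sub>0" "1 - m \<zeta> * z \<noteq> 0" if "\<zeta> \<in> cball 0 1" for \<zeta>
    using one_minus_not_nonpos[of "m \<zeta>" z] moebius_bound(2)[OF True, of \<zeta>] that assms
    by (auto simp: m_def simp del: complex_nonpos_Reals_iff)
  have nz: "(1 - m \<zeta> * z) powr complex_of_real \<alpha> \<noteq> 0" if "\<zeta> \<in> cball 0 1" for \<zeta>
    using np(2)[OF that] by simp
  have "continuous_on (cball 0 1) F"
    unfolding F_def
  proof (intro continuous_intros m_cont ballI)
    have "0 < Re (1 - m \<zeta> * z)" if "\<zeta> \<in> cball 0 1" for \<zeta>
      using Re_one_minus_pos(2)[of "m \<zeta>" z] moebius_bound(2)[OF True, of \<zeta>] that assms by (auto simp: m_def)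
    then show "cball 0 1 \<subseteq> {x. 0 \<le> Re (1 - m x * z) \<or> Im (1 - m x * z) \<noteq> 0}"
      by (intro subsetI CollectI disjI1 less_imp_le)
  qed (use np(2) nz in blast)+
  moreover have "F holomorphic_on ball 0 1"
    unfolding F_def
    by (intro holomorphic_intros m_hol) (rule np nz, simp)+
  ultimately have "F 0 = (\<integral>t. F (0 + 1 * circle_param t) *
      (1 * circle_param t / (0 + 1 * circle_param t - 0)) \<partial>unit_interval)"
    using cauchy_circle_param[of 0 1 F 0] by simp
  then show ?thesis using True by (simp add: F_def m_def frac_kernel_def harmonic_map_def)
next
  case False
  have "measure unit_interval {0..1} = 1"
    using emeasure_unit_interval by (simp add: measure_def)
  then show ?thesis using False by (simp add: harmonic_map_def)
qed

section \<open>Functions with a representing measure of bounded mass\<close>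

text \<open>Asks for an actual measure of mass at most K, so that bounds combine without
  approximating the infimum in \<open>F_norm\<close>. That approximation is made once, in
  \<open>F_norm_multiplier_le\<close>.\<close>

definition F_bounded :: "real \<Rightarrow> ennreal \<Rightarrow> (complex \<Rightarrow> complex) \<Rightarrow> bool" where
  "F_bounded \<alpha> K g \<longleftrightarrow> (\<exists>\<mu>. represents \<alpha> \<mu> g \<and> total_variation circle_borel \<mu> \<le> K)"

lemma F_bounded_mono: "F_bounded \<alpha> K g \<Longrightarrow> K \<le> L \<Longrightarrow> F_bounded \<alpha> L g"
  unfolding F_bounded_def by (meson order_trans)

lemma F_bounded_cong:
  assumes "\<And>z. norm z < 1 \<Longrightarrow> g z = h z"
  shows "F_bounded \<alpha> K g \<longleftrightarrow> F_bounded \<alpha> K h"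
  unfolding F_bounded_def represents_def using assms by simp

lemma space_circle_borel [simp]: "space circle_borel = sphere 0 1"
  by (simp add: circle_borel_def space_restrict_space)

lemma measurable_circle_borelI:
  "f \<in> borel_measurable borel \<Longrightarrow> f \<in> borel_measurable circle_borel"
  unfolding circle_borel_def by (rule measurable_restrict_space1)

lemma measurable_into_circle_borel:
  "f \<in> borel_measurable M \<Longrightarrow> (\<And>x. x \<in> space M \<Longrightarrow> norm (f x) = 1) \<Longrightarrow> f \<in> measurable M circle_borel"
  unfolding circle_borel_def by (intro measurable_restrict_space2) auto

lemma F_bounded_sum_list:
  assumes \<alpha>: "0 < \<alpha>"
    and fin: "\<And>c P. (c, P) \<in> set ps \<Longrightarrow> finite_measure P \<and> sets P = sets circle_borel"
    and g: "\<And>z. norm z < 1 \<Longrightarrow> g z = (\<Sum>(c, P)\<leftarrow>ps. c * integral\<^sup>L P (frac_kernel \<alpha> z))"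
  shows "F_bounded \<alpha> (\<Sum>(c, P)\<leftarrow>ps. ennreal (norm c) * emeasure P (sphere 0 1)) g"
proof -
  define \<mu> where "\<mu> A = (\<Sum>(c, P)\<leftarrow>ps. c * of_real (measure P A))" for A
  note cm = complex_measure_sum_list[of ps circle_borel \<mu>, OF fin \<mu>_def]
  have "complex_measure_integral circle_borel \<mu> (frac_kernel \<alpha> z) = g z" if z: "norm z < 1" for z
    unfolding g[OF z]
    by (rule complex_measure_integral_sum_list[where K = "(1 - norm z) powr - \<alpha>"])
       (use fin cm(1) z \<alpha> in \<open>auto simp: \<mu>_def intro!: norm_frac_kernel_le measurable_circle_borelI\<close>)
  then have "represents \<alpha> \<mu> g"
    using cm(1) unfolding represents_def frac_kernel_def by auto
  then show ?thesis using cm(2) unfolding F_bounded_def by auto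
qed

text \<open>The list holds the four Jordan parts. The condition on
  \<open>map (norm \<circ> fst) ps\<close> records at once that there are four of them and that
  their coefficients are unimodular.\<close>

lemma represents_as_sum_list:
  assumes "represents \<alpha> \<mu> g"
  shows "\<exists>ps :: (complex \<times> complex measure) list. map (norm \<circ> fst) ps = [1, 1, 1, 1] \<and>
    (\<forall>(c, P) \<in> set ps. finite_measure P \<and> sets P = sets circle_borel \<and>
       emeasure P (sphere 0 1) \<le> total_variation circle_borel \<mu>) \<and>
    (\<forall>A \<in> sets circle_borel. \<mu> A = (\<Sum>(c, P)\<leftarrow>ps. c * of_real (measure P A))) \<and>
    (\<forall>z. norm z < 1 \<longrightarrow> g z = (\<Sum>(c, P)\<leftarrow>ps. c * integral\<^sup>L P (frac_kernel \<alpha> z)))"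
proof -
  have cm: "complex_measure circle_borel \<mu>" using assms by (simp add: represents_def)
  let ?U = "upper_variation circle_borel"
  let ?ps = "[(1, ?U (\<lambda>A. Re (\<mu> A))), (-1, ?U (\<lambda>A. - Re (\<mu> A))),
    (\<i>, ?U (\<lambda>A. Im (\<mu> A))), (- \<i>, ?U (\<lambda>A. - Im (\<mu> A)))]"
  note re = complex_measure_Re[OF cm] and im = complex_measure_Im[OF cm]
  note all = re im signed_measure_uminus[OF re] signed_measure_uminus[OF im]
  note fins = all[THEN finite_measure_upper_variation]
  note tvs = all[THEN emeasure_upper_variation_le_total_variation, of \<mu>, unfolded space_circle_borel]
  have le: "Re u \<le> norm u" "Im u \<le> norm u" "- Re u \<le> norm u" "- Im u \<le> norm u" for u
    using abs_Re_le_cmod[of u] abs_Im_le_cmod[of u] by linarith+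
  show ?thesis
  proof (intro exI[of _ ?ps] conjI ballI allI impI)
    show "case p of (c, P) \<Rightarrow> finite_measure P \<and> sets P = sets circle_borel \<and>
        emeasure P (sphere 0 1) \<le> total_variation circle_borel \<mu>" if "p \<in> set ?ps" for p
      using that fins tvs le by auto
    show "\<mu> A = (\<Sum>(c, P)\<leftarrow>?ps. c * of_real (measure P A))" if A: "A \<in> sets circle_borel" for A
      using jordan_decomposition[OF re A] jordan_decomposition[OF im A] by (simp add: complex_eq_iff)
    show "g z = (\<Sum>(c, P)\<leftarrow>?ps. c * integral\<^sup>L P (frac_kernel \<alpha> z))" if "norm z < 1" for z
      using assms that unfolding represents_def complex_measure_integral_def frac_kernel_def
      by (simp add: algebra_simps)
  qed simp
qed

text \<open>The Jordan parts serve only to compute the integral against the sum. The variation of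
  the sum is estimated directly on partitions, so that the bound is K + L without the factor 4 that
  the parts would cost.\<close>

lemma F_bounded_add:
  assumes \<alpha>: "0 < \<alpha>" and "F_bounded \<alpha> K g" "F_bounded \<alpha> L h"
  shows "F_bounded \<alpha> (K + L) (\<lambda>z. g z + h z)"
proof -
  obtain \<mu> \<nu> where \<mu>: "represents \<alpha> \<mu> g" "total_variation circle_borel \<mu> \<le> K"
    and \<nu>: "represents \<alpha> \<nu> h" "total_variation circle_borel \<nu> \<le> L"
    using assms unfolding F_bounded_def by blast
  obtain ps where ps: "\<forall>(c, P) \<in> set ps. finite_measure P \<and> sets P = sets circle_borel \<and>
        emeasure P (sphere 0 1) \<le> total_variation circle_borel \<mu>"
      "\<forall>A \<in> sets circle_borel. \<mu> A = (\<Sum>(c, P)\<leftarrow>ps. c * of_real (measure P A))"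
      "\<forall>z. norm z < 1 \<longrightarrow> g z = (\<Sum>(c, P)\<leftarrow>ps. c * integral\<^sup>L P (frac_kernel \<alpha> z))"
    using represents_as_sum_list[OF \<mu>(1)] by blast
  obtain qs where qs: "\<forall>(c, P) \<in> set qs. finite_measure P \<and> sets P = sets circle_borel \<and>
        emeasure P (sphere 0 1) \<le> total_variation circle_borel \<nu>"
      "\<forall>A \<in> sets circle_borel. \<nu> A = (\<Sum>(c, P)\<leftarrow>qs. c * of_real (measure P A))"
      "\<forall>z. norm z < 1 \<longrightarrow> h z = (\<Sum>(c, P)\<leftarrow>qs. c * integral\<^sup>L P (frac_kernel \<alpha> z))"
    using represents_as_sum_list[OF \<nu>(1)] by blast
  let ?\<rho> = "\<lambda>A. \<mu> A + \<nu> A"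
  have cm: "complex_measure circle_borel ?\<rho>"
    using \<mu>(1) \<nu>(1) unfolding represents_def complex_measure_def by (auto intro!: sums_add)
  have "complex_measure_integral circle_borel ?\<rho> (frac_kernel \<alpha> z) = g z + h z" if z: "norm z < 1" for z
  proof -
    have "complex_measure_integral circle_borel ?\<rho> (frac_kernel \<alpha> z) =
        (\<Sum>(c, P)\<leftarrow>ps @ qs. c * integral\<^sup>L P (frac_kernel \<alpha> z))"
      by (rule complex_measure_integral_sum_list[where K = "(1 - norm z) powr - \<alpha>"])
         (use ps(1,2) qs(1,2) cm z \<alpha> in \<open>auto intro!: norm_frac_kernel_le measurable_circle_borelI\<close>)
    then show ?thesis using ps(3) qs(3) z by simp
  qed
  then have "represents \<alpha> ?\<rho> (\<lambda>z. g z + h z)"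
    using cm unfolding represents_def frac_kernel_def by auto
  moreover have "total_variation circle_borel ?\<rho> \<le> K + L"
    unfolding total_variation_def
  proof (rule SUP_least)
    fix A :: "nat \<Rightarrow> complex set"
    assume A: "A \<in> {A. range A \<subseteq> sets circle_borel \<and> disjoint_family A \<and> (\<Union>i. A i) = space circle_borel}"
    have "(\<Sum>i. ennreal (norm (\<mu> (A i) + \<nu> (A i)))) \<le>
        (\<Sum>i. ennreal (norm (\<mu> (A i))) + ennreal (norm (\<nu> (A i))))"
      by (intro suminf_le) (auto simp flip: ennreal_plus intro!: ennreal_leI norm_triangle_ineq)
    also have "\<dots> = (\<Sum>i. ennreal (norm (\<mu> (A i)))) + (\<Sum>i. ennreal (norm (\<nu> (A i))))"
      by (subst suminf_add) auto
    also have "\<dots> \<le> total_variation circle_borel \<mu> + total_variation circle_borel \<nu>"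
      unfolding total_variation_def by (intro add_mono SUP_upper A)
    also have "\<dots> \<le> K + L" using \<mu>(2) \<nu>(2) by (rule add_mono)
    finally show "(\<Sum>i. ennreal (norm (\<mu> (A i) + \<nu> (A i)))) \<le> K + L" .
  qed
  ultimately show ?thesis unfolding F_bounded_def by blast
qed

text \<open>Balayage: the mass \<open>h x\<close> sitting at \<open>w x\<close> is spread over the
  circle by the harmonic measure at \<open>w x\<close>. P is the image of the density times the
  uniform measure, so the mass is preserved, and Fubini with the mean value property identifies the
  integral.\<close>

lemma frac_kernel_sweep:
  assumes \<alpha>: "0 < \<alpha>" and w [measurable]: "w \<in> borel_measurable M"
    and w1: "\<And>x. x \<in> space M \<Longrightarrow> norm (w x) \<le> 1"
    and h: "integrable M h" and h0: "\<And>x. 0 \<le> (h x :: real)"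
  obtains P where "finite_measure P" "sets P = sets circle_borel"
    "emeasure P (sphere 0 1) = (\<integral>\<^sup>+ x. ennreal (h x) \<partial>M)"
    "\<And>z. norm z < 1 \<Longrightarrow> integral\<^sup>L P (frac_kernel \<alpha> z) = (\<integral>x. h x *\<^sub>R frac_kernel \<alpha> z (w x) \<partial>M)"
proof -
  have [measurable]: "h \<in> borel_measurable M" using h by auto
  define D where "D = density M (\<lambda>x. ennreal (h x))"
  have emD: "emeasure D (space M) = (\<integral>\<^sup>+ x. ennreal (h x) \<partial>M)"
    unfolding D_def by (subst emeasure_density) (auto intro!: nn_integral_cong)
  have spD [simp]: "space D = space M" and [measurable_cong]: "sets D = sets M" by (auto simp: D_def)
  have emD': "emeasure D (space M) < \<infinity>"
    unfolding emD using h h0 by (simp add: integrable_iff_bounded)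
  interpret D: finite_measure D by standard (use emD' in auto)
  interpret pair_sigma_finite D unit_interval ..
  let ?T = "\<lambda>(x, t). harmonic_map (w x) (circle_param t)"
  have cp [measurable]: "circle_param \<in> borel_measurable unit_interval"
    by (intro measurable_unit_intervalI) measurable
  have T: "?T \<in> measurable (D \<Otimes>\<^sub>M unit_interval) circle_borel"
    by (rule measurable_into_circle_borel)
       (measurable, auto simp: space_pair_measure intro!: norm_harmonic_map w1)
  define P where "P = distr (D \<Otimes>\<^sub>M unit_interval) circle_borel ?T"
  have emP: "emeasure P (sphere 0 1) = emeasure D (space M)"
  proof -
    have "emeasure P (sphere 0 1) = emeasure (D \<Otimes>\<^sub>M unit_interval) (space D \<times> space unit_interval)"
      unfolding P_def using T measurable_space[OF T]
      by (subst emeasure_distr)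
         (auto simp: space_pair_measure simp flip: space_circle_borel intro!: arg_cong2[of _ _ _ _ emeasure])
    also have "\<dots> = emeasure D (space M)"
      by (subst unit_interval.emeasure_pair_measure_Times) (auto simp: emeasure_unit_interval simp del: space_unit_interval)
    finally show ?thesis .
  qed
  show ?thesis
  proof (rule that[of P])
    show "finite_measure P" by standard (use emP emD' in \<open>auto simp: P_def\<close>)
    show "sets P = sets circle_borel" by (simp add: P_def)
    show "emeasure P (sphere 0 1) = (\<integral>\<^sup>+ x. ennreal (h x) \<partial>M)" using emP emD by simp
    fix z :: complex assume z: "norm z < 1"
    let ?k = "frac_kernel \<alpha> z"
    interpret DU: finite_measure "D \<Otimes>\<^sub>M unit_interval"
      by (intro finite_measure_pair_measure D.finite_measure_axioms unit_interval.finite_measure_axioms)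
    have int: "integrable (D \<Otimes>\<^sub>M unit_interval) (\<lambda>p. ?k (?T p))"
    proof (rule DU.integrable_const_bound[where B = "(1 - norm z) powr - \<alpha>"])
      show "AE p in D \<Otimes>\<^sub>M unit_interval. norm (?k (?T p)) \<le> (1 - norm z) powr - \<alpha>"
        using z \<alpha> w1 by (intro AE_I2 norm_frac_kernel_le)
          (auto simp: space_pair_measure norm_harmonic_map)
    qed (measurable)
    have "integral\<^sup>L P ?k = (\<integral>p. ?k (?T p) \<partial>(D \<Otimes>\<^sub>M unit_interval))"
      unfolding P_def by (rule integral_distr[OF T]) (intro measurable_circle_borelI, measurable)
    also have "\<dots> = (\<integral>x. (\<integral>t. ?k (?T (x, t)) \<partial>unit_interval) \<partial>D)"
      using integral_fst'[OF int] by simp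
    also have "\<dots> = (\<integral>x. ?k (w x) \<partial>D)"
      by (intro Bochner_Integration.integral_cong refl) (use w1 z in \<open>auto simp: frac_kernel_mean_value\<close>)
    also have "\<dots> = (\<integral>x. h x *\<^sub>R ?k (w x) \<partial>M)"
      unfolding D_def using h0 by (intro integral_density) auto
    finally show "integral\<^sup>L P ?k = (\<integral>x. h x *\<^sub>R ?k (w x) \<partial>M)" .
  qed
qed

lemma integrable_mult_frac_kernel:
  assumes \<alpha>: "0 < \<alpha>" and w [measurable]: "w \<in> borel_measurable M"
    and w1: "\<And>x. x \<in> space M \<Longrightarrow> norm (w x) \<le> 1"
    and h: "integrable M (h :: _ \<Rightarrow> complex)" and z: "norm z < 1"
  shows "integrable M (\<lambda>x. h x * frac_kernel \<alpha> z (w x))"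
proof (rule Bochner_Integration.integrable_bound)
  show "integrable M (\<lambda>x. (1 - norm z) powr - \<alpha> * norm (h x))" using h by auto
  have [measurable]: "h \<in> borel_measurable M" using h by auto
  show "(\<lambda>x. h x * frac_kernel \<alpha> z (w x)) \<in> borel_measurable M" by measurable
  show "AE x in M. norm (h x * frac_kernel \<alpha> z (w x)) \<le> norm ((1 - norm z) powr - \<alpha> * norm (h x))"
  proof (rule AE_I2)
    fix x assume "x \<in> space M"
    from norm_frac_kernel_le[OF w1[OF this] z \<alpha>]
    have "norm (h x) * norm (frac_kernel \<alpha> z (w x)) \<le> norm (h x) * (1 - norm z) powr - \<alpha>"
      by (rule mult_left_mono) simp
    then show "norm (h x * frac_kernel \<alpha> z (w x)) \<le> norm ((1 - norm z) powr - \<alpha> * norm (h x))"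
      by (simp add: norm_mult mult.commute)
  qed
qed

text \<open>Takes the role of the triangle inequality for integrals of kernels at points of the
  closed disk. The factor 4 comes from sweeping the positive and negative parts of Re h and Im h
  separately, each with mass at most that of the modulus of h.\<close>

lemma F_bounded_superposition:
  assumes \<alpha>: "0 < \<alpha>" and w [measurable]: "w \<in> borel_measurable M"
    and w1: "\<And>x. x \<in> space M \<Longrightarrow> norm (w x) \<le> 1"
    and h: "integrable M (h :: _ \<Rightarrow> complex)"
  shows "F_bounded \<alpha> (4 * (\<integral>\<^sup>+ x. ennreal (norm (h x)) \<partial>M)) (\<lambda>z. \<integral>x. h x * frac_kernel \<alpha> z (w x) \<partial>M)"
proof -
  have [measurable]: "h \<in> borel_measurable M" using h by auto
  let ?f = "\<lambda>x. max 0 (Re (h x))" and ?g = "\<lambda>x. max 0 (- Re (h x))"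
  let ?p = "\<lambda>x. max 0 (Im (h x))" and ?q = "\<lambda>x. max 0 (- Im (h x))"
  have int: "integrable M ?f" "integrable M ?g" "integrable M ?p" "integrable M ?q"
    using h by (auto intro!: integrable_max integrable_minus)
  obtain P1 where P1: "finite_measure P1" "sets P1 = sets circle_borel"
    "emeasure P1 (sphere 0 1) = (\<integral>\<^sup>+ x. ennreal (?f x) \<partial>M)"
    "\<And>z. norm z < 1 \<Longrightarrow> integral\<^sup>L P1 (frac_kernel \<alpha> z) = (\<integral>x. ?f x *\<^sub>R frac_kernel \<alpha> z (w x) \<partial>M)"
    by (rule frac_kernel_sweep[OF \<alpha> w w1 int(1)]) auto
  obtain P2 where P2: "finite_measure P2" "sets P2 = sets circle_borel"
    "emeasure P2 (sphere 0 1) = (\<integral>\<^sup>+ x. ennreal (?g x) \<partial>M)"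
    "\<And>z. norm z < 1 \<Longrightarrow> integral\<^sup>L P2 (frac_kernel \<alpha> z) = (\<integral>x. ?g x *\<^sub>R frac_kernel \<alpha> z (w x) \<partial>M)"
    by (rule frac_kernel_sweep[OF \<alpha> w w1 int(2)]) auto
  obtain P3 where P3: "finite_measure P3" "sets P3 = sets circle_borel"
    "emeasure P3 (sphere 0 1) = (\<integral>\<^sup>+ x. ennreal (?p x) \<partial>M)"
    "\<And>z. norm z < 1 \<Longrightarrow> integral\<^sup>L P3 (frac_kernel \<alpha> z) = (\<integral>x. ?p x *\<^sub>R frac_kernel \<alpha> z (w x) \<partial>M)"
    by (rule frac_kernel_sweep[OF \<alpha> w w1 int(3)]) auto
  obtain P4 where P4: "finite_measure P4" "sets P4 = sets circle_borel"
    "emeasure P4 (sphere 0 1) = (\<integral>\<^sup>+ x. ennreal (?q x) \<partial>M)"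
    "\<And>z. norm z < 1 \<Longrightarrow> integral\<^sup>L P4 (frac_kernel \<alpha> z) = (\<integral>x. ?q x *\<^sub>R frac_kernel \<alpha> z (w x) \<partial>M)"
    by (rule frac_kernel_sweep[OF \<alpha> w w1 int(4)]) auto
  let ?ps = "[(1, P1), (-1, P2), (\<i>, P3), (-\<i>, P4)]"
  have "F_bounded \<alpha> (\<Sum>(c, P)\<leftarrow>?ps. ennreal (norm c) * emeasure P (sphere 0 1))
      (\<lambda>z. \<integral>x. h x * frac_kernel \<alpha> z (w x) \<partial>M)"
  proof (rule F_bounded_sum_list[OF \<alpha>])
    show "finite_measure P \<and> sets P = sets circle_borel" if "(c, P) \<in> set ?ps" for c P
      using that P1(1,2) P2(1,2) P3(1,2) P4(1,2) by auto
    fix z :: complex assume z: "norm z < 1"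
    let ?k = "\<lambda>x. frac_kernel \<alpha> z (w x)"
    have ik: "integrable M (\<lambda>x. f x *\<^sub>R ?k x)" if "integrable M f" for f :: "_ \<Rightarrow> real"
      using integrable_mult_frac_kernel[OF \<alpha> w w1 _ z, of "\<lambda>x. of_real (f x)"] that
      by (simp add: scaleR_conv_of_real)
    have "(\<integral>x. h x * ?k x \<partial>M) = (\<integral>x. (?f x *\<^sub>R ?k x - ?g x *\<^sub>R ?k x) +
        \<i> * (?p x *\<^sub>R ?k x - ?q x *\<^sub>R ?k x) \<partial>M)"
    proof (intro Bochner_Integration.integral_cong refl)
      fix x
      have "h x = (of_real (?f x) - of_real (?g x)) + \<i> * (of_real (?p x) - of_real (?q x))"
        by (simp add: complex_eq_iff max_def)
      then have "h x * ?k x = ((of_real (?f x) - of_real (?g x)) + \<i> * (of_real (?p x) - of_real (?q x))) * ?k x"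
        by (rule arg_cong)
      then show "h x * ?k x = (?f x *\<^sub>R ?k x - ?g x *\<^sub>R ?k x) + \<i> * (?p x *\<^sub>R ?k x - ?q x *\<^sub>R ?k x)"
        by (simp only: scaleR_conv_of_real ring_distribs mult.assoc)
    qed
    also have "\<dots> = ((\<integral>x. ?f x *\<^sub>R ?k x \<partial>M) - (\<integral>x. ?g x *\<^sub>R ?k x \<partial>M)) +
        \<i> * ((\<integral>x. ?p x *\<^sub>R ?k x \<partial>M) - (\<integral>x. ?q x *\<^sub>R ?k x \<partial>M))"
      using int[THEN ik] by simp
    finally show "(\<integral>x. h x * ?k x \<partial>M) = (\<Sum>(c, P)\<leftarrow>?ps. c * integral\<^sup>L P (frac_kernel \<alpha> z))"
      using P1(4) P2(4) P3(4) P4(4) z by (simp add: algebra_simps)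
  qed
  then show ?thesis
  proof (rule F_bounded_mono)
    let ?I = "\<integral>\<^sup>+ x. ennreal (norm (h x)) \<partial>M"
    have "emeasure P1 (sphere 0 1) \<le> ?I" "emeasure P2 (sphere 0 1) \<le> ?I"
      "emeasure P3 (sphere 0 1) \<le> ?I" "emeasure P4 (sphere 0 1) \<le> ?I"
      unfolding P1(3) P2(3) P3(3) P4(3)
      using abs_Re_le_cmod abs_Im_le_cmod
      by (auto intro!: nn_integral_mono ennreal_leI simp: abs_le_iff)
    then have "emeasure P1 (sphere 0 1) + (emeasure P2 (sphere 0 1) +
        (emeasure P3 (sphere 0 1) + emeasure P4 (sphere 0 1))) \<le> ?I + (?I + (?I + ?I))"
      by (intro add_mono)
    also have "?I + (?I + (?I + ?I)) = (1 + (1 + (1 + 1))) * ?I" by (simp only: distrib_right mult_1)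
    also have "(1 + (1 + (1 + 1))) = (4 :: ennreal)" by simp
    finally show "(\<Sum>(c, P)\<leftarrow>?ps. ennreal (norm c) * emeasure P (sphere 0 1)) \<le> 4 * ?I" by simp
  qed
qed

section \<open>Differences of kernels\<close>

lemma integrable_unit_interval:
  fixes f :: "real \<Rightarrow> complex"
  assumes "continuous_on {0..1} f"
  shows "integrable unit_interval f"
proof -
  have "set_integrable lborel {0..1} f"
    using assms by (rule borel_integrable_atLeastAtMost')
  then show ?thesis
    unfolding unit_interval_def set_integrable_def by (simp add: integrable_restrict_space)
qed

section \<open>Cauchy's formula for kernels at nearby points\<close>

text \<open>The difference of the Cauchy kernels at \<open>cnj w\<close> and \<open>cnj a\<close> on
  the circle of radius 1 - |a| about \<open>cnj a\<close>: with u = (1 - |a|)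
  \<open>circle_param t\<close> and v = \<open>cnj (w - a)\<close> it is u / (u - v) - 1 = v / (u -
  v). The conjugates appear because the kernel is holomorphic in \<open>cnj w\<close>.\<close>

definition circle_weight :: "complex \<Rightarrow> complex \<Rightarrow> real \<Rightarrow> complex" where
  "circle_weight a w t = cnj (w - a) / (of_real (1 - norm a) * circle_param t - cnj (w - a))"

text \<open>The circle about a that touches the unit circle from inside, conjugated back so that it
  can be inserted into the kernel.\<close>

definition circle_point :: "complex \<Rightarrow> real \<Rightarrow> complex" where
  "circle_point a t = a + of_real (1 - norm a) * cnj (circle_param t)"

lemma norm_circle_point_le: "norm a \<le> 1 \<Longrightarrow> norm (circle_point a t) \<le> 1"
  unfolding circle_point_def
  by (rule order_trans[OF norm_triangle_ineq])
     (simp only: norm_mult norm_of_real complex_mod_cnj norm_circle_param, simp)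

lemma circle_weight_denom:
  assumes "norm a < 1" "norm (w - a) \<le> (1 - norm a) / 2"
  shows "(1 - norm a) / 2 \<le> norm (of_real (1 - norm a) * circle_param t - cnj (w - a))"
proof -
  define r where "r = 1 - norm a"
  define u where "u = of_real r * circle_param t"
  define v where "v = cnj (w - a)"
  have "norm u = r" using assms by (simp add: u_def norm_mult) (simp add: r_def)
  moreover have "norm v \<le> r / 2" using assms(2) by (simp only: v_def r_def complex_mod_cnj)
  ultimately have "r / 2 \<le> norm (u - v)" using norm_triangle_ineq2[of u v] by linarith
  then show ?thesis by (simp only: u_def v_def r_def)
qed

lemma norm_circle_weight_le:
  assumes "norm a < 1" "norm (w - a) \<le> (1 - norm a) / 2"
  shows "norm (circle_weight a w t) \<le> 2 * (norm (w - a) / (1 - norm a))"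
proof -
  have "norm (circle_weight a w t) \<le> norm (w - a) / ((1 - norm a) / 2)"
    unfolding circle_weight_def norm_divide complex_mod_cnj
    using assms circle_weight_denom[OF assms, of t] by (intro frac_le) auto
  then show ?thesis by (simp add: mult.commute)
qed

text \<open>Two instances of Cauchy's formula, subtracted. The contour may touch the unit circle,
  but for |z| < 1 the kernel is still holomorphic on the closed disk that it bounds.\<close>

lemma frac_kernel_diff_circle:
  assumes a: "norm a < 1" and w: "norm (w - a) \<le> (1 - norm a) / 2" and z: "norm z < 1"
  shows "frac_kernel \<alpha> z w - frac_kernel \<alpha> z a =
    (\<integral>t. circle_weight a w t * frac_kernel \<alpha> z (circle_point a t) \<partial>unit_interval)"
proof -
  define f where "f \<zeta> = 1 / (1 - \<zeta> * z) powr complex_of_real \<alpha>" for \<zeta>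
  define r where "r = 1 - norm a"
  have r: "0 < r" using a by (simp add: r_def)
  have norm_le: "norm \<zeta> \<le> 1" if "\<zeta> \<in> cball (cnj a) r" for \<zeta>
    using that norm_triangle_ineq2[of \<zeta> "cnj a"] by (simp add: r_def dist_norm norm_minus_commute)
  have np: "1 - \<zeta> * z \<notin> \<real>\<^sub>\<le>\<^sub>0" "1 - \<zeta> * z \<noteq> 0" if "\<zeta> \<in> cball (cnj a) r" for \<zeta>
    using one_minus_not_nonpos[of \<zeta> z] norm_le[OF that] z by blast+
  have nz: "(1 - \<zeta> * z) powr complex_of_real \<alpha> \<noteq> 0" if "\<zeta> \<in> cball (cnj a) r" for \<zeta>
    using np(2)[OF that] by simp
  have hol: "f holomorphic_on cball (cnj a) r"
    unfolding f_def by (intro holomorphic_intros) (rule np nz, assumption)+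
  then have cont: "continuous_on (cball (cnj a) r) f" by (rule holomorphic_on_imp_continuous_on)
  have hol': "f holomorphic_on ball (cnj a) r" using hol by (rule holomorphic_on_subset) auto
  let ?e = "\<lambda>t. cnj a + of_real r * circle_param t"
  have e: "?e t \<in> cball (cnj a) r" for t using r by (simp add: dist_norm norm_mult)
  have ball: "cnj w \<in> ball (cnj a) r" "cnj a \<in> ball (cnj a) r"
    using w r by (simp_all add: dist_norm r_def norm_minus_commute flip: complex_cnj_diff)
  have ne: "?e t \<noteq> v" if "v \<in> ball (cnj a) r" for t v
    using that r by (auto simp: dist_norm norm_mult)
  have int: "integrable unit_interval (\<lambda>t. f (?e t) * (of_real r * circle_param t / (?e t - v)))"
    if "v \<in> ball (cnj a) r" for v
  proof (intro integrable_unit_interval continuous_intros continuous_circle_param)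
    show "continuous_on {0..1} (\<lambda>t. f (?e t))"
      by (rule continuous_on_compose2[OF cont])
         (auto intro!: continuous_intros continuous_circle_param e simp del: mem_cball)
    show "\<forall>t\<in>{0..1}. ?e t - v \<noteq> 0" using ne[OF that] by simp
  qed
  have "f (cnj w) - f (cnj a) =
      (\<integral>t. f (?e t) * (of_real r * circle_param t / (?e t - cnj w)) \<partial>unit_interval) -
      (\<integral>t. f (?e t) * (of_real r * circle_param t / (?e t - cnj a)) \<partial>unit_interval)"
    by (rule arg_cong2[OF cauchy_circle_param[OF cont hol' ball(1)] cauchy_circle_param[OF cont hol' ball(2)]])
  also have "\<dots> = (\<integral>t. f (?e t) * (of_real r * circle_param t / (?e t - cnj w)) -
      f (?e t) * (of_real r * circle_param t / (?e t - cnj a)) \<partial>unit_interval)"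
    by (rule Bochner_Integration.integral_diff[OF int[OF ball(1)] int[OF ball(2)], symmetric])
  also have "\<dots> = (\<integral>t. circle_weight a w t * frac_kernel \<alpha> z (circle_point a t) \<partial>unit_interval)"
  proof (intro Bochner_Integration.integral_cong refl)
    fix t
    have d: "?e t - cnj w = of_real r * circle_param t - cnj (w - a)" by simp
    have nz: "of_real r * circle_param t - cnj (w - a) \<noteq> 0"
      using ne[OF ball(1), of t] d by auto
    have "of_real r * circle_param t / (of_real r * circle_param t - cnj (w - a)) - 1 = circle_weight a w t"
      using nz by (simp add: circle_weight_def r_def divide_simps del: complex_cnj_diff)
    moreover have "f (?e t) = frac_kernel \<alpha> z (circle_point a t)"
      by (simp add: f_def frac_kernel_def circle_point_def r_def)
    moreover have "of_real r * circle_param t / (?e t - cnj a) = 1" using r by simp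
    ultimately show "f (?e t) * (of_real r * circle_param t / (?e t - cnj w)) -
        f (?e t) * (of_real r * circle_param t / (?e t - cnj a)) =
        circle_weight a w t * frac_kernel \<alpha> z (circle_point a t)"
      unfolding d by (simp only: mult_1_right) (metis mult.commute mult.right_neutral right_diff_distrib)
  qed
  finally show ?thesis by (simp add: f_def frac_kernel_def)
qed

lemma measurable_circle_weight [measurable (raw)]:
  assumes [measurable]: "a \<in> borel_measurable M" "w \<in> borel_measurable M" "t \<in> borel_measurable M"
  shows "(\<lambda>x. circle_weight (a x) (w x) (t x)) \<in> borel_measurable M"
  unfolding circle_weight_def by measurable

lemma measurable_circle_point [measurable (raw)]:
  assumes [measurable]: "a \<in> borel_measurable M" "t \<in> borel_measurable M"
  shows "(\<lambda>x. circle_point (a x) (t x)) \<in> borel_measurable M"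
  unfolding circle_point_def by measurable

lemma measurable_unit_interval_ident: "(\<lambda>t. t) \<in> borel_measurable unit_interval"
  by (intro measurable_unit_intervalI) measurable

lemma nn_integral_unit_interval_const [simp]: "(\<integral>\<^sup>+ t. c \<partial>unit_interval) = c"
  using emeasure_unit_interval by simp

text \<open>The circle formula turns the integral of differences into a superposition of kernels
  over M times the unit interval, whose coefficient is small where w is close to a. Hence only h
  times this gain must be integrable. The constant is 4 from the superposition times 2 from the
  bound of \<open>circle_weight\<close>.\<close>

lemma F_bounded_diff_near:
  fixes h :: "'a \<Rightarrow> complex"
  assumes \<alpha>: "0 < \<alpha>" and "sigma_finite_measure M"
    and [measurable]: "a \<in> borel_measurable M" "w \<in> borel_measurable M" "h \<in> borel_measurable M"
    and a: "\<And>x. x \<in> space M \<Longrightarrow> norm (a x) < 1"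
    and w: "\<And>x. x \<in> space M \<Longrightarrow> norm (w x - a x) \<le> (1 - norm (a x)) / 2"
    and fin: "(\<integral>\<^sup>+ x. ennreal (norm (h x) * (norm (w x - a x) / (1 - norm (a x)))) \<partial>M) < \<infinity>"
      (is "?I < \<infinity>")
  shows "F_bounded \<alpha> (8 * ?I)
    (\<lambda>z. \<integral>x. h x * (frac_kernel \<alpha> z (w x) - frac_kernel \<alpha> z (a x)) \<partial>M)"
proof -
  interpret sigma_finite_measure M by fact
  interpret pair_sigma_finite M unit_interval ..
  let ?N = "M \<Otimes>\<^sub>M unit_interval"
  define H where "H p = h (fst p) * circle_weight (a (fst p)) (w (fst p)) (snd p)" for p
  define W where "W p = circle_point (a (fst p)) (snd p)" for p
  have [measurable]: "snd \<in> borel_measurable ?N"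
    by (rule measurable_compose[OF measurable_snd measurable_unit_interval_ident])
  have mH [measurable]: "H \<in> borel_measurable ?N"
    unfolding H_def by measurable
  have mW [measurable]: "W \<in> borel_measurable ?N"
    unfolding W_def by measurable
  have W1: "norm (W p) \<le> 1" if "p \<in> space ?N" for p
    using that a norm_circle_point_le by (auto simp: W_def space_pair_measure less_imp_le)
  have "(\<integral>\<^sup>+ p. ennreal (norm (H p)) \<partial>?N) = (\<integral>\<^sup>+ x. \<integral>\<^sup>+ t. ennreal (norm (H (x, t))) \<partial>unit_interval \<partial>M)"
    by (rule unit_interval.nn_integral_fst[symmetric]) measurable
  also have "\<dots> \<le> (\<integral>\<^sup>+ x. \<integral>\<^sup>+ t. ennreal (2 * (norm (h x) * (norm (w x - a x) / (1 - norm (a x))))) \<partial>unit_interval \<partial>M)"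
  proof (intro nn_integral_mono ennreal_leI)
    fix x t assume "x \<in> space M"
    from norm_circle_weight_le[OF a[OF this] w[OF this], of t]
    have "norm (h x) * norm (circle_weight (a x) (w x) t) \<le>
        norm (h x) * (2 * (norm (w x - a x) / (1 - norm (a x))))"
      by (rule mult_left_mono) simp
    then show "norm (H (x, t)) \<le> 2 * (norm (h x) * (norm (w x - a x) / (1 - norm (a x))))"
      by (simp add: H_def norm_mult mult_ac)
  qed
  also have "\<dots> = (\<integral>\<^sup>+ x. 2 * ennreal (norm (h x) * (norm (w x - a x) / (1 - norm (a x)))) \<partial>M)"
    by (intro nn_integral_cong, subst nn_integral_unit_interval_const, subst ennreal_mult') simp_all
  also have "\<dots> = 2 * ?I"
    by (rule nn_integral_cmult) measurable
  finally have le: "(\<integral>\<^sup>+ p. ennreal (norm (H p)) \<partial>?N) \<le> 2 * ?I" .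
  have intH: "integrable ?N H"
    using le fin by (intro integrableI_bounded) (auto simp: order_le_less_trans ennreal_mult_less_top)
  have eq: "(\<integral>p. H p * frac_kernel \<alpha> z (W p) \<partial>?N) =
      (\<integral>x. h x * (frac_kernel \<alpha> z (w x) - frac_kernel \<alpha> z (a x)) \<partial>M)" if z: "norm z < 1" for z
  proof -
    have "(\<integral>p. H p * frac_kernel \<alpha> z (W p) \<partial>?N) =
        (\<integral>x. \<integral>t. H (x, t) * frac_kernel \<alpha> z (W (x, t)) \<partial>unit_interval \<partial>M)"
      using integral_fst'[OF integrable_mult_frac_kernel[OF \<alpha> mW W1 intH z]] by simp
    also have "\<dots> = (\<integral>x. h x * (frac_kernel \<alpha> z (w x) - frac_kernel \<alpha> z (a x)) \<partial>M)"
      by (intro Bochner_Integration.integral_cong refl)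
         (simp add: frac_kernel_diff_circle[OF a w z] H_def W_def mult.assoc)
    finally show ?thesis .
  qed
  have "F_bounded \<alpha> (4 * (\<integral>\<^sup>+ p. ennreal (norm (H p)) \<partial>?N)) (\<lambda>z. \<integral>p. H p * frac_kernel \<alpha> z (W p) \<partial>?N)"
    by (rule F_bounded_superposition[OF \<alpha> mW W1 intH])
  then have "F_bounded \<alpha> (4 * (\<integral>\<^sup>+ p. ennreal (norm (H p)) \<partial>?N))
      (\<lambda>z. \<integral>x. h x * (frac_kernel \<alpha> z (w x) - frac_kernel \<alpha> z (a x)) \<partial>M)"
    by (subst (asm) F_bounded_cong[OF eq])
  then show ?thesis
  proof (rule F_bounded_mono)
    have "4 * (\<integral>\<^sup>+ p. ennreal (norm (H p)) \<partial>?N) \<le> 4 * (2 * ?I)" by (intro mult_left_mono le) simp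
    also have "\<dots> = 8 * ?I" by (simp flip: mult.assoc)
    finally show "4 * (\<integral>\<^sup>+ p. ennreal (norm (H p)) \<partial>?N) \<le> 8 * ?I" .
  qed
qed

text \<open>A bound at a single z, used to show that integrals of h times a difference of kernels
  exist although h itself may not be integrable. The constant 4 covers both cases: 2 near a by the
  circle formula, and 2 far from a, where the minimum is at least 1/2.\<close>

lemma norm_frac_kernel_diff_le:
  assumes a: "norm a < 1" and w: "norm w \<le> 1" and z: "norm z < 1" and \<alpha>: "0 < \<alpha>"
  shows "norm (frac_kernel \<alpha> z w - frac_kernel \<alpha> z a) \<le>
    4 * (1 - norm z) powr - \<alpha> * min 1 (norm (w - a) / (1 - norm a))"
proof -
  let ?K = "(1 - norm z) powr - \<alpha>"
  show ?thesis
  proof (cases "norm (w - a) \<le> (1 - norm a) / 2")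
    case True
    let ?q = "norm (w - a) / (1 - norm a)"
    have q: "?q \<le> 1 / 2" using True a by (simp add: field_simps)
    have "norm (circle_weight a w t * frac_kernel \<alpha> z (circle_point a t)) \<le> (2 * ?q) * ?K" for t
      unfolding norm_mult using norm_circle_weight_le[OF a True] norm_frac_kernel_le[OF norm_circle_point_le z \<alpha>] a
      by (intro mult_mono) auto
    note bound = this
    let ?f = "\<lambda>t. circle_weight a w t * frac_kernel \<alpha> z (circle_point a t)"
    have "?f \<in> borel_measurable unit_interval"
      by (intro measurable_unit_intervalI) measurable
    then have "integrable unit_interval ?f"
      using bound by (intro unit_interval.integrable_const_bound[where B = "(2 * ?q) * ?K"] AE_I2)
    then have "(\<integral>t. norm (?f t) \<partial>unit_interval) \<le> (\<integral>t. (2 * ?q) * ?K \<partial>unit_interval)"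
      using bound by (intro integral_mono integrable_norm) auto
    also have "\<dots> = (2 * ?q) * ?K" using emeasure_unit_interval by (simp add: measure_def)
    finally have "norm (\<integral>t. ?f t \<partial>unit_interval) \<le> (2 * ?q) * ?K"
      using integral_norm_bound[of unit_interval ?f] by linarith
    then have "norm (frac_kernel \<alpha> z w - frac_kernel \<alpha> z a) \<le> (2 * ?q) * ?K"
      by (simp only: frac_kernel_diff_circle[OF a True z])
    also have "\<dots> \<le> (4 * ?q) * ?K" using a by (intro mult_right_mono) auto
    also have "\<dots> = 4 * ?K * min 1 ?q" using min.absorb2[of ?q 1] q by (simp only: mult_ac)
    finally show ?thesis .
  next
    case False
    then have "1 \<le> 2 * (norm (w - a) / (1 - norm a))" using a by (simp add: field_simps)
    then have "1 \<le> 2 * min 1 (norm (w - a) / (1 - norm a))" by (simp add: min_def)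
    then have "2 * ?K * 1 \<le> 2 * ?K * (2 * min 1 (norm (w - a) / (1 - norm a)))"
      by (intro mult_left_mono) auto
    moreover have "norm (frac_kernel \<alpha> z w - frac_kernel \<alpha> z a) \<le> ?K + ?K"
      using a w z \<alpha> by (intro order_trans[OF norm_triangle_ineq4] add_mono norm_frac_kernel_le) auto
    ultimately show ?thesis by simp
  qed
qed

lemma integrable_mult_frac_kernel_diff:
  fixes h :: "'a \<Rightarrow> complex"
  assumes \<alpha>: "0 < \<alpha>"
    and [measurable]: "a \<in> borel_measurable M" "w \<in> borel_measurable M" "h \<in> borel_measurable M"
    and a: "\<And>x. x \<in> space M \<Longrightarrow> norm (a x) < 1"
    and w: "\<And>x. x \<in> space M \<Longrightarrow> norm (w x) \<le> 1"
    and fin: "(\<integral>\<^sup>+ x. ennreal (norm (h x) * min 1 (norm (w x - a x) / (1 - norm (a x)))) \<partial>M) < \<infinity>"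
    and z: "norm z < 1"
  shows "integrable M (\<lambda>x. h x * (frac_kernel \<alpha> z (w x) - frac_kernel \<alpha> z (a x)))"
proof (rule Bochner_Integration.integrable_bound)
  let ?m = "\<lambda>x. norm (h x) * min 1 (norm (w x - a x) / (1 - norm (a x)))"
  have nn: "0 \<le> ?m x" if "x \<in> space M" for x using a[OF that] by simp
  have "(\<integral>\<^sup>+ x. ennreal (norm (?m x)) \<partial>M) = (\<integral>\<^sup>+ x. ennreal (?m x) \<partial>M)"
    using nn by (intro nn_integral_cong) (simp only: real_norm_def abs_of_nonneg)
  moreover have "?m \<in> borel_measurable M" by measurable
  ultimately have "integrable M ?m" using fin by (intro integrableI_bounded) simp_all
  then show "integrable M (\<lambda>x. 4 * (1 - norm z) powr - \<alpha> * ?m x)" by simp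
  show "(\<lambda>x. h x * (frac_kernel \<alpha> z (w x) - frac_kernel \<alpha> z (a x))) \<in> borel_measurable M"
    by measurable
  show "AE x in M. norm (h x * (frac_kernel \<alpha> z (w x) - frac_kernel \<alpha> z (a x))) \<le>
      norm (4 * (1 - norm z) powr - \<alpha> * ?m x)"
  proof (rule AE_I2)
    fix x assume x: "x \<in> space M"
    from norm_frac_kernel_diff_le[OF a[OF x] w[OF x] z \<alpha>]
    have "norm (h x) * norm (frac_kernel \<alpha> z (w x) - frac_kernel \<alpha> z (a x)) \<le>
        norm (h x) * (4 * (1 - norm z) powr - \<alpha> * min 1 (norm (w x - a x) / (1 - norm (a x))))"
      by (rule mult_left_mono) simp
    also have "\<dots> = 4 * (1 - norm z) powr - \<alpha> * ?m x" by (simp only: mult_ac)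
    also have "\<dots> \<le> norm (4 * (1 - norm z) powr - \<alpha> * ?m x)" by simp
    finally show "norm (h x * (frac_kernel \<alpha> z (w x) - frac_kernel \<alpha> z (a x))) \<le>
      norm (4 * (1 - norm z) powr - \<alpha> * ?m x)" by (simp only: norm_mult)
  qed
qed

text \<open>
  Where \<open>w\<close> is within half the distance of \<open>a\<close> to the circle, Cauchy's formula gains the
  factor \<open>\<bar>w - a\<bar> / (1 - \<bar>a\<bar>)\<close>; elsewhere the two kernels are estimated separately.
\<close>

lemma F_bounded_diff:
  fixes h :: "'a \<Rightarrow> complex"
  assumes \<alpha>: "0 < \<alpha>" and sf: "sigma_finite_measure M"
    and ma [measurable]: "a \<in> borel_measurable M" and mw [measurable]: "w \<in> borel_measurable M"
    and mh [measurable]: "h \<in> borel_measurable M"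
    and a: "\<And>x. x \<in> space M \<Longrightarrow> norm (a x) < 1"
    and w: "\<And>x. x \<in> space M \<Longrightarrow> norm (w x) \<le> 1"
    and fin: "(\<integral>\<^sup>+ x. ennreal (norm (h x) * min 1 (norm (w x - a x) / (1 - norm (a x)))) \<partial>M) < \<infinity>"
      (is "?I < \<infinity>")
  shows "F_bounded \<alpha> (24 * ?I)
    (\<lambda>z. \<integral>x. h x * (frac_kernel \<alpha> z (w x) - frac_kernel \<alpha> z (a x)) \<partial>M)"
proof -
  let ?k = "frac_kernel \<alpha>"
  define near where "near x \<longleftrightarrow> norm (w x - a x) \<le> (1 - norm (a x)) / 2" for x
  have [measurable]: "Measurable.pred M near" unfolding near_def by measurable
  \<comment> \<open>Setting v = a off the near set makes the near estimate applicable on all of M,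
    with integrand 0 there. The function f carries h on the rest; there the minimum is at least 1/2,
    so f is integrable and its two kernels can be separated. Each of the three pieces contributes
    8.\<close>
  define v where "v x = (if near x then w x else a x)" for x
  define f where "f x = (if near x then 0 else h x)" for x
  have mv [measurable]: "v \<in> borel_measurable M" unfolding v_def by measurable
  have mf [measurable]: "f \<in> borel_measurable M" unfolding f_def by measurable
  have v: "norm (v x - a x) \<le> (1 - norm (a x)) / 2" "norm (v x) \<le> 1"
    "norm (v x - a x) / (1 - norm (a x)) \<le> min 1 (norm (w x - a x) / (1 - norm (a x)))"
    if "x \<in> space M" for x
  proof -
    have "norm (w x - a x) / (1 - norm (a x)) \<le> 1" if "near x"
      using that a[OF \<open>x \<in> space M\<close>] by (simp add: near_def field_simps)
    then show "norm (v x - a x) / (1 - norm (a x)) \<le> min 1 (norm (w x - a x) / (1 - norm (a x)))"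
      using a[OF that] by (auto simp: v_def)
  qed (use a[OF that] w[OF that] in \<open>auto simp: v_def near_def\<close>)
  have v_le: "(\<integral>\<^sup>+ x. ennreal (norm (h x) * (norm (v x - a x) / (1 - norm (a x)))) \<partial>M) \<le> ?I"
    by (intro nn_integral_mono ennreal_leI mult_left_mono v(3)) auto
  have v_le': "(\<integral>\<^sup>+ x. ennreal (norm (h x) * min 1 (norm (v x - a x) / (1 - norm (a x)))) \<partial>M) \<le> ?I"
    by (intro nn_integral_mono ennreal_leI mult_left_mono order_trans[OF min.cobounded2 v(3)]) auto
  have "F_bounded \<alpha> (8 * (\<integral>\<^sup>+ x. ennreal (norm (h x) * (norm (v x - a x) / (1 - norm (a x)))) \<partial>M))
      (\<lambda>z. \<integral>x. h x * (?k z (v x) - ?k z (a x)) \<partial>M)"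
    using v_le fin by (intro F_bounded_diff_near[OF \<alpha> sf ma mv mh a v(1)]) auto
  then have near: "F_bounded \<alpha> (8 * ?I) (\<lambda>z. \<integral>x. h x * (?k z (v x) - ?k z (a x)) \<partial>M)"
    by (rule F_bounded_mono) (intro mult_left_mono v_le, simp)
  have f_le: "(\<integral>\<^sup>+ x. ennreal (norm (f x)) \<partial>M) \<le> 2 * ?I"
  proof -
    have "(\<integral>\<^sup>+ x. ennreal (norm (f x)) \<partial>M) \<le>
        (\<integral>\<^sup>+ x. 2 * ennreal (norm (h x) * min 1 (norm (w x - a x) / (1 - norm (a x)))) \<partial>M)"
    proof (rule nn_integral_mono)
      fix x assume x: "x \<in> space M"
      let ?m = "min 1 (norm (w x - a x) / (1 - norm (a x)))"
      have "norm (f x) \<le> 2 * (norm (h x) * ?m)"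
      proof (cases "near x")
        case False
        then have "1 \<le> 2 * ?m" using a[OF x] by (simp add: near_def field_simps min_def)
        then have "norm (h x) * 1 \<le> norm (h x) * (2 * ?m)" by (rule mult_left_mono) simp
        then show ?thesis using False by (simp add: f_def mult_ac)
      qed (use a[OF x] in \<open>simp add: f_def\<close>)
      then have "ennreal (norm (f x)) \<le> ennreal (2 * (norm (h x) * ?m))" by (rule ennreal_leI)
      then show "ennreal (norm (f x)) \<le> 2 * ennreal (norm (h x) * ?m)" by (simp add: ennreal_mult')
    qed
    also have "\<dots> = 2 * ?I" by (rule nn_integral_cmult) measurable
    finally show ?thesis .
  qed
  have intf: "integrable M f"
    using f_le fin by (intro integrableI_bounded mf) (auto simp: order_le_less_trans ennreal_mult_less_top)
  have far: "F_bounded \<alpha> (8 * ?I) (\<lambda>z. \<integral>x. f x * ?k z (w x) \<partial>M)"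
    "F_bounded \<alpha> (8 * ?I) (\<lambda>z. \<integral>x. (- f x) * ?k z (a x) \<partial>M)"
  proof -
    have le: "4 * (\<integral>\<^sup>+ x. ennreal (norm (f x)) \<partial>M) \<le> 8 * ?I"
    proof -
      have "4 * (\<integral>\<^sup>+ x. ennreal (norm (f x)) \<partial>M) \<le> 4 * (2 * ?I)" by (intro mult_left_mono f_le) simp
      also have "\<dots> = 8 * ?I" by (simp flip: mult.assoc)
      finally show ?thesis .
    qed
    show "F_bounded \<alpha> (8 * ?I) (\<lambda>z. \<integral>x. f x * ?k z (w x) \<partial>M)"
      by (rule F_bounded_mono[OF F_bounded_superposition[OF \<alpha> mw w intf] le])
    have "F_bounded \<alpha> (4 * (\<integral>\<^sup>+ x. ennreal (norm (- f x)) \<partial>M)) (\<lambda>z. \<integral>x. (- f x) * ?k z (a x) \<partial>M)"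
      using a intf by (intro F_bounded_superposition[OF \<alpha> ma]) (auto simp: less_imp_le)
    then show "F_bounded \<alpha> (8 * ?I) (\<lambda>z. \<integral>x. (- f x) * ?k z (a x) \<partial>M)"
      by (rule F_bounded_mono) (use le in simp)
  qed
  have sum: "F_bounded \<alpha> (8 * ?I + (8 * ?I + 8 * ?I)) (\<lambda>z. (\<integral>x. h x * (?k z (v x) - ?k z (a x)) \<partial>M) +
      ((\<integral>x. f x * ?k z (w x) \<partial>M) + (\<integral>x. (- f x) * ?k z (a x) \<partial>M)))"
    by (intro F_bounded_add \<alpha> near far)
  have I24: "8 * ?I + (8 * ?I + 8 * ?I) = 24 * ?I"
    by (simp flip: distrib_right)
  have eq: "(\<integral>x. h x * (?k z (v x) - ?k z (a x)) \<partial>M) +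
      ((\<integral>x. f x * ?k z (w x) \<partial>M) + (\<integral>x. (- f x) * ?k z (a x) \<partial>M)) =
      (\<integral>x. h x * (?k z (w x) - ?k z (a x)) \<partial>M)" if z: "norm z < 1" for z
  proof -
    have i1: "integrable M (\<lambda>x. h x * (?k z (v x) - ?k z (a x)))"
      using v_le' fin by (intro integrable_mult_frac_kernel_diff[OF \<alpha> ma mv mh a v(2) _ z]) auto
    have i2: "integrable M (\<lambda>x. f x * ?k z (w x))"
      by (rule integrable_mult_frac_kernel[OF \<alpha> mw w intf z])
    have i3: "integrable M (\<lambda>x. (- f x) * ?k z (a x))"
      using a intf z by (intro integrable_mult_frac_kernel[OF \<alpha> ma]) (auto simp: less_imp_le)
    have "(\<integral>x. h x * (?k z (v x) - ?k z (a x)) \<partial>M) +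
        ((\<integral>x. f x * ?k z (w x) \<partial>M) + (\<integral>x. (- f x) * ?k z (a x) \<partial>M)) =
        (\<integral>x. h x * (?k z (v x) - ?k z (a x)) + (f x * ?k z (w x) + (- f x) * ?k z (a x)) \<partial>M)"
      using Bochner_Integration.integral_add[OF i1 Bochner_Integration.integrable_add[OF i2 i3]]
        Bochner_Integration.integral_add[OF i2 i3] by simp
    also have "\<dots> = (\<integral>x. h x * (?k z (w x) - ?k z (a x)) \<partial>M)"
      by (intro Bochner_Integration.integral_cong refl) (auto simp: f_def v_def algebra_simps)
    finally show ?thesis .
  qed
  show ?thesis using sum unfolding I24 by (subst (asm) F_bounded_cong[OF eq])
qed

section \<open>Products with a simple fraction\<close>

text \<open>Split at s = 1 / \<kappa>. Below, the minimum is replaced by s\<kappa>, which gives (1 -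
  \<alpha>) / \<alpha> times \<open>\<kappa> powr (1 - \<alpha>)\<close>; above, it is replaced by 1
  and the range extended to infinity, which gives \<open>\<kappa> powr (1 - \<alpha>)\<close>. The
  sum is the bound. For \<alpha> = 1 the integrand vanishes.\<close>

lemma nn_integral_powr_min_le:
  assumes \<alpha>: "0 < \<alpha>" "\<alpha> \<le> 1" and \<kappa>: "1 \<le> \<kappa>"
  shows "(\<integral>\<^sup>+ s. ennreal ((1 - \<alpha>) * s powr (\<alpha> - 2) * min 1 (s * \<kappa>)) \<partial>unit_interval) \<le>
    ennreal (\<kappa> powr (1 - \<alpha>) / \<alpha>)"
proof (cases "\<alpha> = 1")
  case False
  with \<alpha> have "\<alpha> < 1" by simp
  define c where "c = 1 / \<kappa>"
  have c: "0 < c" using \<kappa> by (simp add: c_def)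
  have c_powr: "c powr (\<alpha> - 1) = \<kappa> powr (1 - \<alpha>)" "\<kappa> * c powr \<alpha> = \<kappa> powr (1 - \<alpha>)"
    using \<kappa> by (simp_all add: c_def powr_divide powr_diff powr_minus field_simps)
  have "((\<lambda>s. (1 - \<alpha>) * \<kappa> * s powr (\<alpha> - 1)) has_integral (1 - \<alpha>) * \<kappa> * (c powr \<alpha> / \<alpha>)) {0..c}"
    using has_integral_mult_right[OF has_integral_powr_from_0[of "\<alpha> - 1" c]] \<alpha> c by auto
  from nn_integral_has_integral_lebesgue'[OF _ this]
  have I1: "(\<integral>\<^sup>+ s. ennreal ((1 - \<alpha>) * \<kappa> * s powr (\<alpha> - 1)) * indicator {0..c} s \<partial>lborel) =
      ennreal ((1 - \<alpha>) / \<alpha> * \<kappa> powr (1 - \<alpha>))"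
    using \<alpha> \<kappa> by (simp add: mult_ac flip: c_powr(2))
  have "((\<lambda>s. (1 - \<alpha>) * s powr (\<alpha> - 2)) has_integral (1 - \<alpha>) * (- (c powr (\<alpha> - 2 + 1)) / (\<alpha> - 2 + 1))) {c..}"
    using \<open>\<alpha> < 1\<close> c by (intro has_integral_mult_right has_integral_powr_to_inf) auto
  moreover have "(1 - \<alpha>) * (- (c powr (\<alpha> - 2 + 1)) / (\<alpha> - 2 + 1)) = \<kappa> powr (1 - \<alpha>)"
    using \<open>\<alpha> < 1\<close> by (simp add: c_powr(1)[symmetric] field_simps)
  ultimately have "((\<lambda>s. (1 - \<alpha>) * s powr (\<alpha> - 2)) has_integral \<kappa> powr (1 - \<alpha>)) {c..}" by simp
  from nn_integral_has_integral_lebesgue'[OF _ this]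
  have I2: "(\<integral>\<^sup>+ s. ennreal ((1 - \<alpha>) * s powr (\<alpha> - 2)) * indicator {c..} s \<partial>lborel) = ennreal (\<kappa> powr (1 - \<alpha>))"
    using \<alpha> by simp
  have "(\<integral>\<^sup>+ s. ennreal ((1 - \<alpha>) * s powr (\<alpha> - 2) * min 1 (s * \<kappa>)) \<partial>unit_interval) =
      (\<integral>\<^sup>+ s. ennreal ((1 - \<alpha>) * s powr (\<alpha> - 2) * min 1 (s * \<kappa>)) * indicator {0..1} s \<partial>lborel)"
    unfolding unit_interval_def by (intro nn_integral_restrict_space) simp
  also have "\<dots> \<le> (\<integral>\<^sup>+ s. ennreal ((1 - \<alpha>) * \<kappa> * s powr (\<alpha> - 1)) * indicator {0..c} s +
      ennreal ((1 - \<alpha>) * s powr (\<alpha> - 2)) * indicator {c..} s \<partial>lborel)"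
  proof (rule nn_integral_mono)
    fix s :: real
    let ?f = "(1 - \<alpha>) * s powr (\<alpha> - 2) * min 1 (s * \<kappa>)"
    consider "s < 0 \<or> s > 1" | "0 \<le> s" "s \<le> c" | "c \<le> s" "0 \<le> s" by linarith
    then show "ennreal ?f * indicator {0..1} s \<le> ennreal ((1 - \<alpha>) * \<kappa> * s powr (\<alpha> - 1)) * indicator {0..c} s +
        ennreal ((1 - \<alpha>) * s powr (\<alpha> - 2)) * indicator {c..} s"
    proof cases
      case 2
      have "s powr (\<alpha> - 2) * min 1 (s * \<kappa>) \<le> s powr (\<alpha> - 2) * (s * \<kappa>)"
        by (intro mult_left_mono) auto
      also have "\<dots> = \<kappa> * s powr (\<alpha> - 1)"
      proof (cases "s = 0")
        case False
        then have "s powr (\<alpha> - 1) = s powr (\<alpha> - 2) * s powr 1"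
          by (simp only: powr_add[symmetric]) simp
        then show ?thesis using False 2 by simp
      qed simp
      finally have "(1 - \<alpha>) * (s powr (\<alpha> - 2) * min 1 (s * \<kappa>)) \<le> (1 - \<alpha>) * (\<kappa> * s powr (\<alpha> - 1))"
        using \<alpha> by (intro mult_left_mono) auto
      then have "ennreal ?f \<le> ennreal ((1 - \<alpha>) * \<kappa> * s powr (\<alpha> - 1))"
        by (intro ennreal_leI) (simp only: mult.assoc)
      then show ?thesis using 2
        by (intro order_trans[OF _ add_increasing2[OF _ order_refl]]) (auto simp: indicator_def)
    next
      case 3
      have "(1 - \<alpha>) * s powr (\<alpha> - 2) * min 1 (s * \<kappa>) \<le> (1 - \<alpha>) * s powr (\<alpha> - 2) * 1"
        using \<alpha> by (intro mult_left_mono) auto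
      then have "ennreal ?f \<le> ennreal ((1 - \<alpha>) * s powr (\<alpha> - 2))"
        by (intro ennreal_leI) simp
      then show ?thesis using 3
        by (intro order_trans[OF _ add_increasing[OF _ order_refl]]) (auto simp: indicator_def)
    qed auto
  qed
  also have "\<dots> = (\<integral>\<^sup>+ s. ennreal ((1 - \<alpha>) * \<kappa> * s powr (\<alpha> - 1)) * indicator {0..c} s \<partial>lborel) +
      (\<integral>\<^sup>+ s. ennreal ((1 - \<alpha>) * s powr (\<alpha> - 2)) * indicator {c..} s \<partial>lborel)"
    by (rule nn_integral_add) measurable
  also have "\<dots> = ennreal ((1 - \<alpha>) / \<alpha> * \<kappa> powr (1 - \<alpha>) + \<kappa> powr (1 - \<alpha>))"
    unfolding I1 I2 using \<alpha> by (subst ennreal_plus) auto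
  also have "(1 - \<alpha>) / \<alpha> * \<kappa> powr (1 - \<alpha>) + \<kappa> powr (1 - \<alpha>) = \<kappa> powr (1 - \<alpha>) / \<alpha>"
    using \<alpha> by (simp add: field_simps)
  finally show ?thesis .
qed simp

section \<open>The chord from a point of the disk to a point of the circle\<close>

lemma norm_chord_le:
  fixes a \<xi> :: complex
  assumes "norm a \<le> 1" "norm \<xi> \<le> 1" and s: "0 \<le> s" "s \<le> 1"
  shows "norm (a + of_real s * (\<xi> - a)) \<le> 1"
proof -
  have "a + of_real s * (\<xi> - a) = (1 - s) *\<^sub>R a + s *\<^sub>R \<xi>"
    by (simp add: scaleR_conv_of_real algebra_simps)
  also have "norm \<dots> \<le> (1 - s) * norm a + s * norm \<xi>"
    using s by (intro order_trans[OF norm_triangle_ineq]) simp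
  also have "\<dots> \<le> (1 - s) * 1 + s * 1"
    using assms by (intro add_mono mult_left_mono) auto
  finally show ?thesis by simp
qed

lemma chord_nn_integral:
  fixes a \<xi> :: complex
  assumes a: "norm a < 1" and \<xi>: "norm \<xi> = 1" and \<alpha>: "0 < \<alpha>" "\<alpha> \<le> 1"
  shows "(\<integral>\<^sup>+ s. ennreal ((1 - \<alpha>) * s powr (\<alpha> - 2) *
      min 1 (norm (of_real s * (\<xi> - a)) / (1 - norm a))) \<partial>unit_interval)
    \<le> ennreal ((norm (\<xi> - a) / (1 - norm a)) powr (1 - \<alpha>) / \<alpha>)"
proof -
  have "1 \<le> norm (\<xi> - a) / (1 - norm a)"
    using norm_triangle_ineq2[of \<xi> a] a \<xi> by (simp add: field_simps)
  from nn_integral_powr_min_le[OF \<alpha> this]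
  have "(\<integral>\<^sup>+ s. ennreal ((1 - \<alpha>) * s powr (\<alpha> - 2) *
      min 1 (s * (norm (\<xi> - a) / (1 - norm a)))) \<partial>unit_interval)
    \<le> ennreal ((norm (\<xi> - a) / (1 - norm a)) powr (1 - \<alpha>) / \<alpha>)" .
  also have "(\<integral>\<^sup>+ s. ennreal ((1 - \<alpha>) * s powr (\<alpha> - 2) *
      min 1 (s * (norm (\<xi> - a) / (1 - norm a)))) \<partial>unit_interval) =
    (\<integral>\<^sup>+ s. ennreal ((1 - \<alpha>) * s powr (\<alpha> - 2) *
      min 1 (norm (of_real s * (\<xi> - a)) / (1 - norm a))) \<partial>unit_interval)"
    by (intro nn_integral_cong) (simp add: norm_mult)
  finally show ?thesis .
qed

context
  fixes a \<xi> z :: complex and \<alpha> :: real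
  assumes a: "norm a < 1" and \<xi>: "norm \<xi> = 1" and z: "norm z < 1" and \<alpha>: "0 < \<alpha>" "\<alpha> \<le> 1"
begin

text \<open>
  With \<open>A\<^sub>s = 1 - cnj w\<^sub>s z\<close> and \<open>w\<^sub>s\<close> on the segment from \<open>a\<close> to \<open>\<xi>\<close>, the derivative of
  \<open>s\<^sup>\<alpha>\<^sup>-\<^sup>1 (A\<^sub>0\<^sup>-\<^sup>\<alpha> - A\<^sub>s\<^sup>1\<^sup>-\<^sup>\<alpha> / A\<^sub>0)\<close> is \<open>(1 - \<alpha>) s\<^sup>\<alpha>\<^sup>-\<^sup>2 (A\<^sub>s\<^sup>-\<^sup>\<alpha> - A\<^sub>0\<^sup>-\<^sup>\<alpha>)\<close>. At \<open>s = 0\<close> the function has limit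
  \<open>0\<close>, which is also its junk value there, as \<open>0 powr x = 0\<close>.
\<close>

lemma has_integral_chord:
  "((\<lambda>s. of_real ((1 - \<alpha>) * s powr (\<alpha> - 2)) *
      (frac_kernel \<alpha> z (a + of_real s * (\<xi> - a)) - frac_kernel \<alpha> z a)) has_integral
    (frac_kernel \<alpha> z a - (1 - cnj \<xi> * z) powr of_real (1 - \<alpha>) / (1 - cnj a * z))) {0..1}"
proof -
  define c where "c = cnj (\<xi> - a) * z"
  define A where "A s = 1 - cnj a * z - s * c" for s :: complex
  define K where "K = frac_kernel \<alpha> z a"
  define H where "H s = (s powr (\<alpha> - 1)) *\<^sub>R (K - A (of_real s) powr of_real (1 - \<alpha>) / A 0)" for s :: real
  define H' where "H' s = of_real ((1 - \<alpha>) * s powr (\<alpha> - 2)) *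
      (frac_kernel \<alpha> z (a + of_real s * (\<xi> - a)) - frac_kernel \<alpha> z a)" for s :: real
  have A_eq: "A (of_real s) = 1 - cnj (a + of_real s * (\<xi> - a)) * z" for s
    by (simp add: A_def c_def algebra_simps)
  have Re_A: "1 - norm z \<le> Re (A (of_real s))" "0 < Re (A (of_real s))" if "0 \<le> s" "s \<le> 1" for s
    unfolding A_eq using Re_one_minus_pos[of "cnj (a + of_real s * (\<xi> - a))" z] norm_chord_le[OF less_imp_le[OF a] eq_refl[OF \<xi>] that] z
    by (simp_all only: complex_mod_cnj)
  have np: "A (of_real s) \<notin> \<real>\<^sub>\<le>\<^sub>0" "A (of_real s) \<noteq> 0" if "0 \<le> s" "s \<le> 1" for s
    using Re_A(2)[OF that] by (auto simp: complex_nonpos_Reals_iff)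
  have A0: "A 0 \<noteq> 0" using np(2)[of 0] by simp
  have A_powr: "A (of_real s) powr of_real (1 - \<alpha>) = A (of_real s) * A (of_real s) powr (- of_real \<alpha>)"
    if "0 \<le> s" "s \<le> 1" for s
    using np[OF that] by (simp add: powr_diff powr_minus divide_inverse)
  have k_eq: "frac_kernel \<alpha> z (a + of_real s * (\<xi> - a)) = A (of_real s) powr (- of_real \<alpha>)" for s
    unfolding frac_kernel_def A_eq by (simp add: powr_minus divide_inverse)
  have K_eq: "K = A 0 powr (- of_real \<alpha>)" using k_eq[of 0] by (simp add: K_def)
  have deriv: "(H has_vector_derivative H' s) (at s)" if s: "0 < s" "s \<le> 1" for s
  proof -
    have "(A has_field_derivative - c) (at (of_real s))"
      unfolding A_def by (auto intro!: derivative_eq_intros)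
    from DERIV_chain2[OF has_field_derivative_powr[where s = "of_real (1 - \<alpha>)", OF np(1)] this]
    have "((\<lambda>s. A s powr of_real (1 - \<alpha>)) has_field_derivative
        (of_real (1 - \<alpha>) * A (of_real s) powr (- of_real \<alpha>) * (- c))) (at (of_real s))"
      using s by simp
    from DERIV_diff[OF DERIV_const DERIV_cdivide[OF this]]
    have "((\<lambda>s. K - A s powr of_real (1 - \<alpha>) / A 0) has_field_derivative
        (of_real (1 - \<alpha>) * A (of_real s) powr (- of_real \<alpha>) * c / A 0)) (at (of_real s))"
      by simp
    then have X: "((\<lambda>s. K - A (of_real s) powr of_real (1 - \<alpha>) / A 0) has_vector_derivative
        (of_real (1 - \<alpha>) * A (of_real s) powr (- of_real \<alpha>) * c / A 0)) (at s)"
      by (rule has_vector_derivative_real_field)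
    have p: "((\<lambda>s. s powr (\<alpha> - 1)) has_field_derivative (\<alpha> - 1) * s powr (\<alpha> - 2)) (at s)"
      using has_real_derivative_powr[OF s(1), of "\<alpha> - 1"] by simp
    have "(H has_vector_derivative
        (s powr (\<alpha> - 1)) *\<^sub>R (of_real (1 - \<alpha>) * A (of_real s) powr (- of_real \<alpha>) * c / A 0) +
        ((\<alpha> - 1) * s powr (\<alpha> - 2)) *\<^sub>R (K - A (of_real s) powr of_real (1 - \<alpha>) / A 0)) (at s)"
      unfolding H_def by (rule has_vector_derivative_scaleR[OF p X])
    also have "(s powr (\<alpha> - 1)) *\<^sub>R (of_real (1 - \<alpha>) * A (of_real s) powr (- of_real \<alpha>) * c / A 0) +
        ((\<alpha> - 1) * s powr (\<alpha> - 2)) *\<^sub>R (K - A (of_real s) powr of_real (1 - \<alpha>) / A 0) = H' s"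
    proof -
      define P where "P = A (of_real s) powr (- of_real \<alpha>)"
      define q where "q = complex_of_real (s powr (\<alpha> - 2))"
      have "s powr (\<alpha> - 1) = s powr (\<alpha> - 2) * s powr 1"
        by (simp only: powr_add[symmetric]) simp
      then have q: "complex_of_real (s powr (\<alpha> - 1)) = q * of_real s" using s by (simp add: q_def)
      \<comment> \<open>This relation merges the two terms of the product rule: the contributions
        with the power of the value at s add up to the value at 0, which cancels the denominator
        \<open>A 0\<close>.\<close>
      have A0_eq: "A 0 = A (of_real s) + of_real s * c" by (simp add: A_def)
      have "q * of_real s * ((1 - of_real \<alpha>) * P * c / A 0) +
          ((of_real \<alpha> - 1) * q) * (K - A (of_real s) * P / A 0) =
          (1 - of_real \<alpha>) * q * (P * ((A (of_real s) + of_real s * c) / A 0) - K)"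
        using A0 by (simp add: field_simps)
      also have "(A (of_real s) + of_real s * c) / A 0 = 1"
        using A0 unfolding A0_eq[symmetric] by simp
      finally show ?thesis
        using s unfolding H'_def k_eq K_def[symmetric] A_powr[OF less_imp_le[OF s(1)] s(2)] P_def[symmetric]
        by (simp add: scaleR_conv_of_real q q_def[symmetric])
    qed
    finally show ?thesis .
  qed
  have "continuous (at s within {0..1}) H" if s: "s \<in> {0..1}" for s
  proof (cases "s = 0")
    case False
    then show ?thesis
      using has_vector_derivative_continuous[OF deriv[of s]] s by (auto intro: continuous_at_imp_continuous_within)
  next
    case True
    \<comment> \<open>On the half-plane where the real part is at least 1 - |z|, the function w powr
      (1 - \<alpha>) is Lipschitz, so the bracket in H is O(t). The factor
      \<open>t powr (\<alpha> - 1)\<close> leaves \<open>t powr \<alpha>\<close>, which tends to 0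
      because \<alpha> > 0.\<close>
    define L where "L = (1 - \<alpha>) * (1 - norm z) powr - \<alpha> * norm c / norm (A 0)"
    have H_le: "norm (H t) \<le> L * t powr \<alpha>" if t: "t \<in> {0..1}" for t
    proof -
      let ?S = "{w. Re w \<ge> 1 - norm z}"
      have "norm (A (of_real t) powr of_real (1 - \<alpha>) - A 0 powr of_real (1 - \<alpha>)) \<le>
          (1 - \<alpha>) * (1 - norm z) powr - \<alpha> * norm (A (of_real t) - A 0)"
      proof (rule field_differentiable_bound[of ?S])
        show "convex ?S" by (rule convex_halfspace_Re_ge)
        fix w assume w: "w \<in> ?S"
        then have "0 < Re w" using z by simp
        then have "w \<notin> \<real>\<^sub>\<le>\<^sub>0" by (auto simp: complex_nonpos_Reals_iff)
        from has_field_derivative_powr[OF this, of "of_real (1 - \<alpha>)"]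
        show "((\<lambda>z. z powr of_real (1 - \<alpha>)) has_field_derivative
            of_real (1 - \<alpha>) * w powr (- of_real \<alpha>)) (at w within ?S)"
          by (simp add: has_field_derivative_at_within)
        have "norm w powr - \<alpha> \<le> (1 - norm z) powr - \<alpha>"
          using z w \<alpha> complex_Re_le_cmod[of w] by (intro powr_mono2') auto
        then have "(1 - \<alpha>) * norm w powr - \<alpha> \<le> (1 - \<alpha>) * (1 - norm z) powr - \<alpha>"
          using \<alpha> by (intro mult_left_mono) auto
        moreover have "norm (w powr (- of_real \<alpha>)) = norm w powr - \<alpha>"
          by (simp add: norm_powr_real_powr')
        moreover have "norm (complex_of_real (1 - \<alpha>)) = 1 - \<alpha>" using \<alpha> by (simp only: norm_of_real)
        ultimately show "norm (of_real (1 - \<alpha>) * w powr (- of_real \<alpha>)) \<le> (1 - \<alpha>) * (1 - norm z) powr - \<alpha>"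
          by (simp only: norm_mult)
      qed (use Re_A(1)[of t] Re_A(1)[of 0] t in auto)
      also have "A (of_real t) - A 0 = - (of_real t * c)" by (simp add: A_def)
      also have "norm (- (of_real t * c)) = t * norm c" using t by (simp add: norm_mult)
      finally have le: "norm (A (of_real t) powr of_real (1 - \<alpha>) - A 0 powr of_real (1 - \<alpha>)) \<le>
          (1 - \<alpha>) * (1 - norm z) powr - \<alpha> * (t * norm c)" .
      have "K - A (of_real t) powr of_real (1 - \<alpha>) / A 0 =
          - ((A (of_real t) powr of_real (1 - \<alpha>) - A 0 powr of_real (1 - \<alpha>)) / A 0)"
        using A_powr[of 0] A0 by (simp add: K_eq field_simps)
      then have "norm (K - A (of_real t) powr of_real (1 - \<alpha>) / A 0) =
          norm (A (of_real t) powr of_real (1 - \<alpha>) - A 0 powr of_real (1 - \<alpha>)) / norm (A 0)"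
        by (simp only: norm_minus_cancel norm_divide)
      also have "\<dots> \<le> (1 - \<alpha>) * (1 - norm z) powr - \<alpha> * (t * norm c) / norm (A 0)"
        by (intro divide_right_mono le) simp
      also have "\<dots> = t * L" by (simp add: L_def)
      finally have "norm (H t) \<le> t powr (\<alpha> - 1) * (t * L)"
        unfolding H_def by (simp add: mult_left_mono)
      also have "t powr (\<alpha> - 1) * (t * L) = L * t powr \<alpha>"
      proof (cases "t = 0")
        case False
        then have "t powr \<alpha> = t powr (\<alpha> - 1) * t powr 1"
          by (simp only: powr_add[symmetric]) simp
        then show ?thesis using False t by simp
      qed simp
      finally show ?thesis .
    qed
    have "((\<lambda>t. L * t powr \<alpha>) \<longlongrightarrow> 0) (at 0 within {0..1})"
    proof -
      have "continuous_on {0..1} (\<lambda>t. L * t powr \<alpha>)"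
        using \<alpha> by (intro continuous_intros continuous_on_powr') auto
      then show ?thesis by (auto simp: continuous_on_def dest!: bspec[of _ _ 0])
    qed
    then have "(H \<longlongrightarrow> 0) (at 0 within {0..1})"
      by (rule Lim_null_comparison[rotated]) (use H_le in \<open>auto simp: eventually_at_filter\<close>)
    moreover have "H 0 = 0" by (simp add: H_def)
    ultimately show ?thesis using True by (simp add: continuous_within)
  qed
  then have "continuous_on {0..1} H" by (simp add: continuous_on_eq_continuous_within)
  then have "(H' has_integral (H 1 - H 0)) {0..1}"
    by (intro fundamental_theorem_of_calculus_interior deriv) auto
  moreover have "H 1 - H 0 = frac_kernel \<alpha> z a - (1 - cnj \<xi> * z) powr of_real (1 - \<alpha>) / (1 - cnj a * z)"
    using A_eq[of 1] by (simp add: H_def K_def) (simp add: A_def)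
  ultimately show ?thesis unfolding H'_def[abs_def] by (simp only:)
qed

text \<open>The fundamental theorem yields a gauge integral only. Absolute integrability near s = 0
  comes from the smallness of the difference of kernels, through \<open>chord_nn_integral\<close>;
  after that both integrals agree.\<close>

lemma lebesgue_integral_chord:
  "(\<integral>s. of_real ((1 - \<alpha>) * s powr (\<alpha> - 2)) *
      (frac_kernel \<alpha> z (a + of_real s * (\<xi> - a)) - frac_kernel \<alpha> z a) \<partial>unit_interval) =
    frac_kernel \<alpha> z a - (1 - cnj \<xi> * z) powr of_real (1 - \<alpha>) / (1 - cnj a * z)"
proof -
  let ?f = "\<lambda>s. complex_of_real ((1 - \<alpha>) * s powr (\<alpha> - 2)) *
      (frac_kernel \<alpha> z (a + of_real s * (\<xi> - a)) - frac_kernel \<alpha> z a)"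
  have "integrable unit_interval ?f"
  proof (rule integrable_mult_frac_kernel_diff)
    show "(\<lambda>s. a + of_real s * (\<xi> - a)) \<in> borel_measurable unit_interval"
      "(\<lambda>s. complex_of_real ((1 - \<alpha>) * s powr (\<alpha> - 2))) \<in> borel_measurable unit_interval"
      by (intro measurable_unit_intervalI; measurable)+
    show "norm (a + of_real s * (\<xi> - a)) \<le> 1" if "s \<in> space unit_interval" for s
      using that norm_chord_le[of a \<xi> s] a \<xi> by simp
    have "norm (complex_of_real ((1 - \<alpha>) * s powr (\<alpha> - 2))) = (1 - \<alpha>) * s powr (\<alpha> - 2)" for s
      using \<alpha> by (simp only: norm_of_real) simp
    then show "(\<integral>\<^sup>+ s. ennreal (norm (complex_of_real ((1 - \<alpha>) * s powr (\<alpha> - 2))) *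
        min 1 (norm (a + of_real s * (\<xi> - a) - a) / (1 - norm a))) \<partial>unit_interval) < \<infinity>"
      using chord_nn_integral[OF a \<xi> \<alpha>] by (simp add: order_le_less_trans)
  qed (use a z \<alpha> in auto)
  then have "set_integrable lborel {0..1} ?f"
    unfolding unit_interval_def set_integrable_def by (simp add: integrable_restrict_space)
  from set_borel_integral_eq_integral(2)[OF this] show ?thesis
    unfolding integral_unique[OF has_integral_chord]
    unfolding unit_interval_def set_lebesgue_integral_def by (simp add: integral_restrict_space)
qed

text \<open>Because |\<xi>| = 1, the denominators A = 1 - \<open>cnj a * z\<close> and B = 1 -
  \<open>cnj \<xi> * z\<close> satisfy A - \<open>cnj a * \<xi>\<close> B = 1 -
  \<open>cnj a * \<xi>\<close>. Dividing by A leaves the quotient of B powr (1 - \<alpha>) by A,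
  which is the boundary term of the chord formula. For \<alpha> = 1 the integral is 0 and this is a
  partial fraction decomposition.\<close>

lemma simple_fraction_times_frac_kernel:
  "1 / (1 - cnj a * z) * frac_kernel \<alpha> z \<xi> =
    1 / (1 - cnj a * \<xi>) * (frac_kernel \<alpha> z \<xi> + (- (cnj a * \<xi>) * frac_kernel \<alpha> z a +
      cnj a * \<xi> * (\<integral>s. of_real ((1 - \<alpha>) * s powr (\<alpha> - 2)) *
        (frac_kernel \<alpha> z (a + of_real s * (\<xi> - a)) - frac_kernel \<alpha> z a) \<partial>unit_interval)))"
proof -
  define A where "A = 1 - cnj a * z"
  define B where "B = 1 - cnj \<xi> * z"
  define P where "P = frac_kernel \<alpha> z \<xi>"
  have A: "A \<noteq> 0" and B: "B \<noteq> 0" and D: "1 - cnj a * \<xi> \<noteq> 0"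
    using one_minus_not_nonpos(2)[of "cnj a" z] one_minus_not_nonpos(2)[of "cnj \<xi>" z]
      one_minus_not_nonpos(2)[of \<xi> "cnj a"] a \<xi> z by (auto simp: A_def B_def mult.commute)
  have BP: "B powr of_real (1 - \<alpha>) = B * P"
    using B by (simp add: P_def frac_kernel_def B_def[symmetric] powr_diff)
  have "cnj \<xi> * \<xi> = 1" using \<xi> by (simp add: complex_norm_square[symmetric] mult.commute)
  then have "A - cnj a * \<xi> * B = 1 - cnj a * \<xi>"
    by (simp add: A_def B_def algebra_simps)
  then have "1 / A * P = 1 / (1 - cnj a * \<xi>) * (P - cnj a * \<xi> * (B * P / A))"
  proof -
    assume *: "A - cnj a * \<xi> * B = 1 - cnj a * \<xi>"
    have "P - cnj a * \<xi> * (B * P / A) = (A - cnj a * \<xi> * B) * P / A"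
      using A by (simp add: field_simps)
    then show ?thesis using D unfolding * by simp
  qed
  then show ?thesis
    unfolding lebesgue_integral_chord A_def[symmetric] B_def[symmetric] P_def[symmetric] BP
    by (simp add: algebra_simps)
qed

end

text \<open>The product formula integrated over a parameter space, so that measures and series are
  treated at once. The kernels at \<xi> and at a cost 4 each as superpositions; the differences
  along the chords cost 24, times 1 / \<alpha> from the integral in s.\<close>

lemma F_bounded_simple_fraction:
  fixes h :: "'a \<Rightarrow> complex"
  assumes \<alpha>: "0 < \<alpha>" "\<alpha> \<le> 1" and sf: "sigma_finite_measure M"
    and ma [measurable]: "a \<in> borel_measurable M" and m\<xi> [measurable]: "\<xi> \<in> borel_measurable M"
    and mh [measurable]: "h \<in> borel_measurable M"
    and a: "\<And>x. x \<in> space M \<Longrightarrow> norm (a x) < 1"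
    and \<xi>: "\<And>x. x \<in> space M \<Longrightarrow> norm (\<xi> x) = 1"
    and fin: "(\<integral>\<^sup>+ x. ennreal (norm (h x) * (norm (1 - cnj (a x) * \<xi> x) powr - \<alpha> *
        (1 - norm (a x)) powr (\<alpha> - 1))) \<partial>M) < \<infinity>"
      (is "?I < \<infinity>")
  shows "F_bounded \<alpha> (ennreal (8 + 24 / \<alpha>) * ?I)
    (\<lambda>z. \<integral>x. h x / (1 - cnj (a x) * z) * frac_kernel \<alpha> z (\<xi> x) \<partial>M)"
proof -
  interpret sigma_finite_measure M by fact
  interpret pair_sigma_finite M unit_interval ..
  let ?N = "M \<Otimes>\<^sub>M unit_interval" and ?k = "frac_kernel \<alpha>"
  have [measurable]: "snd \<in> borel_measurable ?N"
    by (rule measurable_compose[OF measurable_snd measurable_unit_interval_ident])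
  define d where "d x = norm (1 - cnj (a x) * \<xi> x)" for x
  define W where "W x = d x powr - \<alpha> * (1 - norm (a x)) powr (\<alpha> - 1)" for x
  \<comment> \<open>e, f and g are the coefficients of the three terms of the product formula: the
    kernel at \<xi>, the kernel at a, and the differences along the chord, the last one on M times
    the unit interval.\<close>
  define e where "e x = h x / (1 - cnj (a x) * \<xi> x)" for x
  define f where "f x = - (e x * (cnj (a x) * \<xi> x))" for x
  define g where "g p = - f (fst p) * of_real ((1 - \<alpha>) * snd p powr (\<alpha> - 2))" for p :: "'a \<times> real"
  define w where "w p = a (fst p) + of_real (snd p) * (\<xi> (fst p) - a (fst p))" for p :: "'a \<times> real"
  have me [measurable]: "e \<in> borel_measurable M" unfolding e_def by measurable
  have mf [measurable]: "f \<in> borel_measurable M" unfolding f_def by measurable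
  have mg [measurable]: "g \<in> borel_measurable ?N" unfolding g_def by measurable
  have mw [measurable]: "w \<in> borel_measurable ?N" unfolding w_def by measurable
  have ma': "(\<lambda>p. a (fst p)) \<in> borel_measurable ?N" by measurable
  have mW [measurable]: "W \<in> borel_measurable M" unfolding W_def d_def by measurable
  have I_eq: "?I = (\<integral>\<^sup>+ x. ennreal (norm (h x) * W x) \<partial>M)" by (simp add: W_def d_def)
  have W0: "0 \<le> W x" for x by (simp add: W_def)
  have d_ge: "1 - norm (a x) \<le> d x" and d_pos: "0 < d x" and d_eq: "norm (\<xi> x - a x) = d x"
    if x: "x \<in> space M" for x
  proof -
    show "1 - norm (a x) \<le> d x"
      using Re_one_minus_pos(1)[of "\<xi> x" "cnj (a x)"] a[OF x] \<xi>[OF x]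
        complex_Re_le_cmod[of "1 - \<xi> x * cnj (a x)"] by (simp add: d_def mult.commute)
    then show "0 < d x" using a[OF x] by linarith
    have "norm (\<xi> x - a x) = norm (cnj (\<xi> x - a x) * \<xi> x)"
      using \<xi>[OF x] by (simp only: norm_mult complex_mod_cnj)
    also have "cnj (\<xi> x - a x) * \<xi> x = 1 - cnj (a x) * \<xi> x"
      using complex_norm_square[of "\<xi> x"] \<xi>[OF x] by (simp add: algebra_simps)
    finally show "norm (\<xi> x - a x) = d x" by (simp add: d_def)
  qed
  have e_eq: "norm (e x) = norm (h x) / d x" for x by (simp add: e_def d_def norm_divide)
  have e_le: "norm (e x) \<le> norm (h x) * W x" if x: "x \<in> space M" for x
  proof -
    \<comment> \<open>The exponent \<alpha> - 1 is not positive, so replacing d by the smaller 1 -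
      |a| increases the power. This bounds 1 / d by the weight W.\<close>
    have "d x powr (\<alpha> - 1) \<le> (1 - norm (a x)) powr (\<alpha> - 1)"
      using d_ge[OF x] a[OF x] \<alpha> by (intro powr_mono2') auto
    then have "d x powr - \<alpha> * d x powr (\<alpha> - 1) \<le> W x"
      unfolding W_def by (intro mult_left_mono) auto
    moreover have "d x powr - \<alpha> * d x powr (\<alpha> - 1) = 1 / d x"
      using d_pos[OF x] powr_add[of "d x" "- \<alpha>" "\<alpha> - 1"] by (simp add: powr_minus_divide del: powr_minus)
    ultimately have "norm (h x) * (1 / d x) \<le> norm (h x) * W x" by (intro mult_left_mono) auto
    then show ?thesis by (simp add: e_eq)
  qed
  have f_le: "norm (f x) \<le> norm (e x)" if x: "x \<in> space M" for x
    using a[OF x] \<xi>[OF x] by (simp add: f_def norm_mult mult_left_le)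
  have eI: "(\<integral>\<^sup>+ x. ennreal (norm (e x)) \<partial>M) \<le> ?I" and fI: "(\<integral>\<^sup>+ x. ennreal (norm (f x)) \<partial>M) \<le> ?I"
    unfolding I_eq using e_le f_le by (auto intro!: nn_integral_mono ennreal_leI intro: order_trans)
  have inte: "integrable M e" and intf: "integrable M f"
    using eI fI fin by (auto intro!: integrableI_bounded simp: order_le_less_trans)
  have gI: "(\<integral>\<^sup>+ p. ennreal (norm (g p) * min 1 (norm (w p - a (fst p)) / (1 - norm (a (fst p))))) \<partial>?N) \<le>
      ennreal (1 / \<alpha>) * ?I" (is "?J \<le> _")
  proof -
    have "?J = (\<integral>\<^sup>+ x. \<integral>\<^sup>+ s. ennreal (norm (g (x, s)) *
        min 1 (norm (w (x, s) - a x) / (1 - norm (a x)))) \<partial>unit_interval \<partial>M)"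
    proof -
      have "(\<lambda>p. ennreal (norm (g p) * min 1 (norm (w p - a (fst p)) / (1 - norm (a (fst p)))))) \<in>
          borel_measurable ?N"
        by measurable
      from unit_interval.nn_integral_fst[OF this] show ?thesis by simp
    qed
    also have "\<dots> \<le> (\<integral>\<^sup>+ x. ennreal (1 / \<alpha>) * ennreal (norm (h x) * W x) \<partial>M)"
    proof (rule nn_integral_mono)
      fix x assume x: "x \<in> space M"
      have "(\<integral>\<^sup>+ s. ennreal (norm (g (x, s)) *
            min 1 (norm (w (x, s) - a x) / (1 - norm (a x)))) \<partial>unit_interval) =
          (\<integral>\<^sup>+ s. ennreal (norm (f x)) * ennreal ((1 - \<alpha>) * s powr (\<alpha> - 2) *
            min 1 (norm (of_real s * (\<xi> x - a x)) / (1 - norm (a x)))) \<partial>unit_interval)"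
      proof (rule nn_integral_cong)
        fix s :: real
        have "norm (g (x, s)) = norm (f x) * ((1 - \<alpha>) * s powr (\<alpha> - 2))"
          using \<alpha> by (simp only: g_def fst_conv snd_conv norm_mult norm_minus_cancel norm_of_real) simp
        moreover have "w (x, s) - a x = of_real s * (\<xi> x - a x)" by (simp add: w_def)
        ultimately show "ennreal (norm (g (x, s)) * min 1 (norm (w (x, s) - a x) / (1 - norm (a x)))) =
            ennreal (norm (f x)) * ennreal ((1 - \<alpha>) * s powr (\<alpha> - 2) *
              min 1 (norm (of_real s * (\<xi> x - a x)) / (1 - norm (a x))))"
          by (simp only: mult.assoc ennreal_mult'[OF norm_ge_zero])
      qed
      also have "\<dots> = ennreal (norm (f x)) * (\<integral>\<^sup>+ s. ennreal ((1 - \<alpha>) * s powr (\<alpha> - 2) *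
            min 1 (norm (of_real s * (\<xi> x - a x)) / (1 - norm (a x)))) \<partial>unit_interval)"
        by (rule nn_integral_cmult) (intro measurable_unit_intervalI, measurable)
      also have "\<dots> \<le> ennreal (norm (e x)) * ennreal ((norm (\<xi> x - a x) / (1 - norm (a x))) powr (1 - \<alpha>) / \<alpha>)"
        using f_le[OF x] by (intro mult_mono ennreal_leI chord_nn_integral[OF a[OF x] \<xi>[OF x] \<alpha>]) auto
      also have "\<dots> = ennreal (norm (e x) * ((d x / (1 - norm (a x))) powr (1 - \<alpha>) / \<alpha>))"
        by (simp only: d_eq[OF x] ennreal_mult'[OF norm_ge_zero])
      also have "norm (e x) * ((d x / (1 - norm (a x))) powr (1 - \<alpha>) / \<alpha>) = 1 / \<alpha> * (norm (h x) * W x)"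
      proof -
        \<comment> \<open>An equality: the bound of the chord integral, divided by d, is W up to the
          factor 1 / \<alpha>. This dictates the form of the weight.\<close>
        have "(d x / (1 - norm (a x))) powr (1 - \<alpha>) / d x = W x"
        proof -
          have "(d x / (1 - norm (a x))) powr (1 - \<alpha>) = d x powr (1 - \<alpha>) / (1 - norm (a x)) powr (1 - \<alpha>)"
            using d_pos[OF x] a[OF x] by (simp add: powr_divide)
          moreover have "d x powr (1 - \<alpha>) = d x * d x powr - \<alpha>"
            using d_pos[OF x] by (simp add: powr_diff powr_minus divide_inverse)
          moreover have "(1 - norm (a x)) powr (\<alpha> - 1) = 1 / (1 - norm (a x)) powr (1 - \<alpha>)"
            using powr_minus_divide[of "1 - norm (a x)" "1 - \<alpha>"] by simp
          ultimately show ?thesis using d_pos[OF x] by (simp add: W_def)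
        qed
        then show ?thesis unfolding e_eq by (metis (no_types, lifting) divide_inverse mult.commute mult.left_commute mult_1)
      qed
      also have "ennreal (1 / \<alpha> * (norm (h x) * W x)) = ennreal (1 / \<alpha>) * ennreal (norm (h x) * W x)"
        using \<alpha> by (intro ennreal_mult') simp
      finally show "(\<integral>\<^sup>+ s. ennreal (norm (g (x, s)) *
            min 1 (norm (w (x, s) - a x) / (1 - norm (a x)))) \<partial>unit_interval) \<le>
          ennreal (1 / \<alpha>) * ennreal (norm (h x) * W x)" .
    qed
    also have "\<dots> = ennreal (1 / \<alpha>) * ?I" unfolding I_eq by (rule nn_integral_cmult) measurable
    finally show ?thesis .
  qed
  have gfin: "?J < \<infinity>"
    using order_le_less_trans[OF gI] fin by (simp add: ennreal_mult_less_top)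
  have a': "norm (a (fst p)) < 1" and w': "norm (w p) \<le> 1" if "p \<in> space ?N" for p
    using that a \<xi> norm_chord_le[of "a (fst p)" "\<xi> (fst p)" "snd p"]
    by (auto simp: space_pair_measure w_def less_imp_le)
  have sfN: "sigma_finite_measure ?N" by unfold_locales
  have b1: "F_bounded \<alpha> (4 * ?I) (\<lambda>z. \<integral>x. e x * ?k z (\<xi> x) \<partial>M)"
    using \<xi> by (intro F_bounded_mono[OF F_bounded_superposition[OF \<alpha>(1) m\<xi> _ inte]] mult_left_mono eI) auto
  have b2: "F_bounded \<alpha> (4 * ?I) (\<lambda>z. \<integral>x. f x * ?k z (a x) \<partial>M)"
    using a by (intro F_bounded_mono[OF F_bounded_superposition[OF \<alpha>(1) ma _ intf]] mult_left_mono fI)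
      (auto simp: less_imp_le)
  have b3: "F_bounded \<alpha> (24 * (ennreal (1 / \<alpha>) * ?I)) (\<lambda>z. \<integral>p. g p * (?k z (w p) - ?k z (a (fst p))) \<partial>?N)"
  proof (rule F_bounded_mono)
    show "F_bounded \<alpha> (24 * ?J) (\<lambda>z. \<integral>p. g p * (?k z (w p) - ?k z (a (fst p))) \<partial>?N)"
      by (rule F_bounded_diff[OF \<alpha>(1) sfN ma' mw mg a' w' gfin])
    show "24 * ?J \<le> 24 * (ennreal (1 / \<alpha>) * ?I)" by (intro mult_left_mono gI) simp
  qed
  have sum: "F_bounded \<alpha> (4 * ?I + (4 * ?I + 24 * (ennreal (1 / \<alpha>) * ?I)))
      (\<lambda>z. (\<integral>x. e x * ?k z (\<xi> x) \<partial>M) + ((\<integral>x. f x * ?k z (a x) \<partial>M) +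
        (\<integral>p. g p * (?k z (w p) - ?k z (a (fst p))) \<partial>?N)))"
    by (intro F_bounded_add \<alpha> b1 b2 b3)
  have const: "4 * ?I + (4 * ?I + 24 * (ennreal (1 / \<alpha>) * ?I)) = ennreal (8 + 24 / \<alpha>) * ?I"
  proof -
    have "ennreal (8 + 24 / \<alpha>) = 4 + (4 + 24 * ennreal (1 / \<alpha>))"
    proof -
      have "ennreal (8 + 24 / \<alpha>) = ennreal (4 + (4 + 24 * (1 / \<alpha>)))" by simp
      also have "\<dots> = ennreal 4 + (ennreal 4 + ennreal 24 * ennreal (1 / \<alpha>))"
        using \<alpha> by (simp only: ennreal_plus ennreal_mult' zero_le_numeral add_nonneg_nonneg
            mult_nonneg_nonneg zero_le_divide_1_iff less_imp_le)
      finally show ?thesis by simp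
    qed
    then show ?thesis by (simp only: distrib_right mult.assoc)
  qed
  have eq: "(\<integral>x. e x * ?k z (\<xi> x) \<partial>M) + ((\<integral>x. f x * ?k z (a x) \<partial>M) +
        (\<integral>p. g p * (?k z (w p) - ?k z (a (fst p))) \<partial>?N)) =
      (\<integral>x. h x / (1 - cnj (a x) * z) * ?k z (\<xi> x) \<partial>M)" if z: "norm z < 1" for z
  proof -
    let ?c = "\<lambda>x. \<integral>s. g (x, s) * (?k z (w (x, s)) - ?k z (a x)) \<partial>unit_interval"
    have i1: "integrable M (\<lambda>x. e x * ?k z (\<xi> x))"
      using \<xi> by (intro integrable_mult_frac_kernel[OF \<alpha>(1) m\<xi> _ inte z]) auto
    have i2: "integrable M (\<lambda>x. f x * ?k z (a x))"
      using a by (intro integrable_mult_frac_kernel[OF \<alpha>(1) ma _ intf z]) (auto simp: less_imp_le)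
    note iN = integrable_mult_frac_kernel_diff[OF \<alpha>(1) ma' mw mg a' w' gfin z]
    have i3: "integrable M ?c" and c_eq: "integral\<^sup>L M ?c = (\<integral>p. g p * (?k z (w p) - ?k z (a (fst p))) \<partial>?N)"
      using integrable_fst'[OF iN] integral_fst'[OF iN] by simp_all
    have "(\<integral>x. e x * ?k z (\<xi> x) \<partial>M) + ((\<integral>x. f x * ?k z (a x) \<partial>M) + integral\<^sup>L M ?c) =
        (\<integral>x. e x * ?k z (\<xi> x) + (f x * ?k z (a x) + ?c x) \<partial>M)"
      using Bochner_Integration.integral_add[OF i1 Bochner_Integration.integrable_add[OF i2 i3]]
        Bochner_Integration.integral_add[OF i2 i3] by simp
    also have "\<dots> = (\<integral>x. h x / (1 - cnj (a x) * z) * ?k z (\<xi> x) \<partial>M)"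
    proof (intro Bochner_Integration.integral_cong refl)
      fix x assume x: "x \<in> space M"
      let ?i = "\<integral>s. of_real ((1 - \<alpha>) * s powr (\<alpha> - 2)) *
        (?k z (a x + of_real s * (\<xi> x - a x)) - ?k z (a x)) \<partial>unit_interval"
      have "?c x = - f x * ?i"
        unfolding g_def w_def fst_conv snd_conv mult.assoc by (rule integral_mult_right_zero)
      moreover have "h x / (1 - cnj (a x) * z) * ?k z (\<xi> x) = h x * (1 / (1 - cnj (a x) * z) * ?k z (\<xi> x))"
        by simp
      ultimately show "e x * ?k z (\<xi> x) + (f x * ?k z (a x) + ?c x) = h x / (1 - cnj (a x) * z) * ?k z (\<xi> x)"
        by (simp only: simple_fraction_times_frac_kernel[OF a[OF x] \<xi>[OF x] z \<alpha>])
           (simp add: e_def f_def algebra_simps)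
    qed
    finally show ?thesis by (simp only: c_eq)
  qed
  show ?thesis using sum unfolding const by (subst (asm) F_bounded_cong[OF eq])
qed

section \<open>Interpolation by sums of simple fractions\<close>

lemma lagrange_interpolation:
  fixes a :: "'i \<Rightarrow> complex"
  assumes I: "finite I" "inj_on a I" and p: "degree p < card I"
  shows "poly p z = (\<Sum>i\<in>I. poly p (a i) * (\<Prod>j\<in>I - {i}. (z - a j) / (a i - a j)))"
proof -
  define l where "l i = (\<Prod>j\<in>I - {i}. smult (1 / (a i - a j)) [:- a j, 1:])" for i
  define q where "q = (\<Sum>i\<in>I. smult (poly p (a i)) (l i))"
  have l: "poly (l i) z = (\<Prod>j\<in>I - {i}. (z - a j) / (a i - a j))" for i z
    unfolding l_def poly_prod by (intro prod.cong refl) (simp add: diff_divide_distrib)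
  have q: "poly q z = (\<Sum>i\<in>I. poly p (a i) * (\<Prod>j\<in>I - {i}. (z - a j) / (a i - a j)))" for z
    unfolding q_def poly_sum by (simp add: l)
  have deg_l: "degree (l i) < card I" if "i \<in> I" for i
  proof -
    have "degree (l i) \<le> (\<Sum>j\<in>I - {i}. degree (smult (1 / (a i - a j)) [:- a j, 1:]))"
      unfolding l_def using degree_prod_sum_le[of "I - {i}" "\<lambda>j. smult (1 / (a i - a j)) [:- a j, 1:]"] I
      by (simp add: o_def)
    also have "\<dots> \<le> (\<Sum>j\<in>I - {i}. 1)"
      by (intro sum_mono order_trans[OF degree_smult_le]) simp
    also have "\<dots> = card (I - {i})" by simp
    also have "\<dots> < card I" using that I(1) by (rule card_Diff1_less[rotated])
    finally show ?thesis .
  qed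
  have pq: "p = q"
  proof (rule poly_eqI_degree[of "a ` I"])
    have card: "card (a ` I) = card I" using I by (simp add: card_image)
    show "degree p < card (a ` I)" using p card by simp
    have "degree q < card I"
      unfolding q_def
    proof (rule degree_sum_less)
      show "0 < card I" using p by simp
    qed (use deg_l degree_smult_le order_le_less_trans in blast)
    then show "degree q < card (a ` I)" using card by simp
    fix x assume "x \<in> a ` I"
    then obtain k where k: "k \<in> I" "x = a k" by auto
    have "poly q x = (\<Sum>i\<in>I. if i = k then poly p x else 0)"
      unfolding q
    proof (rule sum.cong[OF refl])
      fix i assume i: "i \<in> I"
      show "poly p (a i) * (\<Prod>j\<in>I - {i}. (x - a j) / (a i - a j)) = (if i = k then poly p x else 0)"
      proof (cases "i = k")
        case True
        have "(\<Prod>j\<in>I - {i}. (x - a j) / (a i - a j)) = 1"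
          using I(2) i k True by (intro prod.neutral) (auto simp: inj_on_def)
        then show ?thesis using True k by simp
      next
        case False
        then have "(\<Prod>j\<in>I - {i}. (x - a j) / (a i - a j)) = 0"
          using I(1) k by (intro prod_zero) auto
        then show ?thesis using False by simp
      qed
    qed
    also have "\<dots> = poly p x" using I(1) k by simp
    finally show "poly p x = poly q x" by simp
  qed
  show ?thesis by (rule trans[OF arg_cong[OF pq, of "\<lambda>p. poly p z"] q])
qed

text \<open>
  For \<open>c \<noteq> 0\<close> this is Lagrange interpolation of \<open>\<Prod> (1 - b\<^sub>j z)\<close> at \<open>z = 1 / c\<close>, multiplied by a power of
  \<open>- c\<close>; both sides are continuous in \<open>c\<close>.
\<close>

lemma cauchy_matrix_identity:
  fixes a b :: "'i \<Rightarrow> complex"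
  assumes I: "finite I" "inj_on a I" and k: "k \<in> I"
  shows "(\<Prod>j\<in>I - {k}. b j - c) =
    (\<Sum>i\<in>I. (\<Prod>j\<in>I - {k}. 1 - b j * a i) * (\<Prod>j\<in>I - {i}. (1 - c * a j) / (a j - a i)))"
    (is "?f c = ?g c")
proof -
  have nonzero: "?f c = ?g c" if c: "c \<noteq> 0" for c
  proof -
    define p where "p = (\<Prod>j\<in>I - {k}. [:1, - b j:])"
    have p: "poly p z = (\<Prod>j\<in>I - {k}. 1 - b j * z)" for z
      unfolding p_def poly_prod by (simp add: mult.commute)
    have "degree p \<le> (\<Sum>j\<in>I - {k}. degree [:1, - b j:])"
      unfolding p_def using degree_prod_sum_le[of "I - {k}" "\<lambda>j. [:1, - b j:]"] I by (simp add: o_def)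
    also have "\<dots> \<le> (\<Sum>j\<in>I - {k}. 1)" by (intro sum_mono) simp
    also have "\<dots> = card (I - {k})" by simp
    also have "\<dots> < card I" using k I(1) by (rule card_Diff1_less[rotated])
    finally have deg: "degree p < card I" .
    have card: "(- c) ^ card (I - {i}) = (- c) ^ card (I - {k})" if "i \<in> I" for i
      using that k I by simp
    have "?f c = (\<Prod>j\<in>I - {k}. (- c) * (1 - b j * (1 / c)))"
      using c by (intro prod.cong refl) (simp add: field_simps)
    also have "\<dots> = (- c) ^ card (I - {k}) * poly p (1 / c)"
      unfolding p prod.distrib by simp
    also have "\<dots> = (\<Sum>i\<in>I. poly p (a i) *
        ((- c) ^ card (I - {k}) * (\<Prod>j\<in>I - {i}. (1 / c - a j) / (a i - a j))))"
      by (subst lagrange_interpolation[OF I deg]) (simp add: sum_distrib_left mult_ac)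
    also have "\<dots> = ?g c"
    proof (rule sum.cong[OF refl])
      fix i assume i: "i \<in> I"
      have "(- c) ^ card (I - {k}) * (\<Prod>j\<in>I - {i}. (1 / c - a j) / (a i - a j)) =
          (\<Prod>j\<in>I - {i}. (- c) * ((1 / c - a j) / (a i - a j)))"
        unfolding card[OF i, symmetric] prod.distrib by simp
      also have "\<dots> = (\<Prod>j\<in>I - {i}. (1 - c * a j) / (a j - a i))"
      proof (rule prod.cong[OF refl])
        fix j assume "j \<in> I - {i}"
        then have "a i - a j \<noteq> 0" "a j - a i \<noteq> 0" using I(2) i by (auto simp: inj_on_def)
        then show "(- c) * ((1 / c - a j) / (a i - a j)) = (1 - c * a j) / (a j - a i)"
          using c by (simp add: field_simps)
      qed
      finally show "poly p (a i) * ((- c) ^ card (I - {k}) * (\<Prod>j\<in>I - {i}. (1 / c - a j) / (a i - a j))) =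
          (\<Prod>j\<in>I - {k}. 1 - b j * a i) * (\<Prod>j\<in>I - {i}. (1 - c * a j) / (a j - a i))"
        unfolding p by simp
    qed
    finally show ?thesis .
  qed
  show ?thesis
  proof (cases "c = 0")
    case True
    have ne: "a j - a i \<noteq> 0" if "i \<in> I" "j \<in> I - {i}" for i j
      using that I(2) by (auto simp: inj_on_def)
    have f: "(?f \<longlongrightarrow> ?f 0) (at 0)"
      by (intro tendsto_intros)
    have g: "(?g \<longlongrightarrow> ?g 0) (at 0)"
      by (intro tendsto_intros ne)
    have "eventually (\<lambda>c. ?f c = ?g c) (at 0)"
      unfolding eventually_at_filter by (intro always_eventually allI impI nonzero)
    from Lim_transform_eventually[OF f this] have "(?g \<longlongrightarrow> ?f 0) (at 0)" .
    then have "?f 0 = ?g 0" by (rule tendsto_unique[OF trivial_limit_at _ g])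
    then show ?thesis unfolding True .
  qed (rule nonzero)
qed

section \<open>The inverse of the Cauchy matrix\<close>

context
  fixes a :: "'i \<Rightarrow> complex" and I :: "'i set"
  assumes I: "finite I" "inj_on a I" and disk: "\<And>i. i \<in> I \<Longrightarrow> norm (a i) < 1"
begin

text \<open>The value at \<open>a i\<close> of the finite Blaschke product whose zeros are the other
  points. Its modulus is a partial product in the sense of \<open>separation_const\<close>.\<close>

private definition "\<beta> i = (\<Prod>j\<in>I - {i}. (a j - a i) / (1 - cnj (a j) * a i))"
private definition "t i = 1 - cnj (a i) * a i"

private lemma ne:
  assumes "i \<in> I" "j \<in> I"
  shows "1 - cnj (a j) * a i \<noteq> 0"
proof (rule one_minus_not_nonpos(2))
  show "norm (cnj (a j)) \<le> 1" using disk[OF assms(2)] by simp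
  show "norm (a i) < 1" by (rule disk[OF assms(1)])
qed

private lemma diff_ne:
  assumes "i \<in> I" "j \<in> I - {i}"
  shows "a j - a i \<noteq> 0"
  using assms I(2) by (auto dest: inj_onD)

private lemma \<beta>_ne:
  assumes i: "i \<in> I"
  shows "\<beta> i \<noteq> 0"
proof -
  have nz: "(a j - a i) / (1 - cnj (a j) * a i) \<noteq> 0" if j: "j \<in> I - {i}" for j
    using diff_ne[OF i j] ne[OF i DiffD1[OF j]] unfolding divide_eq_0_iff by (intro notI) (elim disjE; blast)
  show ?thesis unfolding \<beta>_def prod_zero_iff[OF finite_Diff[OF I(1)]]
  proof
    assume "\<exists>j\<in>I - {i}. (a j - a i) / (1 - cnj (a j) * a i) = 0"
    then obtain j where j: "j \<in> I - {i}" "(a j - a i) / (1 - cnj (a j) * a i) = 0" by (rule bexE)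
    show False using nz[OF j(1)] j(2) by (rule notE)
  qed
qed

text \<open>After conjugation the summands become those of \<open>cauchy_matrix_identity\<close>
  with \<open>b j = cnj (a j)\<close> and \<open>c = cnj (a l)\<close>, divided by the product Q.
  Off the diagonal the left-hand product of that identity contains the vanishing factor j = l; on
  the diagonal it is the numerator of \<beta>.\<close>

lemma cauchy_matrix_inverse:
  assumes k: "k \<in> I" and l: "l \<in> I"
  shows "(\<Sum>i\<in>I. t i / (cnj (\<beta> i) * (1 - cnj (a i) * a k) * (1 - cnj (a i) * a l))) =
    (if k = l then \<beta> k / t k else 0)"
proof -
  let ?c = "cnj (a l)"
  let ?Q = "\<Prod>j\<in>I. 1 - ?c * a j"
  have Q: "?Q \<noteq> 0" unfolding prod_zero_iff[OF I(1)] using ne[OF _ l] by blast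
  have summand: "cnj (t i / (cnj (\<beta> i) * (1 - cnj (a i) * a k) * (1 - cnj (a i) * a l))) =
      (\<Prod>j\<in>I - {k}. 1 - cnj (a j) * a i) * (\<Prod>j\<in>I - {i}. (1 - ?c * a j) / (a j - a i)) / ?Q"
    if i: "i \<in> I" for i
  proof -
    let ?D = "\<Prod>j\<in>I - {i}. a j - a i" and ?N = "\<Prod>j\<in>I - {i}. 1 - cnj (a j) * a i"
    have D: "?D \<noteq> 0" unfolding prod_zero_iff[OF finite_Diff[OF I(1)]] using diff_ne[OF i] by blast
    have N: "?N \<noteq> 0" unfolding prod_zero_iff[OF finite_Diff[OF I(1)]] using ne[OF i] by blast
    have b: "\<beta> i = ?D / ?N" by (simp add: \<beta>_def prod_dividef)
    \<comment> \<open>Both sides are the product over all of I, once with the factor i and once with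
      the factor k taken out.\<close>
    have Nk: "t i * ?N = (1 - cnj (a k) * a i) * (\<Prod>j\<in>I - {k}. 1 - cnj (a j) * a i)"
      using prod.remove[OF I(1) i, of "\<lambda>j. 1 - cnj (a j) * a i"]
        prod.remove[OF I(1) k, of "\<lambda>j. 1 - cnj (a j) * a i"] by (simp add: t_def)
    have Q': "?Q = (1 - ?c * a i) * (\<Prod>j\<in>I - {i}. 1 - ?c * a j)"
      by (rule prod.remove[OF I(1) i])
    have E: "(\<Prod>j\<in>I - {i}. 1 - ?c * a j) \<noteq> 0" using Q Q' by auto
    have ti: "cnj (t i) = t i" by (simp add: t_def mult.commute)
    have "cnj (t i / (cnj (\<beta> i) * (1 - cnj (a i) * a k) * (1 - cnj (a i) * a l))) =
        t i / (\<beta> i * (1 - cnj (a k) * a i) * (1 - ?c * a i))"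
      by (simp add: ti mult.commute)
    also have "\<dots> = t i * ?N / (?D * (1 - cnj (a k) * a i) * (1 - ?c * a i))"
      using D N by (simp add: b)
    also have "\<dots> = (\<Prod>j\<in>I - {k}. 1 - cnj (a j) * a i) / (?D * (1 - ?c * a i))"
      unfolding Nk using ne[OF i k] by simp
    also have "\<dots> = (\<Prod>j\<in>I - {k}. 1 - cnj (a j) * a i) * (\<Prod>j\<in>I - {i}. (1 - ?c * a j) / (a j - a i)) / ?Q"
      unfolding Q' prod_dividef using E by simp
    finally show ?thesis .
  qed
  have "cnj (\<Sum>i\<in>I. t i / (cnj (\<beta> i) * (1 - cnj (a i) * a k) * (1 - cnj (a i) * a l))) =
      (\<Sum>i\<in>I. (\<Prod>j\<in>I - {k}. 1 - cnj (a j) * a i) * (\<Prod>j\<in>I - {i}. (1 - ?c * a j) / (a j - a i)) / ?Q)"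
    unfolding cnj_sum by (rule sum.cong[OF refl summand])
  also have "\<dots> = (\<Prod>j\<in>I - {k}. cnj (a j) - ?c) / ?Q"
    unfolding sum_divide_distrib[symmetric] cauchy_matrix_identity[OF I k, of "\<lambda>j. cnj (a j)" ?c, symmetric] ..
  also have "\<dots> = cnj (if k = l then \<beta> k / t k else 0)"
  proof (cases "k = l")
    case True
    have "?Q = (1 - ?c * a k) * (\<Prod>j\<in>I - {k}. 1 - ?c * a j)" by (rule prod.remove[OF I(1) k])
    then show ?thesis using True by (simp add: \<beta>_def t_def prod_dividef mult.commute)
  next
    case False
    then have "(\<Prod>j\<in>I - {k}. cnj (a j) - ?c) = 0" using I(1) l by (intro prod_zero) auto
    then show ?thesis using False by simp
  qed
  finally show ?thesis by (simp only: complex_cnj_cancel_iff)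
qed

text \<open>Interchanging the sums puts the data outside and the inverse relation inside, where only
  k = l survives. The weights t / \<beta> on the data cancel the diagonal entry \<beta> / t.\<close>

lemma finite_interpolation:
  fixes x :: "'i \<Rightarrow> complex"
  assumes l: "l \<in> I"
  shows "(\<Sum>i\<in>I. (t i / cnj (\<beta> i) * (\<Sum>k\<in>I. x k * t k / (\<beta> k * (1 - cnj (a i) * a k)))) /
    (1 - cnj (a i) * a l)) = x l"
proof -
  have t_ne: "t i \<noteq> 0" if "i \<in> I" for i using ne[OF that that] unfolding t_def .
  have "(\<Sum>i\<in>I. (t i / cnj (\<beta> i) * (\<Sum>k\<in>I. x k * t k / (\<beta> k * (1 - cnj (a i) * a k)))) /
      (1 - cnj (a i) * a l)) =
    (\<Sum>i\<in>I. \<Sum>k\<in>I. x k * t k / \<beta> k * (t i / (cnj (\<beta> i) * (1 - cnj (a i) * a k) * (1 - cnj (a i) * a l))))"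
    by (simp add: sum_distrib_left sum_divide_distrib mult_ac)
  also have "\<dots> = (\<Sum>k\<in>I. x k * t k / \<beta> k *
      (\<Sum>i\<in>I. t i / (cnj (\<beta> i) * (1 - cnj (a i) * a k) * (1 - cnj (a i) * a l))))"
    by (subst sum.swap) (simp only: sum_distrib_left)
  also have "\<dots> = (\<Sum>k\<in>I. if k = l then x k else 0)"
  proof (rule sum.cong[OF refl])
    fix k assume k: "k \<in> I"
    show "x k * t k / \<beta> k *
        (\<Sum>i\<in>I. t i / (cnj (\<beta> i) * (1 - cnj (a i) * a k) * (1 - cnj (a i) * a l))) = (if k = l then x k else 0)"
      unfolding cauchy_matrix_inverse[OF k l] using t_ne[OF k] \<beta>_ne[OF k] by (cases "k = l") simp_all
  qed
  also have "\<dots> = x l" using l I(1) by simp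
  finally show ?thesis .
qed

lemmas finite_interpolation' = finite_interpolation[unfolded \<beta>_def t_def]

end

section \<open>Consequences of separation and of the Carleson sum\<close>

text \<open>All factors are at most 1, so the partial products decrease and lie above their limit,
  which lies above the infimum over the points. That real infimum is a lower bound because the
  limits are nonnegative.\<close>

lemma partial_product_ge_separation_const:
  assumes a: "range a \<subseteq> ball 0 1"
  shows "separation_const a \<le> norm (\<Prod>j\<in>{..<N} - {i}. (a j - a i) / (1 - cnj (a j) * a i))"
proof -
  have a1: "norm (a k) < 1" for k using a by (auto simp: subset_iff)
  define P where "P n N = (\<Prod>k\<in>{..<N} - {n}. norm ((a k - a n) / (1 - cnj (a k) * a n)))" for n N
  have le1: "norm ((a k - a n) / (1 - cnj (a k) * a n)) \<le> 1" for k n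
    using moebius_bound(2)[of "cnj (a k)" "- a n"] a1[of k] a1[of n]
    by (simp add: norm_divide norm_minus_commute)
  have P0: "0 \<le> P n N" for n N by (simp add: P_def prod_nonneg)
  have dec: "decseq (P n)" for n
  proof (rule decseq_SucI)
    fix N
    show "P n (Suc N) \<le> P n N"
    proof (cases "N = n")
      case True
      then have "{..<Suc N} - {n} = {..<N} - {n}" by auto
      then show ?thesis by (simp add: P_def)
    next
      case False
      then have "{..<Suc N} - {n} = insert N ({..<N} - {n})" by auto
      then have "P n (Suc N) = norm ((a N - a n) / (1 - cnj (a N) * a n)) * P n N" by (simp add: P_def)
      then show ?thesis using le1 P0 by (simp only: mult_left_le_one_le norm_ge_zero)
    qed
  qed
  \<comment> \<open>\<open>lim\<close> carries information only for convergent sequences; here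
    monotonicity and nonnegativity give convergence.\<close>
  have "convergent (P n)" for n
    using P0 by (intro Bseq_monoseq_convergent decseq_imp_monoseq dec BseqI'[of _ "P n 0"])
      (use dec[of n] in \<open>auto simp: decseq_def\<close>)
  then have lim: "P n \<longlonglongrightarrow> lim (P n)" for n by (simp add: convergent_LIMSEQ_iff)
  have lim0: "0 \<le> lim (P n)" for n by (rule LIMSEQ_le_const[OF lim], rule exI[of _ 0]) (simp add: P0)
  have "separation_const a \<le> lim (P i)"
    unfolding separation_const_def P_def[symmetric]
    using lim0 by (intro cINF_lower bdd_belowI2[where m = 0]) auto
  also have "\<dots> \<le> P i N" by (rule decseq_ge[OF dec lim])
  also have "\<dots> = norm (\<Prod>j\<in>{..<N} - {i}. (a j - a i) / (1 - cnj (a j) * a i))"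
    by (simp add: P_def prod_norm)
  finally show ?thesis .
qed

lemma inj_if_separation_const_pos:
  assumes a: "range a \<subseteq> ball 0 1" and sep: "separation_const a > 0"
  shows "inj a"
proof (rule injI, rule ccontr)
  fix m n assume mn: "a m = a n" "m \<noteq> n"
  then have zero: "(\<Prod>j\<in>{..<Suc m} - {n}. (a j - a n) / (1 - cnj (a j) * a n)) = 0"
    by (intro prod_zero bexI[of _ m]) auto
  have "separation_const a \<le> norm (\<Prod>j\<in>{..<Suc m} - {n}. (a j - a n) / (1 - cnj (a j) * a n))"
    by (rule partial_product_ge_separation_const[OF a])
  then show False using sep unfolding zero by simp
qed

lemma carleson_sum_partial:
  assumes "carleson_sum \<alpha> a < \<infinity>" "norm \<xi> = 1"
  shows "(\<Sum>k<N. ((1 - (norm (a k))\<^sup>2) / norm (1 - cnj \<xi> * a k)) powr \<alpha>) \<le> enn2real (carleson_sum \<alpha> a)"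
proof -
  let ?r = "\<lambda>k. ((1 - (norm (a k))\<^sup>2) / norm (1 - cnj \<xi> * a k)) powr \<alpha>"
  have "ennreal (\<Sum>k<N. ?r k) = (\<Sum>k<N. ennreal (?r k))" by (rule sum_ennreal[symmetric]) simp
  also have "\<dots> \<le> (\<Sum>k. ennreal (?r k))" by (intro sum_le_suminf) auto
  also have "\<dots> \<le> carleson_sum \<alpha> a" unfolding carleson_sum_def using assms(2) by (intro SUP_upper) auto
  also have "\<dots> = ennreal (enn2real (carleson_sum \<alpha> a))" using assms(1) by simp
  finally show ?thesis by (subst (asm) ennreal_le_iff) auto
qed

text \<open>The Cauchy matrix calls for exponent 1, while the hypothesis has exponent \<alpha>.
  Since 1 - |a|^2 \<le> 2 (1 - |a|), each quotient r is at most 2, so r =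
  \<open>r powr \<alpha> * r powr (1 - \<alpha>)\<close> is at most 2
  \<open>r powr \<alpha>\<close>.\<close>

lemma carleson_sum_partial_linear:
  assumes \<alpha>: "0 < \<alpha>" "\<alpha> \<le> 1" and a: "range a \<subseteq> ball 0 1"
    and fin: "carleson_sum \<alpha> a < \<infinity>" and \<xi>: "norm \<xi> = 1"
  shows "(\<Sum>k<N. (1 - (norm (a k))\<^sup>2) / norm (1 - cnj \<xi> * a k)) \<le> 2 * enn2real (carleson_sum \<alpha> a)"
proof -
  have "(1 - (norm (a k))\<^sup>2) / norm (1 - cnj \<xi> * a k) \<le>
      2 * ((1 - (norm (a k))\<^sup>2) / norm (1 - cnj \<xi> * a k)) powr \<alpha>" for k
  proof -
    let ?r = "(1 - (norm (a k))\<^sup>2) / norm (1 - cnj \<xi> * a k)"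
    have a1: "norm (a k) < 1" using a by (auto simp: subset_iff)
    have d: "1 - norm (a k) \<le> norm (1 - cnj \<xi> * a k)"
      using Re_one_minus_pos(1)[of "cnj \<xi>" "a k"] a1 \<xi> complex_Re_le_cmod[of "1 - cnj \<xi> * a k"] by simp
    then have d0: "0 < norm (1 - cnj \<xi> * a k)" using a1 by linarith
    have t: "1 - (norm (a k))\<^sup>2 = (1 - norm (a k)) * (1 + norm (a k))" by (simp add: power2_eq_square algebra_simps)
    have "(1 - norm (a k)) * (1 + norm (a k)) \<le> norm (1 - cnj \<xi> * a k) * 2"
      using a1 d by (intro mult_mono) auto
    then have r2: "?r \<le> 2" using d0 unfolding t by (simp add: field_simps)
    have r0: "0 < ?r"
      unfolding t using d0 a1 by (intro divide_pos_pos mult_pos_pos add_pos_nonneg) auto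
    have "q = q powr \<alpha> * q powr (1 - \<alpha>)" if "0 < q" for q :: real
      using that by (simp flip: powr_add)
    from this[OF r0] have "?r = ?r powr \<alpha> * ?r powr (1 - \<alpha>)" .
    also have "\<dots> \<le> ?r powr \<alpha> * 2 powr (1 - \<alpha>)"
      using r0 r2 \<alpha> by (intro mult_left_mono powr_mono2) auto
    also have "\<dots> \<le> ?r powr \<alpha> * 2 powr 1" using \<alpha> by (intro mult_left_mono powr_mono) auto
    finally show ?thesis by simp
  qed
  then have "(\<Sum>k<N. (1 - (norm (a k))\<^sup>2) / norm (1 - cnj \<xi> * a k)) \<le>
      (\<Sum>k<N. 2 * ((1 - (norm (a k))\<^sup>2) / norm (1 - cnj \<xi> * a k)) powr \<alpha>)"
    by (intro sum_mono)
  also have "\<dots> \<le> 2 * enn2real (carleson_sum \<alpha> a)"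
    unfolding sum_distrib_left[symmetric] by (intro mult_left_mono carleson_sum_partial[OF fin \<xi>]) simp
  finally show ?thesis .
qed

text \<open>
  A point \<open>w\<close> of the disk is compared with the nearest point \<open>\<xi>\<close> of the circle:
  \<open>\<bar>1 - cnj \<xi> z\<bar> \<le> 2 \<bar>1 - cnj w z\<bar>\<close>.
\<close>

lemma carleson_sum_partial_inner:
  assumes \<alpha>: "0 < \<alpha>" "\<alpha> \<le> 1" and a: "range a \<subseteq> ball 0 1"
    and fin: "carleson_sum \<alpha> a < \<infinity>" and w: "norm w < 1"
  shows "(\<Sum>k<N. (1 - (norm (a k))\<^sup>2) / norm (1 - cnj w * a k)) \<le> 4 * enn2real (carleson_sum \<alpha> a)"
proof -
  \<comment> \<open>The centre has no distinguished nearest point, and \<open>sgn 0 = 0\<close> is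
    not on the circle; any unimodular value serves.\<close>
  define \<xi> where "\<xi> = (if w = 0 then 1 else sgn w)"
  have \<xi>: "norm \<xi> = 1" by (simp add: \<xi>_def norm_sgn)
  have "w = of_real (norm w) * \<xi>"
    by (simp add: \<xi>_def sgn_div_norm scaleR_conv_of_real)
  then have "\<xi> - w = of_real (1 - norm w) * \<xi>" by (metis left_diff_distrib mult_1 of_real_1 of_real_diff)
  then have dist: "norm (\<xi> - w) = 1 - norm w" using \<xi> w by (simp only: norm_mult norm_of_real) simp
  have "(1 - (norm (a k))\<^sup>2) / norm (1 - cnj w * a k) \<le> 2 * ((1 - (norm (a k))\<^sup>2) / norm (1 - cnj \<xi> * a k))" for k
  proof -
    have a1: "norm (a k) < 1" using a by (auto simp: subset_iff)
    have d: "1 - norm w \<le> norm (1 - cnj w * a k)"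
      using Re_one_minus_pos(1)[of "a k" "cnj w"] a1 w complex_Re_le_cmod[of "1 - cnj w * a k"]
      by (simp add: mult.commute)
    have "norm (cnj \<xi>) \<le> 1" using \<xi> by simp
    from Re_one_minus_pos(2)[OF this a1] have pos: "0 < norm (1 - cnj \<xi> * a k)"
      using complex_Re_le_cmod[of "1 - cnj \<xi> * a k"] by linarith
    have "1 - cnj \<xi> * a k = (1 - cnj w * a k) - cnj (\<xi> - w) * a k" by (simp add: algebra_simps)
    then have "norm (1 - cnj \<xi> * a k) \<le> norm (1 - cnj w * a k) + norm (cnj (\<xi> - w) * a k)"
      by (metis norm_triangle_ineq4)
    also have "norm (cnj (\<xi> - w) * a k) \<le> (1 - norm w) * 1"
      using a1 w by (simp only: norm_mult complex_mod_cnj dist) (intro mult_left_mono, auto)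
    finally have "norm (1 - cnj \<xi> * a k) \<le> 2 * norm (1 - cnj w * a k)" using d by simp
    moreover have "0 \<le> 1 - (norm (a k))\<^sup>2" using a1 by (simp add: power_le_one)
    moreover have "0 < norm (1 - cnj w * a k)" using d w by linarith
    ultimately have "(1 - (norm (a k))\<^sup>2) / (2 * norm (1 - cnj w * a k)) \<le> (1 - (norm (a k))\<^sup>2) / norm (1 - cnj \<xi> * a k)"
      using pos by (intro divide_left_mono mult_pos_pos) simp_all
    moreover have "u / v \<le> 2 * q" if "u / (2 * v) \<le> q" for u v q :: real using that by simp
    ultimately show ?thesis by blast
  qed
  then have "(\<Sum>k<N. (1 - (norm (a k))\<^sup>2) / norm (1 - cnj w * a k)) \<le>
      (\<Sum>k<N. 2 * ((1 - (norm (a k))\<^sup>2) / norm (1 - cnj \<xi> * a k)))"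
    by (intro sum_mono)
  also have "\<dots> \<le> 2 * (2 * enn2real (carleson_sum \<alpha> a))"
    unfolding sum_distrib_left[symmetric] by (intro mult_left_mono carleson_sum_partial_linear[OF \<alpha> a fin \<xi>]) simp
  finally show ?thesis by simp
qed

text \<open>The Blaschke condition, read off at w = 0. It supplies the majorants for Tannery's
  theorem and for the M-test.\<close>

lemma summable_carleson:
  assumes \<alpha>: "0 < \<alpha>" "\<alpha> \<le> 1" and a: "range a \<subseteq> ball 0 1" and fin: "carleson_sum \<alpha> a < \<infinity>"
  shows "summable (\<lambda>k. 1 - (norm (a k))\<^sup>2)"
proof (rule summableI_nonneg_bounded)
  show "0 \<le> 1 - (norm (a k))\<^sup>2" for k
    using a by (auto simp: subset_iff power_le_one less_imp_le)
  show "(\<Sum>k<N. 1 - (norm (a k))\<^sup>2) \<le> 4 * enn2real (carleson_sum \<alpha> a)" for N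
    using carleson_sum_partial_inner[OF \<alpha> a fin, of 0 N] by simp
qed

section \<open>Coefficients for infinitely many points\<close>

text \<open>The finite solutions satisfy a bound independent of N, which allows a diagonal
  extraction and survives the limit. In the constant, the factors 1 / \<delta> come from the
  Blaschke products at i and at k, and 4 \<sigma> from the Carleson sum at the interior point w =
  \<open>a i\<close>.\<close>

lemma interpolating_coefficients:
  fixes a x :: "nat \<Rightarrow> complex"
  assumes \<alpha>: "0 < \<alpha>" "\<alpha> \<le> 1" and a: "range a \<subseteq> ball 0 1"
    and sep: "separation_const a > 0" and fin: "carleson_sum \<alpha> a < \<infinity>" and x: "\<And>k. norm (x k) \<le> X"
  shows "\<exists>d. (\<forall>i. norm (d i) \<le>
      4 * enn2real (carleson_sum \<alpha> a) * X / (separation_const a)\<^sup>2 * (1 - (norm (a i))\<^sup>2)) \<and>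
    (\<forall>l. (\<lambda>i. d i / (1 - cnj (a i) * a l)) sums x l)"
proof -
  define \<sigma> where "\<sigma> = enn2real (carleson_sum \<alpha> a)"
  define \<delta> where "\<delta> = separation_const a"
  define C where "C = 4 * \<sigma> * X / \<delta>\<^sup>2"
  define t where "t i = 1 - (norm (a i))\<^sup>2" for i
  have a1: "norm (a k) < 1" for k using a by (auto simp: subset_iff)
  have t0: "0 \<le> t i" for i using a1[of i] by (simp add: t_def power_le_one)
  have t1: "t i \<le> 1" for i by (simp add: t_def)
  have \<delta>: "0 < \<delta>" using sep by (simp add: \<delta>_def)
  have \<sigma>0: "0 \<le> \<sigma>" by (simp add: \<sigma>_def)
  have X0: "0 \<le> X" using x[of 0] norm_ge_zero order_trans by blast
  have C0: "0 \<le> C" using \<sigma>0 X0 by (simp add: C_def)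
  define \<beta> where "\<beta> N i = (\<Prod>j\<in>{..<N} - {i}. (a j - a i) / (1 - cnj (a j) * a i))" for N i
  have \<beta>: "\<delta> \<le> norm (\<beta> N i)" for N i
    unfolding \<beta>_def \<delta>_def by (rule partial_product_ge_separation_const[OF a])
  have t_eq: "1 - cnj (a i) * a i = of_real (t i)" for i
    using complex_norm_square[of "a i"] by (simp add: t_def mult.commute)
  \<comment> \<open>Extended by 0 beyond N, the finite solutions become sequences on the same index
    set, so that limits can be taken index by index.\<close>
  define D where "D N i = (if i < N then of_real (t i) / cnj (\<beta> N i) *
    (\<Sum>k<N. x k * of_real (t k) / (\<beta> N k * (1 - cnj (a i) * a k))) else 0)" for N i
  have D_interp: "(\<Sum>i<N. D N i / (1 - cnj (a i) * a l)) = x l" if "l < N" for N l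
  proof -
    have inj: "inj_on a {..<N}" using inj_if_separation_const_pos[OF a sep] by (rule inj_on_subset) simp
    show ?thesis
      using finite_interpolation'[of "{..<N}" a l x] inj a1 that
      unfolding \<beta>_def[symmetric] t_eq by (simp add: D_def)
  qed
  have D_le: "norm (D N i) \<le> C * t i" for N i
  proof (cases "i < N")
    case True
    have "norm (\<Sum>k<N. x k * of_real (t k) / (\<beta> N k * (1 - cnj (a i) * a k))) \<le>
        (\<Sum>k<N. X / \<delta> * (t k / norm (1 - cnj (a i) * a k)))"
    proof (rule sum_norm_le)
      fix k
      have "norm (x k * of_real (t k) / (\<beta> N k * (1 - cnj (a i) * a k))) =
          norm (x k) / norm (\<beta> N k) * (t k / norm (1 - cnj (a i) * a k))"
        using t0[of k] by (simp add: norm_mult norm_divide)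
      also have "\<dots> \<le> X / \<delta> * (t k / norm (1 - cnj (a i) * a k))"
        using x \<beta> \<delta> t0 X0 by (intro mult_right_mono frac_le divide_nonneg_nonneg) auto
      finally show "norm (x k * of_real (t k) / (\<beta> N k * (1 - cnj (a i) * a k))) \<le>
          X / \<delta> * (t k / norm (1 - cnj (a i) * a k))" .
    qed
    also have "\<dots> \<le> X / \<delta> * (4 * \<sigma>)"
      unfolding sum_distrib_left[symmetric] t_def \<sigma>_def
      using X0 \<delta> by (intro mult_left_mono carleson_sum_partial_inner[OF \<alpha> a fin a1]) auto
    finally have S: "norm (\<Sum>k<N. x k * of_real (t k) / (\<beta> N k * (1 - cnj (a i) * a k))) \<le> X / \<delta> * (4 * \<sigma>)" .
    have "norm (D N i) = t i / norm (\<beta> N i) *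
        norm (\<Sum>k<N. x k * of_real (t k) / (\<beta> N k * (1 - cnj (a i) * a k)))"
      using True t0[of i] by (simp add: D_def norm_mult norm_divide)
    also have "\<dots> \<le> t i / \<delta> * (X / \<delta> * (4 * \<sigma>))"
      using S \<beta> \<delta> t0 by (intro mult_mono frac_le) auto
    also have "\<dots> = C * t i" by (simp add: C_def power2_eq_square)
    finally show ?thesis .
  qed (use C0 t0 in \<open>simp add: D_def\<close>)
  \<comment> \<open>The extraction only needs boundedness; the sharper bound by
    \<open>C * t i\<close> is kept for the limit.\<close>
  have D_le_C: "norm (D N i) \<le> C" for N i
    by (rule order_trans[OF D_le mult_left_le[OF t1 C0]])
  have "\<exists>r. strict_mono r \<and> (\<forall>i. \<exists>l. (\<lambda>n. D (r n) i) \<longlonglongrightarrow> l)"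
  proof (rule function_convergent_subsequence[of "UNIV :: nat set" D C])
    fix r :: "nat \<Rightarrow> nat"
    assume "strict_mono r" "\<And>i. i \<in> UNIV \<Longrightarrow> \<exists>l. (\<lambda>n. D (r n) i) \<longlonglongrightarrow> l"
    then show ?thesis by (intro exI[of _ r] conjI allI) simp_all
  qed (simp_all add: D_le_C)
  then obtain r where r: "strict_mono r" "\<forall>i. \<exists>l. (\<lambda>n. D (r n) i) \<longlonglongrightarrow> l" by blast
  obtain d where d: "\<And>i. (\<lambda>n. D (r n) i) \<longlonglongrightarrow> d i" using choice[OF r(2)] by blast
  have d_le: "norm (d i) \<le> C * t i" for i
    by (rule LIMSEQ_le_const2[OF tendsto_norm[OF d]]) (intro exI allI impI D_le)
  have "(\<lambda>i. d i / (1 - cnj (a i) * a l)) sums x l" for l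
  proof -
    let ?M = "\<lambda>i. C / (1 - norm (a l)) * t i"
    have den: "1 - norm (a l) \<le> norm (1 - cnj (a i) * a l)" for i
      using Re_one_minus_pos(1)[of "cnj (a i)" "a l"] a1[of i] a1[of l] complex_Re_le_cmod[of "1 - cnj (a i) * a l"]
      by simp
    have le: "norm (u / (1 - cnj (a i) * a l)) \<le> ?M i" if "norm u \<le> C * t i" for u i
    proof -
      have "norm u / norm (1 - cnj (a i) * a l) \<le> (C * t i) / (1 - norm (a l))"
        using that den[of i] a1[of l] C0 t0[of i] by (intro frac_le mult_nonneg_nonneg) auto
      then show ?thesis by (simp add: norm_divide)
    qed
    have sM: "summable ?M"
      using summable_carleson[OF \<alpha> a fin] unfolding t_def by (rule summable_mult)
    \<comment> \<open>For fixed l the denominators are at least 1 - |a_l|, so a multiple of the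
      Blaschke sequence dominates all the finite solutions, and the limit passes through the
      sum.\<close>
    have "eventually (\<lambda>(i, n). norm (D (r n) i / (1 - cnj (a i) * a l)) \<le> ?M i) (at_top \<times>\<^sub>F sequentially)"
      using le[OF D_le] by (intro always_eventually) auto
    from tannerys_theorem[OF tendsto_divide[OF d tendsto_const] this sM]
    have T: "(\<lambda>n. \<Sum>i. D (r n) i / (1 - cnj (a i) * a l)) \<longlonglongrightarrow> (\<Sum>i. d i / (1 - cnj (a i) * a l))"
      using one_minus_not_nonpos(2)[of "cnj (a _)" "a l"] a1 by (auto simp: less_imp_le)
    have "(\<Sum>i. D (r n) i / (1 - cnj (a i) * a l)) = x l" if n: "l < n" for n
    proof -
      have "l < r n" using n seq_suble[OF r(1), of n] by simp
      moreover have "(\<Sum>i. D (r n) i / (1 - cnj (a i) * a l)) = (\<Sum>i<r n. D (r n) i / (1 - cnj (a i) * a l))"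
        by (rule suminf_finite) (auto simp: D_def)
      ultimately show ?thesis using D_interp by simp
    qed
    then have "(\<lambda>n. \<Sum>i. D (r n) i / (1 - cnj (a i) * a l)) \<longlonglongrightarrow> x l"
      by (intro tendsto_eventually eventually_mono[OF eventually_gt_at_top[of l]])
    then have "(\<Sum>i. d i / (1 - cnj (a i) * a l)) = x l" using T LIMSEQ_unique by blast
    moreover have "summable (\<lambda>i. d i / (1 - cnj (a i) * a l))"
      by (rule summable_comparison_test'[OF sM]) (rule le[OF d_le])
    ultimately show ?thesis by (simp add: sums_iff)
  qed
  then show ?thesis using d_le unfolding C_def \<sigma>_def \<delta>_def t_def by (intro exI[of _ d]) auto
qed

section \<open>Multipliers\<close>

lemma F_norm_le: "F_bounded \<alpha> K g \<Longrightarrow> F_norm \<alpha> g \<le> K"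
  unfolding F_bounded_def F_norm_def by (auto intro: INF_lower2)

lemma F_bounded_imp_F_space: "F_bounded \<alpha> K g \<Longrightarrow> g \<in> F_space \<alpha>"
  unfolding F_bounded_def F_space_def by auto

lemma F_bounded_sum_list_same:
  assumes \<alpha>: "0 < \<alpha>" and "\<And>p. p \<in> set ps \<Longrightarrow> F_bounded \<alpha> K (G p)"
  shows "F_bounded \<alpha> (of_nat (length ps) * K) (\<lambda>z. \<Sum>p\<leftarrow>ps. G p z)"
  using assms(2)
proof (induction ps)
  case Nil
  then show ?case using F_bounded_sum_list[OF \<alpha>, of "[]" "\<lambda>_. 0"] by simp
next
  case (Cons p ps)
  then have "F_bounded \<alpha> (K + of_nat (length ps) * K) (\<lambda>z. G p z + (\<Sum>p\<leftarrow>ps. G p z))"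
    by (intro F_bounded_add[OF \<alpha>]) auto
  then show ?case by (simp add: distrib_right)
qed

lemma norm_simple_fraction_le:
  fixes a d :: "nat \<Rightarrow> complex"
  assumes a: "range a \<subseteq> ball 0 1" and C: "0 \<le> C"
    and d: "\<And>i. norm (d i) \<le> C * (1 - (norm (a i))\<^sup>2)"
    and z: "norm z \<le> r" "r < 1"
  shows "norm (d i / (1 - cnj (a i) * z)) \<le> C / (1 - r) * (1 - (norm (a i))\<^sup>2)"
proof -
  have a1: "norm (a i) < 1" using a by (auto simp: subset_iff)
  have "1 - r \<le> norm (1 - cnj (a i) * z)"
    using Re_one_minus_pos(1)[of "cnj (a i)" z] a1 z complex_Re_le_cmod[of "1 - cnj (a i) * z"] by simp
  then have "norm (d i) / norm (1 - cnj (a i) * z) \<le> (C * (1 - (norm (a i))\<^sup>2)) / (1 - r)"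
    using d[of i] z(2) order_trans[OF norm_ge_zero d] by (intro frac_le) auto
  then show ?thesis by (simp add: norm_divide)
qed

lemma holomorphic_simple_fractions:
  fixes a d :: "nat \<Rightarrow> complex"
  assumes a: "range a \<subseteq> ball 0 1" and C: "0 \<le> C"
    and d: "\<And>i. norm (d i) \<le> C * (1 - (norm (a i))\<^sup>2)"
    and sum: "summable (\<lambda>i. 1 - (norm (a i))\<^sup>2)"
  shows "(\<lambda>z. \<Sum>i. d i / (1 - cnj (a i) * z)) holomorphic_on ball 0 1"
proof (rule holomorphic_uniform_sequence[OF open_ball])
  have a1: "norm (a i) < 1" for i using a by (auto simp: subset_iff)
  show "(\<lambda>z. \<Sum>i<n. d i / (1 - cnj (a i) * z)) holomorphic_on ball 0 1" for n
    using one_minus_not_nonpos(2)[of "cnj (a _)"] a1 by (intro holomorphic_intros) (simp add: less_imp_le)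
  fix x :: complex assume x: "x \<in> ball 0 1"
  \<comment> \<open>Then |x| = 1 - 2 e, so the closed ball of radius e about x stays within |z|
    \<le> 1 - e, where the majorant is uniform.\<close>
  define e where "e = (1 - norm x) / 2"
  have e: "0 < e" "1 - e < 1" using x by (simp_all add: e_def)
  have le: "norm z \<le> 1 - e" if "z \<in> cball x e" for z
    using that norm_triangle_ineq2[of z x] by (simp add: e_def dist_norm norm_minus_commute field_simps)
  have "uniform_limit (cball x e) (\<lambda>n z. \<Sum>i<n. d i / (1 - cnj (a i) * z))
      (\<lambda>z. \<Sum>i. d i / (1 - cnj (a i) * z)) sequentially"
    by (rule Weierstrass_m_test[OF norm_simple_fraction_le[OF a C d le e(2)] summable_mult[OF sum]])
  moreover have "cball x e \<subseteq> ball 0 1" using le e by (force simp: subset_iff)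
  ultimately show "\<exists>e>0. cball x e \<subseteq> ball 0 1 \<and> uniform_limit (cball x e)
      (\<lambda>n z. \<Sum>i<n. d i / (1 - cnj (a i) * z)) (\<lambda>z. \<Sum>i. d i / (1 - cnj (a i) * z)) sequentially"
    using e(1) by blast
qed

section \<open>Multiplication by the series\<close>

text \<open>Converts the weight of one fraction into a term of the Carleson sum. From t = 1 - |a|^2
  \<le> 2 \<rho> with \<rho> = 1 - |a| it follows that
  \<open>t powr (1 - \<alpha>) * \<rho> powr (\<alpha> - 1)\<close> is at most 2.\<close>

lemma fraction_weight_le:
  fixes a \<xi> :: complex
  assumes \<alpha>: "0 < \<alpha>" "\<alpha> \<le> 1" and a: "norm a < 1" and \<xi>: "norm \<xi> = 1"
  shows "(1 - (norm a)\<^sup>2) * (norm (1 - cnj a * \<xi>) powr - \<alpha> * (1 - norm a) powr (\<alpha> - 1)) \<le>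
    2 * ((1 - (norm a)\<^sup>2) / norm (1 - cnj \<xi> * a)) powr \<alpha>"
proof -
  define \<rho> where "\<rho> = 1 - norm a"
  define t where "t = 1 - (norm a)\<^sup>2"
  define D where "D = norm (1 - cnj \<xi> * a)"
  have \<rho>: "0 < \<rho>" using a by (simp add: \<rho>_def)
  have "t = \<rho> * (1 + norm a)" by (simp add: t_def \<rho>_def power2_eq_square algebra_simps)
  then have t: "0 < t" "t \<le> 2 * \<rho>" using \<rho> a by (simp_all add: mult_pos_pos add_pos_nonneg)
  have "cnj (1 - cnj a * \<xi>) = 1 - cnj \<xi> * a" by (simp add: mult.commute)
  then have D_eq: "norm (1 - cnj a * \<xi>) = D" unfolding D_def by (metis complex_mod_cnj)
  have q: "q = q powr \<alpha> * q powr (1 - \<alpha>)" if "0 < q" for q :: real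
    using that by (simp flip: powr_add)
  have "t powr (1 - \<alpha>) \<le> (2 * \<rho>) powr (1 - \<alpha>)" using t \<alpha> by (intro powr_mono2) auto
  also have "\<dots> = 2 powr (1 - \<alpha>) * \<rho> powr (1 - \<alpha>)" using \<rho> by (simp add: powr_mult)
  also have "\<dots> \<le> 2 powr 1 * \<rho> powr (1 - \<alpha>)" using \<alpha> by (intro mult_right_mono powr_mono) auto
  finally have "t powr (1 - \<alpha>) \<le> 2 * \<rho> powr (1 - \<alpha>)" by simp
  then have "t powr (1 - \<alpha>) * \<rho> powr (\<alpha> - 1) \<le> 2 * \<rho> powr (1 - \<alpha>) * \<rho> powr (\<alpha> - 1)"
    by (rule mult_right_mono) simp
  also have "2 * \<rho> powr (1 - \<alpha>) * \<rho> powr (\<alpha> - 1) = 2"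
    using \<rho> powr_add[of \<rho> "1 - \<alpha>" "\<alpha> - 1"] by simp
  finally have le: "t powr (1 - \<alpha>) * \<rho> powr (\<alpha> - 1) \<le> 2" .
  have "t * (D powr - \<alpha> * \<rho> powr (\<alpha> - 1)) =
      (t powr \<alpha> * D powr - \<alpha>) * (t powr (1 - \<alpha>) * \<rho> powr (\<alpha> - 1))"
    by (subst q[OF t(1)]) (simp only: mult_ac)
  also have "\<dots> \<le> (t powr \<alpha> * D powr - \<alpha>) * 2" by (intro mult_left_mono le) simp
  also have "\<dots> = 2 * (t / D) powr \<alpha>"
    using t by (simp add: powr_divide D_def powr_minus_divide del: powr_minus)
  finally show ?thesis unfolding D_eq by (simp only: t_def \<rho>_def D_def)
qed

text \<open>The series and the integral against P are merged into one integral over P times counting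
  measure, to which the estimate for simple fractions applies as a whole. For fixed \<xi> the sum
  over the indices is at most 2 C times the Carleson sum, so the total is proportional to the mass
  of P.\<close>

lemma F_bounded_multiplier_measure:
  fixes a d :: "nat \<Rightarrow> complex"
  assumes \<alpha>: "0 < \<alpha>" "\<alpha> \<le> 1" and a: "range a \<subseteq> ball 0 1" and fin: "carleson_sum \<alpha> a < \<infinity>"
    and C: "0 \<le> C" and d: "\<And>i. norm (d i) \<le> C * (1 - (norm (a i))\<^sup>2)"
    and P: "finite_measure P" "sets P = sets circle_borel" and c: "norm c = 1"
  shows "F_bounded \<alpha> (ennreal (8 + 24 / \<alpha>) * (ennreal (2 * C) * carleson_sum \<alpha> a * emeasure P (sphere 0 1)))
    (\<lambda>z. (\<Sum>i. d i / (1 - cnj (a i) * z)) * (c * integral\<^sup>L P (frac_kernel \<alpha> z)))"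
proof -
  interpret P: finite_measure P by fact
  interpret N: sigma_finite_measure "count_space (UNIV :: nat set)"
    by (rule sigma_finite_measure_count_space)
  interpret pair_sigma_finite P "count_space (UNIV :: nat set)" ..
  let ?M = "P \<Otimes>\<^sub>M count_space (UNIV :: nat set)"
  have spP: "space P = sphere 0 1" using sets_eq_imp_space_eq[OF P(2)] by simp
  have mP: "f \<in> borel_measurable P" if "f \<in> borel_measurable borel" for f :: "complex \<Rightarrow> complex"
    using measurable_circle_borelI[OF that] measurable_cong_sets[OF P(2) refl] by blast
  have a1: "norm (a i) < 1" for i using a by (auto simp: subset_iff)
  have m\<xi> [measurable]: "fst \<in> borel_measurable ?M"
    by (rule measurable_compose[OF measurable_fst mP]) simp
  have ma: "(\<lambda>p. a (snd p)) \<in> borel_measurable ?M"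
    by (rule measurable_compose[OF measurable_snd]) simp
  have mh: "(\<lambda>p. c * d (snd p)) \<in> borel_measurable ?M"
    by (intro borel_measurable_times borel_measurable_const) (rule measurable_compose[OF measurable_snd], simp)
  let ?W = "\<lambda>p. norm (c * d (snd p)) * (norm (1 - cnj (a (snd p)) * fst p) powr - \<alpha> *
        (1 - norm (a (snd p))) powr (\<alpha> - 1))"
  have mW: "(\<lambda>p. ennreal (?W p)) \<in> borel_measurable ?M"
    using ma mh by measurable
  have "(\<integral>\<^sup>+ p. ennreal (?W p) \<partial>?M) = (\<integral>\<^sup>+ \<xi>. (\<Sum>i. ennreal (?W (\<xi>, i))) \<partial>P)"
    using N.nn_integral_fst[OF mW] by (simp add: nn_integral_count_space_nat)
  also have "\<dots> \<le> (\<integral>\<^sup>+ \<xi>. ennreal (2 * C) * carleson_sum \<alpha> a \<partial>P)"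
  proof (rule nn_integral_mono)
    fix \<xi> assume "\<xi> \<in> space P"
    then have \<xi>: "norm \<xi> = 1" by (simp add: spP)
    let ?r = "\<lambda>i. ((1 - (norm (a i))\<^sup>2) / norm (1 - cnj \<xi> * a i)) powr \<alpha>"
    have "(\<Sum>i. ennreal (?W (\<xi>, i))) \<le> (\<Sum>i. ennreal (2 * C) * ennreal (?r i))"
    proof (rule suminf_le)
      fix i
      let ?w = "norm (1 - cnj (a i) * \<xi>) powr - \<alpha> * (1 - norm (a i)) powr (\<alpha> - 1)"
      have "norm (c * d i) * ?w \<le> (C * (1 - (norm (a i))\<^sup>2)) * ?w"
        using d[of i] c by (intro mult_right_mono) (simp_all add: norm_mult)
      also have "\<dots> = C * ((1 - (norm (a i))\<^sup>2) * ?w)" by simp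
      also have "\<dots> \<le> C * (2 * ?r i)"
        by (intro mult_left_mono C fraction_weight_le[OF \<alpha> a1 \<xi>])
      finally have "norm (c * d i) * ?w \<le> 2 * C * ?r i" by simp
      then have "ennreal (norm (c * d i) * ?w) \<le> ennreal (2 * C * ?r i)" by (rule ennreal_leI)
      also have "\<dots> = ennreal (2 * C) * ennreal (?r i)" using C by (intro ennreal_mult') simp
      finally show "ennreal (?W (\<xi>, i)) \<le> ennreal (2 * C) * ennreal (?r i)" by simp
    qed auto
    also have "\<dots> = ennreal (2 * C) * (\<Sum>i. ennreal (?r i))" by (rule ennreal_suminf_cmult)
    also have "\<dots> \<le> ennreal (2 * C) * carleson_sum \<alpha> a"
      unfolding carleson_sum_def using \<xi> by (intro mult_left_mono SUP_upper) auto
    finally show "(\<Sum>i. ennreal (?W (\<xi>, i))) \<le> ennreal (2 * C) * carleson_sum \<alpha> a" .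
  qed
  also have "\<dots> = ennreal (2 * C) * carleson_sum \<alpha> a * emeasure P (sphere 0 1)"
    by (simp add: spP)
  finally have I: "(\<integral>\<^sup>+ p. ennreal (?W p) \<partial>?M) \<le> ennreal (2 * C) * carleson_sum \<alpha> a * emeasure P (sphere 0 1)" .
  have "emeasure P (sphere 0 1) < \<infinity>"
    unfolding infinity_ennreal_def less_top[symmetric] by (rule P.emeasure_finite)
  then have "ennreal (2 * C) * carleson_sum \<alpha> a * emeasure P (sphere 0 1) < \<infinity>"
    using fin by (simp add: ennreal_mult_less_top)
  then have Ifin: "(\<integral>\<^sup>+ p. ennreal (?W p) \<partial>?M) < \<infinity>" using I by (rule order_le_less_trans[rotated])
  have "F_bounded \<alpha> (ennreal (8 + 24 / \<alpha>) * (\<integral>\<^sup>+ p. ennreal (?W p) \<partial>?M))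
      (\<lambda>z. \<integral>p. c * d (snd p) / (1 - cnj (a (snd p)) * z) * frac_kernel \<alpha> z (fst p) \<partial>?M)"
  proof (rule F_bounded_simple_fraction[OF \<alpha> _ ma m\<xi> mh])
    show "sigma_finite_measure ?M" by unfold_locales
    show "norm (fst p) = 1" if "p \<in> space ?M" for p
      using that by (auto simp: space_pair_measure spP)
  qed (use a1 Ifin in auto)
  then have "F_bounded \<alpha> (ennreal (8 + 24 / \<alpha>) * (ennreal (2 * C) * carleson_sum \<alpha> a * emeasure P (sphere 0 1)))
      (\<lambda>z. \<integral>p. c * d (snd p) / (1 - cnj (a (snd p)) * z) * frac_kernel \<alpha> z (fst p) \<partial>?M)"
    by (rule F_bounded_mono) (intro mult_left_mono I, simp)
  moreover have "(\<integral>p. c * d (snd p) / (1 - cnj (a (snd p)) * z) * frac_kernel \<alpha> z (fst p) \<partial>?M) =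
      (\<Sum>i. d i / (1 - cnj (a i) * z)) * (c * integral\<^sup>L P (frac_kernel \<alpha> z))" if z: "norm z < 1" for z
  proof -
    define e where "e i = d i / (1 - cnj (a i) * z)" for i
    let ?k = "frac_kernel \<alpha> z"
    let ?F = "\<lambda>p. c * d (snd p) / (1 - cnj (a (snd p)) * z) * ?k (fst p)"
    have se: "summable (\<lambda>i. norm (e i))"
      unfolding e_def
      by (rule summable_comparison_test'[OF summable_mult[where c = "C / (1 - norm z)", OF summable_carleson[OF \<alpha> a fin]]])
         (simp only: real_norm_def abs_norm_cancel norm_simple_fraction_le[OF a C d order_refl z])
    then have ie: "integrable (count_space UNIV) e" by (simp add: integrable_count_space_nat_iff)
    have ik: "integrable P ?k"
    proof (rule P.integrable_const_bound)
      show "AE x in P. norm (?k x) \<le> (1 - norm z) powr - \<alpha>"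
        using norm_frac_kernel_le z \<alpha>(1) by (intro AE_I2) (simp add: spP)
    qed (intro mP, measurable)
    have F_eq: "?F (x, i) = c * ?k x * e i" for x i by (simp add: e_def)
    have int: "integrable ?M ?F"
    proof (rule Fubini_integrable)
      show "?F \<in> borel_measurable ?M" using ma mh by measurable
      show "AE x in P. integrable (count_space UNIV) (\<lambda>i. ?F (x, i))"
        unfolding F_eq using ie by (intro AE_I2) simp
      have "(\<integral>i. norm (?F (x, i)) \<partial>count_space UNIV) = norm (?k x) * (\<integral>i. norm (e i) \<partial>count_space UNIV)" for x
        unfolding F_eq norm_mult c by simp
      then show "integrable P (\<lambda>x. \<integral>i. norm (?F (x, i)) \<partial>count_space UNIV)"
        using ik by simp
    qed
    have "integral\<^sup>L ?M ?F = (\<integral>x. \<integral>i. ?F (x, i) \<partial>count_space UNIV \<partial>P)"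
      by (rule integral_fst'[OF int, symmetric])
    also have "\<dots> = (\<integral>x. c * ?k x * (\<Sum>i. e i) \<partial>P)"
      unfolding F_eq by (simp add: integral_count_space_nat[OF ie])
    also have "\<dots> = (\<Sum>i. e i) * (c * integral\<^sup>L P ?k)" by simp
    finally show ?thesis by (simp only: e_def)
  qed
  ultimately show ?thesis by (subst (asm) F_bounded_cong) auto
qed

text \<open>The hypothesis bounds the product by the mass of any representing measure, whereas the
  norm is an infimum. A measure of mass less than 1 + e' is chosen, and e' tends to 0.\<close>

lemma F_norm_multiplier_le:
  assumes bound: "\<And>\<mu> g. represents \<alpha> \<mu> g \<Longrightarrow>
      F_bounded \<alpha> (ennreal K * total_variation circle_borel \<mu>) (\<lambda>z. f z * g z)"
    and K: "0 \<le> K" and g: "g \<in> F_space \<alpha>" "F_norm \<alpha> g \<le> 1"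
  shows "F_norm \<alpha> (\<lambda>z. f z * g z) \<le> ennreal K"
proof (rule ennreal_le_epsilon)
  fix e :: real assume e: "0 < e"
  \<comment> \<open>K may be 0, so the division is by K + 1.\<close>
  define e' where "e' = e / (K + 1)"
  have e': "0 < e'" "K * e' \<le> e" using e K by (simp_all add: e'_def field_simps)
  have "F_norm \<alpha> g < ennreal (1 + e')"
    using g(2) e' by (intro order_le_less_trans[OF g(2)]) (simp add: ennreal_1[symmetric] ennreal_less_iff del: ennreal_1)
  then obtain \<mu> where \<mu>: "represents \<alpha> \<mu> g" "total_variation circle_borel \<mu> < ennreal (1 + e')"
    unfolding F_norm_def INF_less_iff by auto
  have "F_norm \<alpha> (\<lambda>z. f z * g z) \<le> ennreal K * total_variation circle_borel \<mu>"
    by (rule F_norm_le[OF bound[OF \<mu>(1)]])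
  also have "\<dots> \<le> ennreal K * ennreal (1 + e')" using \<mu>(2) by (intro mult_left_mono) auto
  also have "\<dots> = ennreal (K + K * e')" using K by (simp add: ennreal_mult'[symmetric] algebra_simps)
  also have "\<dots> \<le> ennreal (K + e)" using e' by (intro ennreal_leI) simp
  also have "\<dots> = ennreal K + ennreal e" using K e by (intro ennreal_plus) auto
  finally show "F_norm \<alpha> (\<lambda>z. f z * g z) \<le> ennreal K + ennreal e" .
qed

theorem lemma1:
  fixes \<alpha> :: real
  assumes "0 < \<alpha>" and "\<alpha> \<le> 1"
  shows "\<exists>c :: real. c > 0 \<and>
    (\<forall>a :: nat \<Rightarrow> complex.
       range a \<subseteq> ball 0 1 \<and> separation_const a > 0 \<and> carleson_sum \<alpha> a < \<infinity> \<longrightarrow>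
       (\<forall>x :: nat \<Rightarrow> complex. bounded (range x) \<longrightarrow>
          (\<exists>f \<in> multipliers \<alpha>.
             (\<forall>k. f (a k) = x k) \<and>
             multiplier_norm \<alpha> f \<le>
               ennreal c * (carleson_sum \<alpha> a / ennreal (separation_const a))\<^sup>2
                 * ennreal (SUP k. norm (x k)))))"
proof (intro exI[of _ "32 * (8 + 24 / \<alpha>)"] conjI allI impI)
  show "0 < 32 * (8 + 24 / \<alpha>)" using assms by (simp add: add_pos_pos)
  fix a x :: "nat \<Rightarrow> complex"
  assume "range a \<subseteq> ball 0 1 \<and> separation_const a > 0 \<and> carleson_sum \<alpha> a < \<infinity>" and bx: "bounded (range x)"
  then have a: "range a \<subseteq> ball 0 1" and sep: "separation_const a > 0" and fin: "carleson_sum \<alpha> a < \<infinity>"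
    by auto
  define X where "X = (SUP k. norm (x k))"
  define \<sigma> where "\<sigma> = enn2real (carleson_sum \<alpha> a)"
  define \<delta> where "\<delta> = separation_const a"
  define C where "C = 4 * \<sigma> * X / \<delta>\<^sup>2"
  have \<sigma>: "carleson_sum \<alpha> a = ennreal \<sigma>" "0 \<le> \<sigma>" using fin by (simp_all add: \<sigma>_def)
  have \<delta>: "0 < \<delta>" using sep by (simp add: \<delta>_def)
  have "bdd_above (range (\<lambda>k. norm (x k)))"
    using bx by (auto simp: bounded_iff bdd_above_def)
  then have X: "norm (x k) \<le> X" for k unfolding X_def by (intro cSUP_upper) auto
  have X0: "0 \<le> X" using X[of 0] norm_ge_zero order_trans by blast
  have C: "0 \<le> C" using X0 \<sigma>(2) by (simp add: C_def)
  obtain d where d: "\<And>i. norm (d i) \<le> C * (1 - (norm (a i))\<^sup>2)"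
    and interp: "\<And>l. (\<lambda>i. d i / (1 - cnj (a i) * a l)) sums x l"
    using interpolating_coefficients[where x = x, OF assms a sep fin X, folded \<sigma>_def \<delta>_def, folded C_def] by auto
  define f where "f z = (\<Sum>i. d i / (1 - cnj (a i) * z))" for z
  \<comment> \<open>32 = 4 * 2 * 4: four Jordan parts of the representing measure, the 2 in
    \<open>2 * C\<close>, and the 4 in C. The square arises as C \<sigma> = 4 X (\<sigma> /
    \<delta>)^2.\<close>
  define K where "K = 32 * (8 + 24 / \<alpha>) * (\<sigma> / \<delta>)\<^sup>2 * X"
  have K0: "0 \<le> K" using X0 assms by (simp add: K_def)
  have bound: "F_bounded \<alpha> (ennreal K * total_variation circle_borel \<mu>) (\<lambda>z. f z * g z)"
    if rep: "represents \<alpha> \<mu> g" for \<mu> g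
  proof -
    let ?T = "total_variation circle_borel \<mu>"
    obtain ps where ps: "map (norm \<circ> fst) ps = [1, 1, 1, 1]"
      "\<forall>(c, P) \<in> set ps. finite_measure P \<and> sets P = sets circle_borel \<and> emeasure P (sphere 0 1) \<le> ?T"
      "\<forall>z. norm z < 1 \<longrightarrow> g z = (\<Sum>(c, P)\<leftarrow>ps. c * integral\<^sup>L P (frac_kernel \<alpha> z))"
      using represents_as_sum_list[OF rep] by (elim exE conjE) (rule that; assumption)
    let ?L = "ennreal (8 + 24 / \<alpha>) * (ennreal (2 * C) * carleson_sum \<alpha> a * ?T)"
    have "F_bounded \<alpha> (of_nat (length ps) * ?L)
        (\<lambda>z. \<Sum>p\<leftarrow>ps. f z * (fst p * integral\<^sup>L (snd p) (frac_kernel \<alpha> z)))"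
    proof (rule F_bounded_sum_list_same[OF assms(1)])
      fix p assume p: "p \<in> set ps"
      have P: "finite_measure (snd p)" "sets (snd p) = sets circle_borel" "emeasure (snd p) (sphere 0 1) \<le> ?T"
        using ps(2) p by auto
      have "norm (fst p) \<in> set (map (norm \<circ> fst) ps)" using p by auto
      then have c: "norm (fst p) = 1" unfolding ps(1) by simp
      show "F_bounded \<alpha> ?L (\<lambda>z. f z * (fst p * integral\<^sup>L (snd p) (frac_kernel \<alpha> z)))"
        unfolding f_def
        by (rule F_bounded_mono[OF F_bounded_multiplier_measure[OF assms a fin C d P(1,2) c]])
           (intro mult_left_mono P(3), auto)
    qed
    moreover have "(\<Sum>p\<leftarrow>ps. f z * (fst p * integral\<^sup>L (snd p) (frac_kernel \<alpha> z))) = f z * g z"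
      if "norm z < 1" for z
      using ps(3) that by (simp add: sum_list_const_mult case_prod_unfold)
    moreover have "length ps = 4" using arg_cong[OF ps(1), of length] by simp
    moreover have "4 * ?L = ennreal K * ?T"
    proof -
      have K_eq: "K = 4 * ((8 + 24 / \<alpha>) * (2 * C * \<sigma>))"
        by (simp add: K_def C_def power2_eq_square)
      have "ennreal K = ennreal 4 * (ennreal (8 + 24 / \<alpha>) * (ennreal (2 * C) * ennreal \<sigma>))"
      proof -
        have "ennreal (p * (q * (r * s))) = ennreal p * (ennreal q * (ennreal r * ennreal s))"
          if "0 \<le> p" "0 \<le> q" "0 \<le> r" "0 \<le> s" for p q r s :: real
          using that by (simp add: ennreal_mult)
        from this[of 4 "8 + 24 / \<alpha>" "2 * C" \<sigma>] show ?thesis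
          unfolding K_eq using assms(1) C \<sigma>(2) by (auto intro: add_nonneg_nonneg)
      qed
      then show ?thesis by (simp add: \<sigma>(1) mult_ac)
    qed
    ultimately show ?thesis by (subst (asm) F_bounded_cong) auto
  qed
  show "\<exists>f \<in> multipliers \<alpha>. (\<forall>k. f (a k) = x k) \<and> multiplier_norm \<alpha> f \<le>
      ennreal (32 * (8 + 24 / \<alpha>)) * (carleson_sum \<alpha> a / ennreal (separation_const a))\<^sup>2 * ennreal (SUP k. norm (x k))"
  proof (intro bexI[of _ f] conjI allI)
    show "f \<in> multipliers \<alpha>"
      unfolding multipliers_def
    proof (intro CollectI conjI ballI)
      show "f holomorphic_on ball 0 1"
        unfolding f_def[abs_def]
        by (rule holomorphic_simple_fractions[OF a C d summable_carleson[OF assms a fin]])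
      show "(\<lambda>z. f z * g z) \<in> F_space \<alpha>" if "g \<in> F_space \<alpha>" for g
        using that bound F_bounded_imp_F_space unfolding F_space_def by blast
    qed
    show "f (a k) = x k" for k unfolding f_def using interp by (simp add: sums_iff)
    have "multiplier_norm \<alpha> f \<le> ennreal K"
      unfolding multiplier_norm_def
      using F_norm_multiplier_le[OF bound K0] by (intro SUP_least) auto
    also have "ennreal K = ennreal (32 * (8 + 24 / \<alpha>)) * (carleson_sum \<alpha> a / ennreal (separation_const a))\<^sup>2 *
        ennreal (SUP k. norm (x k))"
      unfolding \<sigma>(1) \<delta>_def[symmetric] X_def[symmetric] K_def
      using assms \<sigma>(2) \<delta> X0 by (simp add: divide_ennreal ennreal_power ennreal_mult)
    finally show "multiplier_norm \<alpha> f \<le> ennreal (32 * (8 + 24 / \<alpha>)) *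
        (carleson_sum \<alpha> a / ennreal (separation_const a))\<^sup>2 * ennreal (SUP k. norm (x k))" .
  qed
qed

end
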